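(* Consider an $n$-photon, $m$-mode boson sampling instance given by an $m\times m$ unitary $U$ and an input Fock state $\ket{\vec{S}}=\ket{s_1,\ldots,s_m}$ with $\sum_i s_i=n$, where the $s_i$ are arbitrary nonnegative integers (not necessarily $\le 1$). Let $\alpha_S$ be the number of indices $i$ with $s_i\neq 0$. There exists a classical algorithm that outputs a sample $\vec{T}$ distributed exactly according to $p_U(\vec{S}\to\vec{T})$, together with the probability $p_U(\vec{S}\to\vec{T})$ of the sampled outcome, in time upper bounded by $$\mathcal{T}= n\, m \prod_{j=1}^m (s_j+1)^2\, \alpha_S .$$
   Context: Fock states $\ket{\vec{S}}=\prod_i (a_i^\dagger)^{s_i}/\sqrt{s_i!}\ket{0}$ are labeled by occupation vectors. A passive linear-optical transformation given by an $m\times m$ unitary $U$ maps $a_i^\dagger\mapsto\sum_j U_{ji}a_j^\dagger$. Measuring photon numbers in all output modes yields outcome $\vec{T}=(t_1,\ldots,t_m)$, $\sum t_i=n$, with probability $p_U(\vec{S}\to\vec{T})=|\mathrm{Per}(U_{S,T})|^2/(\prod_i s_i!\prod_i t_i!)$, where $U_{S,T}$ is the $n\times n$ matrix obtained by first forming the $m\times n$ matrix $U_S$ consisting of $s_i$ copies of the $i$-th column of $U$, and then taking $t_j$ copies of the $j$-th row of $U_S$. Time is counted in elementary arithmetic operations. *)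

theory Defs
  imports "HOL-Probability.Probability"
begin

text \<open>Matrices of varying size are functions nat => nat => complex with explicit bounds.
  Mode indices are 0..m-1, photon indices 0..n-1.\<close>

definition unitary_mat :: "nat \<Rightarrow> (nat \<Rightarrow> nat \<Rightarrow> complex) \<Rightarrow> bool" where
  "unitary_mat m U \<longleftrightarrow>
     (\<forall>i<m. \<forall>j<m. (\<Sum>k<m. U k i * cnj (U k j)) = (if i = j then 1 else 0))"

definition permanent :: "nat \<Rightarrow> (nat \<Rightarrow> nat \<Rightarrow> complex) \<Rightarrow> complex" where
  "permanent n A = (\<Sum>\<sigma> | \<sigma> permutes {..<n}. \<Prod>i<n. A i (\<sigma> i))"

definition occ_vec :: "nat \<Rightarrow> nat \<Rightarrow> (nat \<Rightarrow> nat) \<Rightarrow> bool" where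
  "occ_vec m n s \<longleftrightarrow> (\<forall>i\<ge>m. s i = 0) \<and> (\<Sum>i<m. s i) = n"

text \<open>The mode of the k-th photon when modes are listed with multiplicity s
  (mode i repeated s i times).\<close>
definition mode_of :: "(nat \<Rightarrow> nat) \<Rightarrow> nat \<Rightarrow> nat" where
  "mode_of s k = (LEAST j. k < (\<Sum>l\<le>j. s l))"

text \<open>U_{S,T}: s_i copies of the i-th column, then t_j copies of the j-th row.\<close>
definition sub_mat :: "(nat \<Rightarrow> nat \<Rightarrow> complex) \<Rightarrow> (nat \<Rightarrow> nat) \<Rightarrow> (nat \<Rightarrow> nat) \<Rightarrow> nat \<Rightarrow> nat \<Rightarrow> complex" where
  "sub_mat U s t a b = U (mode_of t a) (mode_of s b)"

definition bs_prob :: "nat \<Rightarrow> (nat \<Rightarrow> nat \<Rightarrow> complex) \<Rightarrow> (nat \<Rightarrow> nat) \<Rightarrow> (nat \<Rightarrow> nat) \<Rightarrow> real" where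
  "bs_prob m U s t =
     (cmod (permanent (\<Sum>i<m. s i) (sub_mat U s t)))\<^sup>2 /
     ((\<Prod>i<m. fact (s i)) * (\<Prod>i<m. fact (t i)))"

datatype instr =
    Const nat complex
  | Add nat nat nat
  | Sub nat nat nat
  | Mul nat nat nat
  | Div nat nat nat              (* division by 0 gives 0 *)
  | Conj nat nat
  | Load nat nat
  | Store nat nat
  | JumpLe nat nat nat
  | Rand nat
  | Halt

type_synonym mstate = "nat \<times> (nat \<Rightarrow> complex) \<times> nat"

definition addr :: "complex \<Rightarrow> nat" where
  "addr z = nat \<lfloor>Re z\<rfloor>"

fun exec :: "instr \<Rightarrow> (nat \<Rightarrow> real) \<Rightarrow> mstate \<Rightarrow> mstate" where
  "exec (Const k c) \<omega> (pc, r, q) = (Suc pc, r(k := c), q)"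
| "exec (Add i j k) \<omega> (pc, r, q) = (Suc pc, r(k := r i + r j), q)"
| "exec (Sub i j k) \<omega> (pc, r, q) = (Suc pc, r(k := r i - r j), q)"
| "exec (Mul i j k) \<omega> (pc, r, q) = (Suc pc, r(k := r i * r j), q)"
| "exec (Div i j k) \<omega> (pc, r, q) = (Suc pc, r(k := r i / r j), q)"
| "exec (Conj i k) \<omega> (pc, r, q) = (Suc pc, r(k := cnj (r i)), q)"
| "exec (Load k i) \<omega> (pc, r, q) = (Suc pc, r(k := r (addr (r i))), q)"
| "exec (Store i k) \<omega> (pc, r, q) = (Suc pc, r(addr (r i) := r k), q)"
| "exec (JumpLe i j t) \<omega> (pc, r, q) = ((if Re (r i) \<le> Re (r j) then t else Suc pc), r, q)"
| "exec (Rand k) \<omega> (pc, r, q) = (Suc pc, r(k := complex_of_real (\<omega> q)), Suc q)"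
| "exec Halt \<omega> (pc, r, q) = (pc, r, q)"

definition halted :: "instr list \<Rightarrow> mstate \<Rightarrow> bool" where
  "halted P st = (fst st \<ge> length P \<or> P ! fst st = Halt)"

definition step :: "instr list \<Rightarrow> (nat \<Rightarrow> real) \<Rightarrow> mstate \<Rightarrow> mstate" where
  "step P \<omega> st = (if halted P st then st else exec (P ! fst st) \<omega> st)"

definition run :: "instr list \<Rightarrow> (nat \<Rightarrow> real) \<Rightarrow> nat \<Rightarrow> mstate \<Rightarrow> mstate" where
  "run P \<omega> t st = (step P \<omega> ^^ t) st"

definition final_mem :: "instr list \<Rightarrow> (nat \<Rightarrow> real) \<Rightarrow> mstate \<Rightarrow> nat \<Rightarrow> complex" where
  "final_mem P \<omega> st = fst (snd (run P \<omega> (LEAST t. halted P (run P \<omega> t st)) st))"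

definition rand_space :: "(nat \<Rightarrow> real) measure" where
  "rand_space = PiM UNIV (\<lambda>_. uniform_measure lborel {0..1})"

definition input_mem :: "nat \<Rightarrow> nat \<Rightarrow> (nat \<Rightarrow> nat \<Rightarrow> complex) \<Rightarrow> (nat \<Rightarrow> nat) \<Rightarrow> nat \<Rightarrow> complex" where
  "input_mem m n U s a =
     (if a = 0 then of_nat m
      else if a = 1 then of_nat n
      else if a < 2 + m * m then U ((a - 2) div m) ((a - 2) mod m)
      else if a < 2 + m * m + m then of_nat (s (a - 2 - m * m))
      else 0)"

definition init_state :: "nat \<Rightarrow> nat \<Rightarrow> (nat \<Rightarrow> nat \<Rightarrow> complex) \<Rightarrow> (nat \<Rightarrow> nat) \<Rightarrow> mstate" where
  "init_state m n U s = (0, input_mem m n U s, 0)"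

text \<open>Output encoding: r_i = t_i for i < m, r_m = p_U(S -> T).\<close>
definition outputs :: "nat \<Rightarrow> (nat \<Rightarrow> complex) \<Rightarrow> (nat \<Rightarrow> nat) \<Rightarrow> bool" where
  "outputs m r t \<longleftrightarrow> (\<forall>i<m. r i = of_nat (t i))"

definition time_bound :: "nat \<Rightarrow> (nat \<Rightarrow> nat) \<Rightarrow> nat" where
  "time_bound m s = (\<Sum>i<m. s i) * m * (\<Prod>j<m. (s j + 1)^2) * card {i. i < m \<and> s i \<noteq> 0}"

end

theory Submission
  imports Defs
begin

text \<open>
  Write the state as a polynomial in the creation operators, starting from the monomial with exponent
  vector s divided by the product of the factorials of s. Detecting a photon in output mode r applies
  the operator that sums U r j times the derivative with respect to variable j, and by unitarity the squared norms of the results for all r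
  add up to the number of remaining photons times the squared norm before. Hence the photons can be
  detected one at a time, each mode being chosen with probability proportional to the squared norm
  of its result. After n detections the state is a number, the permanent divided by the
  product of the factorials of s, and all orderings of an outcome T contribute equally.

  The state is stored through its derivatives at the exponent vectors below s, of which there are
  N, the product of the numbers s j + 1; in this form the update needs no multiplicities. A new
  entry costs one step per occupied input mode plus at most N steps per mode to decode its index,
  so evaluating all m candidate detections n times takes time of order n m N N times the number of
  occupied modes.
\<close>

section \<open>Structured programs and their compilation\<close>

text \<open>In the basis of monomials divided by their factorials a derivative lowers one exponent
  with coefficient 1. The coefficients in this basis are the derivatives at 0, which explains the
  recursion without multiplicities and the division by factorials in the squared norm. Nothing is
  ever normalised: the random number is scaled by the total weight, and the probability identities
  are products instead of quotients, so states of weight 0 need no special treatment by the program.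
  A second obstacle is the machine. One fixed program must serve every m, its input starts at cell
  0, and its output must end up in the cells 0 to m. Any cell that an instruction can name may
  therefore hold input at the beginning and output at the end, so the lowest 32 cells have to be
  evacuated first and filled last. Moreover, halting within the bound and correctness of the
  reported probability are claimed for every random sequence, also for one that leaves the unit
  interval; only the distribution is a statement about measure.\<close>

datatype com =
    Block "instr list"
  | Seq com com (infixr ";;" 60)
  | Cond nat nat com com
  | Until nat nat com

fun csize :: "com \<Rightarrow> nat" where
  "csize (Block is) = length is"
| "csize (a ;; b) = csize a + csize b"
| "csize (Cond i j a b) = csize a + csize b + 2"
| "csize (Until i j a) = csize a + 2"

text \<open>Jump targets are absolute, hence the start address \<open>p\<close>. In
  \<open>Cond\<close> the code for a failed comparison comes first, since \<open>JumpLe\<close>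
  jumps exactly when the comparison holds; \<open>JumpLe 0 0\<close> is an unconditional jump. No
  \<open>Halt\<close> is emitted: the program stops by running off its end.\<close>

fun compile :: "nat \<Rightarrow> com \<Rightarrow> instr list" where
  "compile p (Block is) = is"
| "compile p (a ;; b) = compile p a @ compile (p + csize a) b"
| "compile p (Cond i j a b) =
     [JumpLe i j (p + csize b + 2)] @ compile (p + 1) b @
     [JumpLe 0 0 (p + csize a + csize b + 2)] @ compile (p + csize b + 2) a"
| "compile p (Until i j a) =
     [JumpLe i j (p + csize a + 2)] @ compile (p + 1) a @ [JumpLe 0 0 p]"

lemma length_compile [simp]: "length (compile p c) = csize c"
  by (induction c arbitrary: p) auto

fun straight :: "instr \<Rightarrow> bool" where
  "straight (JumpLe _ _ _) = False"
| "straight Halt = False"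
| "straight _ = True"

definition effect :: "(nat \<Rightarrow> real) \<Rightarrow> instr \<Rightarrow> (nat \<Rightarrow> complex) \<times> nat \<Rightarrow> (nat \<Rightarrow> complex) \<times> nat" where
  "effect \<omega> i st = snd (exec i \<omega> (0, st))"

lemma effect_simps [simp]:
  "effect \<omega> (Const k c) (r, q) = (r(k := c), q)"
  "effect \<omega> (Add i j k) (r, q) = (r(k := r i + r j), q)"
  "effect \<omega> (Sub i j k) (r, q) = (r(k := r i - r j), q)"
  "effect \<omega> (Mul i j k) (r, q) = (r(k := r i * r j), q)"
  "effect \<omega> (Div i j k) (r, q) = (r(k := r i / r j), q)"
  "effect \<omega> (Conj i k) (r, q) = (r(k := cnj (r i)), q)"
  "effect \<omega> (Load k i) (r, q) = (r(k := r (addr (r i))), q)"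
  "effect \<omega> (Store i k) (r, q) = (r(addr (r i) := r k), q)"
  "effect \<omega> (Rand k) (r, q) = (r(k := complex_of_real (\<omega> q)), Suc q)"
  by (simp_all add: effect_def)

lemma exec_straight: "straight i \<Longrightarrow> exec i \<omega> (pc, st) = (Suc pc, effect \<omega> i st)"
  by (cases st; cases i) (auto simp: effect_def)

text \<open>The step count is exact and includes the jumps inserted by \<open>compile\<close>. The
  program counter is left out; a state is the memory together with the number of random numbers
  consumed.\<close>

inductive big :: "(nat \<Rightarrow> real) \<Rightarrow> com \<Rightarrow> (nat \<Rightarrow> complex) \<times> nat \<Rightarrow> nat \<Rightarrow> (nat \<Rightarrow> complex) \<times> nat \<Rightarrow> bool"
  for \<omega> where
  Block: "list_all straight is \<Longrightarrow> big \<omega> (Block is) st (length is) (fold (effect \<omega>) is st)"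
| Seq: "big \<omega> a st t st' \<Longrightarrow> big \<omega> b st' t' st'' \<Longrightarrow> big \<omega> (a ;; b) st (t + t') st''"
| CondT: "Re (fst st i) \<le> Re (fst st j) \<Longrightarrow> big \<omega> a st t st' \<Longrightarrow> big \<omega> (Cond i j a b) st (Suc t) st'"
| CondF: "\<not> Re (fst st i) \<le> Re (fst st j) \<Longrightarrow> big \<omega> b st t st' \<Longrightarrow> big \<omega> (Cond i j a b) st (t + 2) st'"
| UntilT: "Re (fst st i) \<le> Re (fst st j) \<Longrightarrow> big \<omega> (Until i j a) st 1 st"
| UntilF: "\<not> Re (fst st i) \<le> Re (fst st j) \<Longrightarrow> big \<omega> a st t st' \<Longrightarrow> big \<omega> (Until i j a) st' t' st'' \<Longrightarrow>
    big \<omega> (Until i j a) st (t + 2 + t') st''"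

section \<open>Correctness of the compilation\<close>

definition code_at :: "instr list \<Rightarrow> nat \<Rightarrow> instr list \<Rightarrow> bool" where
  "code_at P p xs \<longleftrightarrow> (\<exists>us vs. P = us @ xs @ vs \<and> length us = p)"

lemma code_at_append:
  "code_at P p (xs @ ys) \<longleftrightarrow> code_at P p xs \<and> code_at P (p + length xs) ys"
proof (intro iffI conjI)
  assume "code_at P p (xs @ ys)"
  then obtain us vs where *: "P = us @ (xs @ ys) @ vs" "length us = p"
    by (auto simp: code_at_def)
  show "code_at P p xs"
    unfolding code_at_def using * by (intro exI[of _ us] exI[of _ "ys @ vs"]) simp
  show "code_at P (p + length xs) ys"
    unfolding code_at_def using * by (intro exI[of _ "us @ xs"] exI[of _ vs]) simp
next
  assume "code_at P p xs \<and> code_at P (p + length xs) ys"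
  then obtain us vs where us: "P = us @ xs @ vs" "length us = p"
    unfolding code_at_def by blast
  from \<open>_ \<and> _\<close> obtain us' vs' where us': "P = us' @ ys @ vs'" "length us' = p + length xs"
    unfolding code_at_def by blast
  note * = us us'
  from *(1,3) have "(us @ xs) @ vs = us' @ ys @ vs'" by simp
  hence "us @ xs = us' \<and> vs = ys @ vs'"
    by (subst (asm) append_eq_append_conv) (use * in auto)
  thus "code_at P p (xs @ ys)"
    unfolding code_at_def using * by (intro exI[of _ us] exI[of _ vs']) simp
qed

lemma code_at_nth: "code_at P p [x] \<Longrightarrow> p < length P \<and> P ! p = x"
  by (auto simp: code_at_def)

lemma run_0 [simp]: "run P \<omega> 0 st = st"
  by (simp add: run_def)

lemma run_add: "run P \<omega> (t + t') st = run P \<omega> t' (run P \<omega> t st)"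
  by (simp add: run_def funpow_add add.commute[of t])

lemma run_Suc: "run P \<omega> (Suc t) st = run P \<omega> t (step P \<omega> st)"
  by (simp add: run_def funpow_swap1)

lemma step_jump: "code_at P p [JumpLe i j l] \<Longrightarrow>
    step P \<omega> (p, st) = (if Re (fst st i) \<le> Re (fst st j) then l else Suc p, st)"
  by (cases st) (auto simp: step_def halted_def dest!: code_at_nth)

lemma run_block: "list_all straight is \<Longrightarrow> code_at P p is \<Longrightarrow>
    run P \<omega> (length is) (p, st) = (p + length is, fold (effect \<omega>) is st)"
proof (induction "is" arbitrary: p st)
  case (Cons i "is")
  have "code_at P p [i]" "code_at P (Suc p) is"
    using Cons.prems(2) code_at_append[of P p "[i]" "is"] by simp_all
  moreover from this have "step P \<omega> (p, st) = (Suc p, effect \<omega> i st)"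
    using Cons.prems(1) by (auto simp: step_def halted_def exec_straight dest!: code_at_nth)
  ultimately show ?case
    using Cons by (simp add: run_Suc)
qed simp

text \<open>The code may sit anywhere inside a larger program \<open>P\<close>; the induction needs
  this for the subcommands, each compiled for its own address.\<close>

lemma compile_correct:
  "big \<omega> c st t st' \<Longrightarrow> code_at P p (compile p c) \<Longrightarrow>
     run P \<omega> t (p, st) = (p + csize c, st')"
proof (induction arbitrary: p rule: big.induct)
  case (Block "is" st)
  thus ?case by (simp add: run_block)
next
  case (Seq a st t st' b t' st'')
  from Seq.prems show ?case
    by (auto simp: code_at_append run_add Seq.IH add.assoc)
next
  case (CondT st i j a t st' b)
  from CondT.prems have *: "code_at P p [JumpLe i j (p + csize b + 2)]"
      "code_at P (p + csize b + 2) (compile (p + csize b + 2) a)"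
    unfolding compile.simps code_at_append by (simp_all add: algebra_simps)
  show ?case
    using CondT.hyps CondT.IH[OF *(2)] by (simp add: run_Suc step_jump[OF *(1)] add_ac)
next
  case (CondF st i j b t st' a)
  from CondF.prems have *: "code_at P p [JumpLe i j (p + csize b + 2)]"
      "code_at P (p + 1) (compile (p + 1) b)"
      "code_at P (p + 1 + csize b) [JumpLe 0 0 (p + csize a + csize b + 2)]"
    unfolding compile.simps code_at_append by simp_all
  have "run P \<omega> (t + 2) (p, st) = run P \<omega> (Suc 0) (run P \<omega> t (step P \<omega> (p, st)))"
    by (metis add_2_eq_Suc' run_Suc run_add Suc_eq_plus1 One_nat_def add_Suc)
  thus ?case
    using CondF.hyps CondF.IH[OF *(2)] step_jump[OF *(3), of \<omega> st']
    by (simp add: run_Suc step_jump[OF *(1)] add.assoc)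
next
  case (UntilT st i j a)
  from UntilT.prems have *: "code_at P p [JumpLe i j (p + csize a + 2)]"
    unfolding compile.simps code_at_append by simp_all
  show ?case
    using UntilT.hyps by (simp add: run_Suc step_jump[OF *])
next
  case (UntilF st i j a t st' t' st'')
  from UntilF.prems have *: "code_at P p [JumpLe i j (p + csize a + 2)]"
      "code_at P (p + 1) (compile (p + 1) a)"
      "code_at P (p + 1 + csize a) [JumpLe 0 0 p]"
    unfolding compile.simps code_at_append by simp_all
  \<comment> \<open>One step for the failing test, t for the body, one for the jump back; the
    remaining t' steps start again at \<open>p\<close>.\<close>
  have "run P \<omega> (t + 2 + t') (p, st) = run P \<omega> t' (run P \<omega> (Suc 0) (run P \<omega> t (step P \<omega> (p, st))))"
    by (metis add_2_eq_Suc' run_Suc run_add Suc_eq_plus1 One_nat_def add_Suc)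
  moreover have "run P \<omega> (Suc 0) (run P \<omega> t (step P \<omega> (p, st))) = (p, st')"
    using UntilF.hyps UntilF.IH(1)[OF *(2)] step_jump[OF *(3), of \<omega> st']
    by (simp add: run_Suc step_jump[OF *(1)] add.assoc)
  ultimately show ?case
    using UntilF.IH(2)[OF UntilF.prems] by simp
qed

text \<open>\<open>final_mem\<close> reads the memory at the least halting time, whereas a
  derivation in \<open>big\<close> provides just some halting time. The two memories agree because
  \<open>step\<close> fixes a halted state.\<close>

lemma final_mem_compile:
  assumes "big \<omega> c (r, q) t (r', q')"
  shows "halted (compile 0 c) (run (compile 0 c) \<omega> t (0, r, q))"
    and "final_mem (compile 0 c) \<omega> (0, r, q) = r'"
proof -
  let ?P = "compile 0 c"
  let ?run = "\<lambda>t. run ?P \<omega> t (0, r, q)"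
  have "code_at ?P 0 ?P" by (auto simp: code_at_def)
  from compile_correct[OF assms this] have eq: "?run t = (csize c, r', q')" by simp
  thus h: "halted ?P (?run t)" by (simp add: halted_def)
  define t0 where "t0 = (LEAST t. halted ?P (?run t))"
  have h0: "halted ?P (?run t0)" and le: "t0 \<le> t"
    unfolding t0_def using h by (rule LeastI, rule Least_le)
  have "run ?P \<omega> d (?run t0) = ?run t0" for d
    by (induction d) (use h0 in \<open>auto simp: run_Suc step_def\<close>)
  hence "?run t0 = ?run t" using le run_add[of ?P \<omega> t0 "t - t0"] by simp
  thus "final_mem ?P \<omega> (0, r, q) = r'"
    using eq by (simp add: final_mem_def t0_def)
qed

section \<open>Total correctness with a time bound\<close>

definition tri :: "(nat \<Rightarrow> real) \<Rightarrow> com \<Rightarrow> (nat \<Rightarrow> complex) \<Rightarrow> nat \<Rightarrow> nat \<Rightarrow>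
    ((nat \<Rightarrow> complex) \<Rightarrow> nat \<Rightarrow> bool) \<Rightarrow> bool" where
  "tri \<omega> c r q b Q \<longleftrightarrow> (\<exists>t r' q'. big \<omega> c (r, q) t (r', q') \<and> t \<le> b \<and> Q r' q')"

lemma tri_conseq: "tri \<omega> c r q b Q \<Longrightarrow> b \<le> b' \<Longrightarrow> (\<And>r' q'. Q r' q' \<Longrightarrow> Q' r' q') \<Longrightarrow> tri \<omega> c r q b' Q'"
  unfolding tri_def by (meson order_trans)

lemma tri_block:
  assumes "list_all straight is" "length is \<le> b" "case fold (effect \<omega>) is (r, q) of (r', q') \<Rightarrow> Q r' q'"
  shows "tri \<omega> (Block is) r q b Q"
proof -
  obtain r' q' where "fold (effect \<omega>) is (r, q) = (r', q')" by fastforce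
  thus ?thesis using assms Block[of "is" \<omega> "(r, q)"] unfolding tri_def by auto
qed

lemma tri_seq:
  assumes "tri \<omega> a r q ba R" "\<And>r' q'. R r' q' \<Longrightarrow> tri \<omega> c r' q' bb Q" "ba + bb \<le> b"
  shows "tri \<omega> (a ;; c) r q b Q"
proof -
  obtain t r' q' where 1: "big \<omega> a (r, q) t (r', q')" "t \<le> ba" "R r' q'"
    using assms(1) unfolding tri_def by blast
  obtain t' r'' q'' where 2: "big \<omega> c (r', q') t' (r'', q'')" "t' \<le> bb" "Q r'' q''"
    using assms(2)[OF 1(3)] unfolding tri_def by blast
  show ?thesis unfolding tri_def
    using big.Seq[OF 1(1) 2(1)] 1(2) 2(2,3) assms(3)
    by (intro exI[of _ "t + t'"] exI[of _ r''] exI[of _ q'']) auto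
qed

lemma tri_cond:
  assumes "Re (r i) \<le> Re (r j) \<Longrightarrow> tri \<omega> a r q ba Q" "\<not> Re (r i) \<le> Re (r j) \<Longrightarrow> tri \<omega> c r q ba Q"
    and "ba + 2 \<le> b"
  shows "tri \<omega> (Cond i j a c) r q b Q"
proof (cases "Re (r i) \<le> Re (r j)")
  case True
  then obtain t r' q' where 1: "big \<omega> a (r, q) t (r', q')" "t \<le> ba" "Q r' q'"
    using assms(1) unfolding tri_def by blast
  show ?thesis unfolding tri_def using CondT[of "(r, q)" i j \<omega> a t "(r', q')" c] 1 True assms(3)
    by (intro exI[of _ "Suc t"] exI[of _ r'] exI[of _ q']) auto
next
  case False
  then obtain t r' q' where 1: "big \<omega> c (r, q) t (r', q')" "t \<le> ba" "Q r' q'"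
    using assms(2) unfolding tri_def by blast
  show ?thesis unfolding tri_def using CondF[of "(r, q)" i j \<omega> c t "(r', q')" a] 1 False assms(3)
    by (intro exI[of _ "t + 2"] exI[of _ r'] exI[of _ q']) auto
qed

text \<open>The number of rounds is known on entry, so an invariant indexed by the round also proves
  termination. A round costs 2 more than its body, for the test and the jump back; the last test
  costs 1.\<close>

lemma tri_until:
  assumes "Inv l r q" "l \<le> K"
    and body: "\<And>k r q. l \<le> k \<Longrightarrow> k < K \<Longrightarrow> Inv k r q \<Longrightarrow>
      \<not> Re (r i) \<le> Re (r j) \<and> tri \<omega> a r q b (Inv (Suc k))"
    and exit: "\<And>r q. Inv K r q \<Longrightarrow> Re (r i) \<le> Re (r j) \<and> Q r q"
    and bound: "(K - l) * (b + 2) + 1 \<le> B"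
  shows "tri \<omega> (Until i j a) r q B Q"
proof -
  have "Inv k r q \<Longrightarrow> l \<le> k \<Longrightarrow> k + d = K \<Longrightarrow> tri \<omega> (Until i j a) r q (d * (b + 2) + 1) Q" for d k r q
  proof (induction d arbitrary: k r q)
    case 0
    thus ?case unfolding tri_def using UntilT[of "(r, q)" i j \<omega> a] exit[of r q] by auto
  next
    case (Suc d)
    have *: "\<not> Re (r i) \<le> Re (r j)" "tri \<omega> a r q b (Inv (Suc k))"
      using body[of k r q] Suc.prems by auto
    obtain t r' q' where 1: "big \<omega> a (r, q) t (r', q')" "t \<le> b" "Inv (Suc k) r' q'"
      using *(2) unfolding tri_def by blast
    have "tri \<omega> (Until i j a) r' q' (d * (b + 2) + 1) Q"
      using Suc.IH[OF 1(3)] Suc.prems by simp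
    then obtain t' r'' q'' where 2: "big \<omega> (Until i j a) (r', q') t' (r'', q'')"
        "t' \<le> d * (b + 2) + 1" "Q r'' q''"
      unfolding tri_def by blast
    have "big \<omega> (Until i j a) (r, q) (t + 2 + t') (r'', q'')"
      by (rule UntilF) (use * 1 2 in auto)
    thus ?case unfolding tri_def using 1(2) 2(2,3)
      by (intro exI[of _ "t + 2 + t'"] exI[of _ r''] exI[of _ q'']) auto
  qed
  from this[of l r q "K - l"] show ?thesis
    using assms(1,2) bound by (auto intro: tri_conseq)
qed

lemma addr_of_nat [simp]: "addr (of_nat a) = a"
  by (simp add: addr_def)

lemma addr_numeral [simp]: "addr 0 = 0" "addr 1 = 1" "addr (numeral k) = numeral k"
  by (simp_all add: addr_def)

text \<open>Addresses are computed in complex registers and decoded by a floor. On naturals this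
  decoding is additive, so the simplifier can reduce a computed address to a sum.\<close>

lemma addr_add [simp]: "z \<in> \<nat> \<Longrightarrow> w \<in> \<nat> \<Longrightarrow> addr (z + w) = addr z + addr w"
  by (auto elim!: Nats_cases simp: addr_def nat_add_distrib simp flip: of_nat_add)

lemma addr_mult [simp]: "z \<in> \<nat> \<Longrightarrow> w \<in> \<nat> \<Longrightarrow> addr (z * w) = addr z * addr w"
  by (auto elim!: Nats_cases simp: addr_def nat_mult_distrib simp flip: of_nat_mult)

section \<open>Amplitudes and permanents\<close>

locale boson_sampling =
  fixes m n :: nat and U :: "nat \<Rightarrow> nat \<Rightarrow> complex" and s :: "nat \<Rightarrow> nat"
  assumes m_pos: "m \<ge> 1" and n_pos: "n \<ge> 1"
    and unitary: "unitary_mat m U" and occ: "occ_vec m n s"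
begin

lemma s_outside: "j \<ge> m \<Longrightarrow> s j = 0"
  using occ by (auto simp: occ_vec_def)

lemma sum_s: "(\<Sum>j<m. s j) = n"
  using occ by (auto simp: occ_vec_def)

text \<open>amp \<rho> a c is the derivative of order c at 0 of the polynomial reached from the
  monomial with exponent vector a, divided by its factorials, by detecting photons in the modes
  listed in \<rho>.\<close>
definition annihilate :: "nat \<Rightarrow> ((nat \<Rightarrow> nat) \<Rightarrow> complex) \<Rightarrow> (nat \<Rightarrow> nat) \<Rightarrow> complex" where
  "annihilate r F a = (\<Sum>j | j < m \<and> 0 < a j. U r j * F (a(j := a j - 1)))"

definition amp :: "nat list \<Rightarrow> (nat \<Rightarrow> nat) \<Rightarrow> (nat \<Rightarrow> nat) \<Rightarrow> complex" where
  "amp \<rho> a c = foldr annihilate \<rho> (\<lambda>x. if x = c then 1 else 0) a"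

lemma amp_Nil: "amp [] a c = (if a = c then 1 else 0)"
  by (simp add: amp_def)

lemma amp_Cons: "amp (r # \<rho>) a c = (\<Sum>j | j < m \<and> 0 < a j. U r j * amp \<rho> (a(j := a j - 1)) c)"
  by (simp add: amp_def annihilate_def)

text \<open>The defining recursion lets the first detection act on the source vector
  \<open>a\<close>; in this dual form the last detection acts on the target vector \<open>c\<close>.
  This is the update that the program performs on the stored derivatives.\<close>

lemma amp_snoc: "amp (\<rho> @ [r]) a c = (\<Sum>j<m. U r j * amp \<rho> a (c(j := Suc (c j))))"
proof (induction \<rho> arbitrary: a)
  case Nil
  \<comment> \<open>The condition \<open>0 < a j\<close> excludes truncated subtraction, so that
    lowering \<open>a\<close> and raising \<open>c\<close> are inverse to each other.\<close>
  have iff: "0 < a j \<and> a(j := a j - 1) = c \<longleftrightarrow> a = c(j := Suc (c j))" for j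
    by (auto simp: fun_eq_iff split: if_splits)
  have "amp ([] @ [r]) a c = (\<Sum>j\<in>{j\<in>{..<m}. 0 < a j}. U r j * (if a(j := a j - 1) = c then 1 else 0))"
    by (simp add: amp_Cons amp_Nil)
  also have "\<dots> = (\<Sum>j<m. if 0 < a j then U r j * (if a(j := a j - 1) = c then 1 else 0) else 0)"
    by (subst sum.inter_filter) simp_all
  also have "\<dots> = (\<Sum>j<m. U r j * amp [] a (c(j := Suc (c j))))"
    by (intro sum.cong refl) (use iff in \<open>auto simp: amp_Nil\<close>)
  finally show ?case .
next
  case (Cons r' \<rho>)
  have "amp ((r' # \<rho>) @ [r]) a c =
      (\<Sum>i | i < m \<and> 0 < a i. \<Sum>j<m. U r' i * (U r j * amp \<rho> (a(i := a i - 1)) (c(j := Suc (c j)))))"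
    unfolding append_Cons amp_Cons Cons.IH sum_distrib_left ..
  also have "\<dots> = (\<Sum>j<m. \<Sum>i | i < m \<and> 0 < a i. U r' i * (U r j * amp \<rho> (a(i := a i - 1)) (c(j := Suc (c j)))))"
    by (rule sum.swap)
  also have "\<dots> = (\<Sum>j<m. U r j * amp (r' # \<rho>) a (c(j := Suc (c j))))"
    by (simp add: amp_Cons sum_distrib_left algebra_simps)
  finally show ?case .
qed

lemma sum_decrease: "j < m \<Longrightarrow> 0 < a j \<Longrightarrow> (\<Sum>i<m. (a(j := a j - 1)) i) + 1 = (\<Sum>i<m. a i :: nat)"
  by (subst (1 2) sum.remove[of _ j]) auto

text \<open>Each detection lowers a single exponent by one, and amplitudes arise only from such
  descents.\<close>

lemma amp_nonzero:
  "amp \<rho> a c \<noteq> 0 \<Longrightarrow> (\<forall>j. c j \<le> a j) \<and> (\<Sum>j<m. c j) + length \<rho> = (\<Sum>j<m. a j)"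
proof (induction \<rho> arbitrary: a)
  case (Cons r \<rho>)
  obtain j where j: "j < m" "0 < a j" "amp \<rho> (a(j := a j - 1)) c \<noteq> 0"
    using Cons.prems unfolding amp_Cons by (metis (mono_tags, lifting) mem_Collect_eq mult_zero_right sum.neutral)
  have IH: "c i \<le> (a(j := a j - 1)) i" "(\<Sum>i<m. c i) + length \<rho> = (\<Sum>i<m. (a(j := a j - 1)) i)" for i
    using Cons.IH[OF j(3)] by blast+
  have "c i \<le> a i" for i
    using IH(1)[of i] by (cases "i = j") auto
  thus ?case using sum_decrease[of j a] j(1,2) IH(2) by simp
qed (auto simp: amp_Nil split: if_splits)

text \<open>Directional derivatives commute: the double sum is unchanged when the two detections and
  the two lowered modes are exchanged together.\<close>

lemma annihilate_commute: "annihilate r \<circ> annihilate r' = annihilate r' \<circ> annihilate r"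
proof (intro ext)
  fix F :: "(nat \<Rightarrow> nat) \<Rightarrow> complex" and a
  \<comment> \<open>The contribution of lowering i and then j, extended by 0 where a step is
    impossible; both sums then run over all modes and can be swapped.\<close>
  define g where "g p q i j = (if 0 < a i \<and> 0 < (a(i := a i - 1)) j
      then U p i * U q j * F (a(i := a i - 1, j := (a(i := a i - 1)) j - 1)) else 0)" for p q i j
  have ann: "annihilate p F a = (\<Sum>j<m. if 0 < a j then U p j * F (a(j := a j - 1)) else 0)" for p F a
    unfolding annihilate_def by (subst sum.inter_filter [symmetric]) auto
  have dist: "(if P then x * (\<Sum>j<m. if R j then y j * z j else 0) else 0) =
      (\<Sum>j<m. if P \<and> R j then x * y j * z j else 0)" for P R and x :: complex and y z :: "nat \<Rightarrow> complex"
    by (auto simp: sum_distrib_left mult.assoc intro!: sum.cong)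
  have eq: "(annihilate p \<circ> annihilate q) F a = (\<Sum>i<m. \<Sum>j<m. g p q i j)" for p q
    unfolding o_def ann g_def dist ..
  have "g r r' i j = g r' r j i" for i j
  proof (cases "i = j")
    case True
    thus ?thesis by (simp add: g_def mult.commute)
  next
    case False
    have "a(i := a i - 1, j := (a(i := a i - 1)) j - 1) = a(j := a j - 1, i := (a(j := a j - 1)) i - 1)"
      using False by (auto simp: fun_eq_iff)
    moreover have "0 < a i \<and> 0 < (a(i := a i - 1)) j \<longleftrightarrow> 0 < a j \<and> 0 < (a(j := a j - 1)) i"
      using False by auto
    ultimately show ?thesis unfolding g_def by (simp only: mult.commute)
  qed
  thus "(annihilate r \<circ> annihilate r') F a = (annihilate r' \<circ> annihilate r) F a"
    unfolding eq by (subst sum.swap) simp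
qed

text \<open>Hence the amplitude depends on the outcome and not on the order of the
  detections.\<close>

lemma amp_mset: "mset \<rho> = mset \<rho>' \<Longrightarrow> amp \<rho> = amp \<rho>'"
  unfolding amp_def foldr_conv_fold
  by (intro ext, subst fold_multiset_equiv[of "rev \<rho>" annihilate "rev \<rho>'"]) (auto intro: annihilate_commute)

text \<open>Laplace expansion of the permanent along its rows, with the photons in B still unused.\<close>
fun expand :: "(nat \<Rightarrow> nat) \<Rightarrow> nat list \<Rightarrow> nat set \<Rightarrow> complex" where
  "expand \<kappa> [] B = (if B = {} then 1 else 0)"
| "expand \<kappa> (r # \<rho>) B = (\<Sum>b\<in>B. U r (\<kappa> b) * expand \<kappa> \<rho> (B - {b}))"

definition occupation :: "(nat \<Rightarrow> nat) \<Rightarrow> nat set \<Rightarrow> nat \<Rightarrow> nat" where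
  "occupation \<kappa> B j = card {b\<in>B. \<kappa> b = j}"

text \<open>Photons in the same mode are interchangeable: a row that uses mode j can choose any of
  its remaining photons with the same effect. Over all rows these multiplicities build up the
  factorials of the occupation numbers.\<close>

lemma expand_amp:
  assumes "finite B" "\<And>b. b \<in> B \<Longrightarrow> \<kappa> b < m"
  shows "expand \<kappa> \<rho> B = (\<Prod>j<m. fact (occupation \<kappa> B j)) * amp \<rho> (occupation \<kappa> B) (\<lambda>_. 0)"
  using assms
proof (induction \<rho> arbitrary: B)
  case Nil
  have "occupation \<kappa> B = (\<lambda>_. 0) \<longleftrightarrow> B = {}"
    using Nil.prems(1) by (auto simp: occupation_def fun_eq_iff)
  moreover have "occupation \<kappa> {} = (\<lambda>_. 0)" by (simp add: occupation_def fun_eq_iff)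
  ultimately show ?case by (simp add: amp_Nil)
next
  case (Cons r \<rho>)
  let ?c = "occupation \<kappa> B"
  have remove: "occupation \<kappa> (B - {b}) = ?c(\<kappa> b := ?c (\<kappa> b) - 1)" if "b \<in> B" for b
  proof (rule ext)
    fix j
    have "{b'\<in>B - {b}. \<kappa> b' = j} = (if j = \<kappa> b then {b\<in>B. \<kappa> b = j} - {b} else {b\<in>B. \<kappa> b = j})"
      by auto
    thus "occupation \<kappa> (B - {b}) j = (?c(\<kappa> b := ?c (\<kappa> b) - 1)) j"
      using that by (cases "j = \<kappa> b") (simp_all add: occupation_def card_Diff_singleton)
  qed
  \<comment> \<open>The term of a photon depends on its mode only, so the sum over photons can be
    grouped by mode.\<close>
  define h where "h j = U r j * ((\<Prod>i<m. fact ((?c(j := ?c j - 1)) i)) * amp \<rho> (?c(j := ?c j - 1)) (\<lambda>_. 0))" for j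
  have "expand \<kappa> (r # \<rho>) B = (\<Sum>b\<in>B. h (\<kappa> b))"
    unfolding expand.simps h_def
    by (intro sum.cong refl) (subst Cons.IH; use Cons.prems remove in auto)
  also have "\<dots> = (\<Sum>j<m. \<Sum>b\<in>{b\<in>B. \<kappa> b = j}. h (\<kappa> b))"
    by (rule sum.group [symmetric]) (use Cons.prems in auto)
  also have "\<dots> = (\<Sum>j<m. of_nat (?c j) * h j)"
    by (intro sum.cong refl) (simp add: occupation_def)
  also have "\<dots> = (\<Sum>j<m. if 0 < ?c j then (\<Prod>i<m. fact (?c i)) * (U r j * amp \<rho> (?c(j := ?c j - 1)) (\<lambda>_. 0)) else 0)"
  proof (intro sum.cong refl)
    fix j assume j: "j \<in> {..<m}"
    have "of_nat (?c j) * (\<Prod>i<m. fact ((?c(j := ?c j - 1)) i)) = (\<Prod>i<m. fact (?c i) :: complex)" if "0 < ?c j"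
    proof -
      have "(\<Prod>i<m. fact ((?c(j := ?c j - 1)) i) :: complex) = fact (?c j - 1) * (\<Prod>i\<in>{..<m}-{j}. fact (?c i))"
        using j by (subst prod.remove[of _ j]) auto
      moreover have "(\<Prod>i<m. fact (?c i) :: complex) = fact (?c j) * (\<Prod>i\<in>{..<m}-{j}. fact (?c i))"
        using j by (subst prod.remove[of _ j]) auto
      moreover have "(fact (?c j) :: complex) = of_nat (?c j) * fact (?c j - 1)"
        using that by (subst fact_reduce) auto
      ultimately show ?thesis by simp
    qed
    hence "of_nat (?c j) * h j = (\<Prod>i<m. fact (?c i)) * (U r j * amp \<rho> (?c(j := ?c j - 1)) (\<lambda>_. 0))"
      if "0 < ?c j"
    proof -
      have swap: "x * (u * (p * y)) = (x * p) * (u * y)" for x u p y :: complex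
        by (simp only: mult_ac)
      show ?thesis unfolding h_def swap using \<open>0 < ?c j \<Longrightarrow> _\<close>[OF that] by (simp only:)
    qed
    thus "of_nat (?c j) * h j = (if 0 < ?c j then (\<Prod>i<m. fact (?c i)) * (U r j * amp \<rho> (?c(j := ?c j - 1)) (\<lambda>_. 0)) else 0)"
      by simp
  qed
  also have "\<dots> = (\<Sum>j | j < m \<and> 0 < ?c j. (\<Prod>i<m. fact (?c i)) * (U r j * amp \<rho> (?c(j := ?c j - 1)) (\<lambda>_. 0)))"
    by (subst sum.inter_filter [symmetric]) auto
  also have "\<dots> = (\<Prod>i<m. fact (?c i)) * amp (r # \<rho>) ?c (\<lambda>_. 0)"
    by (simp add: amp_Cons sum_distrib_left)
  finally show ?case .
qed

text \<open>Choosing a photon for the first row and recursing on the others enumerates the orderings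
  of B by their first element.\<close>

lemma expand_permutations:
  assumes "finite B" "length \<rho> = card B"
  shows "expand \<kappa> \<rho> B = (\<Sum>xs\<in>permutations_of_set B. \<Prod>i<length \<rho>. U (\<rho> ! i) (\<kappa> (xs ! i)))"
  using assms
proof (induction \<rho> arbitrary: B)
  case (Cons r \<rho>)
  have "B \<noteq> {}" using Cons.prems by auto
  let ?f = "\<lambda>xs. \<Prod>i<length (r # \<rho>). U ((r # \<rho>) ! i) (\<kappa> (xs ! i))"
  have "(\<Sum>xs\<in>permutations_of_set B. ?f xs) = (\<Sum>xs\<in>(\<Union>b\<in>B. (#) b ` permutations_of_set (B - {b})). ?f xs)"
    by (subst permutations_of_set_nonempty[OF \<open>B \<noteq> {}\<close>]) (rule refl)
  also have "\<dots> = (\<Sum>b\<in>B. \<Sum>xs\<in>(#) b ` permutations_of_set (B - {b}). ?f xs)"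
    by (rule sum.UNION_disjoint) (use Cons.prems in auto)
  also have "\<dots> = (\<Sum>b\<in>B. \<Sum>xs\<in>permutations_of_set (B - {b}). ?f (b # xs))"
    by (subst sum.reindex) (auto simp: o_def)
  also have "\<dots> = (\<Sum>b\<in>B. U r (\<kappa> b) * expand \<kappa> \<rho> (B - {b}))"
  proof (intro sum.cong refl)
    fix b assume "b \<in> B"
    hence IH: "expand \<kappa> \<rho> (B - {b}) =
        (\<Sum>xs\<in>permutations_of_set (B - {b}). \<Prod>i<length \<rho>. U (\<rho> ! i) (\<kappa> (xs ! i)))"
      by (intro Cons.IH) (use Cons.prems in auto)
    show "(\<Sum>xs\<in>permutations_of_set (B - {b}). ?f (b # xs)) = U r (\<kappa> b) * expand \<kappa> \<rho> (B - {b})"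
      unfolding IH sum_distrib_left
      by (intro sum.cong refl) (simp del: prod.lessThan_Suc add: prod.lessThan_Suc_shift)
  qed
  finally show ?case by simp
qed auto

text \<open>A permutation of \<open>{..<n}\<close> is determined by the list of its values, since it
  is the identity outside that range.\<close>

lemma permanent_permutations:
  "permanent n A = (\<Sum>xs\<in>permutations_of_set {..<n}. \<Prod>i<n. A i (xs ! i))"
  unfolding permanent_def
proof (rule sum.reindex_bij_witness[where i = "\<lambda>xs i. if i < n then xs ! i else i" and j = "\<lambda>\<sigma>. map \<sigma> [0..<n]"])
  fix \<sigma> assume "\<sigma> \<in> {\<sigma>. \<sigma> permutes {..<n}}"
  hence \<sigma>: "\<sigma> permutes {..<n}" by simp
  show "(\<lambda>i. if i < n then map \<sigma> [0..<n] ! i else i) = \<sigma>"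
  proof
    fix i
    show "(if i < n then map \<sigma> [0..<n] ! i else i) = \<sigma> i"
      using permutes_not_in[OF \<sigma>, of i] by (cases "i < n") simp_all
  qed
  show "map \<sigma> [0..<n] \<in> permutations_of_set {..<n}"
    using permutes_image[OF \<sigma>] permutes_inj_on[OF \<sigma>, of "{..<n}"]
    unfolding permutations_of_set_def mem_Collect_eq distinct_map set_map set_upt atLeast0LessThan
    by (intro conjI distinct_upt)
  show "(\<Prod>i<n. A i (map \<sigma> [0..<n] ! i)) = (\<Prod>i<n. A i (\<sigma> i))" by simp
next
  fix xs assume "xs \<in> permutations_of_set {..<n}"
  hence xs: "set xs = {..<n}" "distinct xs" by (auto simp: permutations_of_set_def)
  from xs(1) have "card (set xs) = n" by simp
  hence len: "length xs = n" unfolding distinct_card[OF xs(2)] .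
  show "map (\<lambda>i. if i < n then xs ! i else i) [0..<n] = xs"
    using len by (intro nth_equalityI) auto
  have "bij_betw (\<lambda>i. xs ! i) {..<n} {..<n}"
    by (rule bij_betw_nth[OF xs(2)]) (simp_all only: len xs(1))
  moreover have "bij_betw (\<lambda>i. if i < n then xs ! i else i) {..<n} {..<n} \<longleftrightarrow>
      bij_betw (\<lambda>i. xs ! i) {..<n} {..<n}"
    by (rule bij_betw_cong) simp
  ultimately have "bij_betw (\<lambda>i. if i < n then xs ! i else i) {..<n} {..<n}"
    by simp
  hence "(\<lambda>i. if i < n then xs ! i else i) permutes {..<n}"
    by (rule bij_imp_permutes) simp
  thus "(\<lambda>i. if i < n then xs ! i else i) \<in> {\<sigma>. \<sigma> permutes {..<n}}"
    by simp
qed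

text \<open>The partial sums of \<open>t\<close> cut the photon indices into consecutive intervals,
  one for each mode; the hypothesis guarantees that the \<open>LEAST\<close> in
  \<open>mode_of\<close> is attained.\<close>

lemma mode_of_eq_iff:
  assumes "k < (\<Sum>l<M. t l)"
  shows "mode_of t k = j \<longleftrightarrow> (\<Sum>l<j. t l) \<le> k \<and> k < (\<Sum>l\<le>j. t l)"
proof -
  let ?P = "\<lambda>j. k < (\<Sum>l\<le>j. t l)"
  have "M > 0" using assms by (cases M) auto
  hence "?P (M - 1)" using assms by (cases M) (auto simp: lessThan_Suc_atMost)
  hence P: "?P (mode_of t k)" unfolding mode_of_def by (rule LeastI)
  have "(\<Sum>l<mode_of t k. t l) \<le> k"
  proof (cases "mode_of t k")
    case (Suc i)
    hence "\<not> ?P i" unfolding mode_of_def by (metis lessI not_less_Least)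
    thus ?thesis using Suc by (simp add: lessThan_Suc_atMost)
  qed simp
  moreover have "mode_of t k = j" if "(\<Sum>l<j. t l) \<le> k" "?P j"
    unfolding mode_of_def
  proof (rule Least_equality)
    fix y assume "?P y"
    show "j \<le> y"
    proof (rule ccontr)
      assume "\<not> j \<le> y"
      hence "(\<Sum>l\<le>y. t l) \<le> (\<Sum>l<j. t l)" by (intro sum_mono2) auto
      thus False using \<open>?P y\<close> that(1) by simp
    qed
  qed (use that in auto)
  ultimately show ?thesis using P by blast
qed

lemma mode_of_less: "occ_vec m n t \<Longrightarrow> k < n \<Longrightarrow> mode_of t k < m"
proof (rule ccontr)
  assume t: "occ_vec m n t" and k: "k < n" and *: "\<not> mode_of t k < m"
  have "(\<Sum>l<mode_of t k. t l) \<le> k"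
    using mode_of_eq_iff[of k t m "mode_of t k"] t k by (auto simp: occ_vec_def)
  moreover have "(\<Sum>l<m. t l) \<le> (\<Sum>l<mode_of t k. t l)"
    using * by (intro sum_mono2) auto
  ultimately show False using t k by (auto simp: occ_vec_def)
qed

lemma occupation_mode_of:
  assumes "occ_vec m n t"
  shows "occupation (mode_of t) {..<n} = t"
proof (rule ext)
  fix j
  have n: "n = (\<Sum>l<m. t l)" using assms by (simp add: occ_vec_def)
  have le: "(\<Sum>l\<le>j. t l) \<le> n"
  proof (cases "j < m")
    case True
    thus ?thesis unfolding n by (intro sum_mono2) auto
  next
    case False
    have "(\<Sum>l\<le>j. t l) = (\<Sum>l<m. t l)"
      using assms False by (intro sum.mono_neutral_right) (auto simp: occ_vec_def)
    thus ?thesis by (simp add: n)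
  qed
  have "{b \<in> {..<n}. mode_of t b = j} = {(\<Sum>l<j. t l)..<(\<Sum>l\<le>j. t l)}"
  proof (rule set_eqI)
    fix b
    show "b \<in> {b \<in> {..<n}. mode_of t b = j} \<longleftrightarrow> b \<in> {(\<Sum>l<j. t l)..<(\<Sum>l\<le>j. t l)}"
      using le mode_of_eq_iff[of b t m j] n by (cases "b < n") auto
  qed
  thus "occupation (mode_of t) {..<n} j = t j"
    by (simp add: occupation_def flip: lessThan_Suc_atMost)
qed

lemma permanent_amp:
  assumes "occ_vec m n T"
  shows "permanent n (sub_mat U s T) =
    (\<Prod>j<m. fact (s j)) * amp (map (mode_of T) [0..<n]) s (\<lambda>_. 0)"
proof -
  have "permanent n (sub_mat U s T) = expand (mode_of s) (map (mode_of T) [0..<n]) {..<n}"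
    by (subst expand_permutations) (simp_all add: permanent_permutations sub_mat_def)
  also have "\<dots> = (\<Prod>j<m. fact (s j)) * amp (map (mode_of T) [0..<n]) s (\<lambda>_. 0)"
    using occ by (subst expand_amp) (auto simp: occupation_mode_of mode_of_less)
  finally show ?thesis .
qed

section \<open>Squared norms of the states after some detections\<close>

definition configs :: "(nat \<Rightarrow> nat) set" where
  "configs = PiE_dflt {..<m} 0 (\<lambda>j. {..s j})"

lemma configs_iff: "c \<in> configs \<longleftrightarrow> (\<forall>j. c j \<le> s j)"
  unfolding configs_def PiE_dflt_def mem_Collect_eq lessThan_iff atMost_iff
  using s_outside by (metis le_zero_eq not_le)

lemma finite_configs: "finite configs"
  unfolding configs_def by (intro finite_PiE_dflt) auto

text \<open>The squared Fock norm of the state reached by \<rho>: the monomial with exponents c has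
  as squared norm the product of the factorials of c, and its coefficient is \<open>amp\<close>
  divided by that product.\<close>

definition weight :: "nat list \<Rightarrow> real" where
  "weight \<rho> = (\<Sum>c\<in>configs. (cmod (amp \<rho> s c))\<^sup>2 / (\<Prod>j<m. fact (c j)))"

lemma weight_nonneg: "weight \<rho> \<ge> 0"
  unfolding weight_def by (intro sum_nonneg divide_nonneg_nonneg prod_nonneg) auto

text \<open>Expanding the squares produces the inner products of the columns of \<open>U\<close>,
  which \<open>unitary_mat\<close> makes orthonormal.\<close>

lemma norm_unitary:
  "(\<Sum>r<m. (cmod (\<Sum>j<m. U r j * x j))\<^sup>2) = (\<Sum>j<m. (cmod (x j))\<^sup>2)"
proof -
  have "complex_of_real (\<Sum>r<m. (cmod (\<Sum>j<m. U r j * x j))\<^sup>2) =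
      (\<Sum>r<m. \<Sum>i<m. \<Sum>j<m. x i * cnj (x j) * (U r i * cnj (U r j)))"
    by (simp only: of_real_sum complex_norm_square cnj_sum sum_product)
       (simp add: mult_ac)
  also have "\<dots> = (\<Sum>i<m. \<Sum>r<m. \<Sum>j<m. x i * cnj (x j) * (U r i * cnj (U r j)))"
    by (rule sum.swap)
  also have "\<dots> = (\<Sum>i<m. \<Sum>j<m. \<Sum>r<m. x i * cnj (x j) * (U r i * cnj (U r j)))"
    by (rule sum.cong[OF refl], rule sum.swap)
  also have "\<dots> = (\<Sum>i<m. \<Sum>j<m. x i * cnj (x j) * (if i = j then 1 else 0))"
    unfolding sum_distrib_left [symmetric]
    using unitary by (intro sum.cong refl) (auto simp: unitary_mat_def)
  also have "\<dots> = (\<Sum>i<m. x i * cnj (x i))"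
    by (simp add: if_distrib[of "(*) _"] cong: if_cong)
  also have "\<dots> = complex_of_real (\<Sum>j<m. (cmod (x j))\<^sup>2)"
    by (simp only: of_real_sum complex_norm_square)
  finally show ?thesis by (simp only: of_real_eq_iff)
qed

text \<open>Shift the summation index by one photon in mode j; the factorial of \<open>c j\<close>
  then gains the factor of the number operator. The boundary terms drop out: at
  \<open>c j = s j\<close> the shifted amplitude vanishes, at \<open>c j = 0\<close> the factor
  does.\<close>

lemma sum_shift_config:
  assumes "j < m"
  shows "(\<Sum>c\<in>configs. (cmod (amp \<rho> s (c(j := Suc (c j)))))\<^sup>2 / (\<Prod>i<m. fact (c i))) =
    (\<Sum>c\<in>configs. of_nat (c j) * ((cmod (amp \<rho> s c))\<^sup>2 / (\<Prod>i<m. fact (c i))))" (is "?lhs = ?rhs")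
proof (rule sum.reindex_bij_witness_not_neutral[where
    S' = "{c\<in>configs. c j = s j}" and T' = "{c\<in>configs. c j = 0}"
    and j = "\<lambda>c. c(j := Suc (c j))" and i = "\<lambda>c. c(j := c j - 1)"])
  fix c
  have "(\<Prod>i<m. fact ((c(j := Suc (c j))) i) :: real) = of_nat (Suc (c j)) * (\<Prod>i<m. fact (c i))"
  proof -
    have "(\<Prod>i<m. fact ((c(j := Suc (c j))) i) :: real) = fact (Suc (c j)) * (\<Prod>i\<in>{..<m}-{j}. fact (c i))"
      using assms by (subst prod.remove[of _ j]) auto
    moreover have "(\<Prod>i<m. fact (c i) :: real) = fact (c j) * (\<Prod>i\<in>{..<m}-{j}. fact (c i))"
      using assms by (subst prod.remove[of _ j]) auto
    ultimately show ?thesis by simp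
  qed
  thus "of_nat ((c(j := Suc (c j))) j) * ((cmod (amp \<rho> s (c(j := Suc (c j)))))\<^sup>2 /
      (\<Prod>i<m. fact ((c(j := Suc (c j))) i))) =
    (cmod (amp \<rho> s (c(j := Suc (c j)))))\<^sup>2 / (\<Prod>i<m. fact (c i))"
    by (simp del: of_nat_Suc)
next
  fix c assume c: "c \<in> configs - {c\<in>configs. c j = s j}"
  show "c(j := Suc (c j)) \<in> configs - {c \<in> configs. c j = 0}"
    using c by (auto simp: configs_iff le_neq_implies_less Suc_leI)
next
  fix c assume c: "c \<in> {c\<in>configs. c j = s j}"
  have "amp \<rho> s (c(j := Suc (c j))) = 0"
  proof (rule ccontr)
    assume "amp \<rho> s (c(j := Suc (c j))) \<noteq> 0"
    from amp_nonzero[OF this] have "(c(j := Suc (c j))) j \<le> s j" by blast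
    thus False using c by simp
  qed
  thus "(cmod (amp \<rho> s (c(j := Suc (c j)))))\<^sup>2 / (\<Prod>i<m. fact (c i)) = 0" by simp
next
  fix c assume c: "c \<in> configs - {c\<in>configs. c j = 0}"
  have "c i - 1 \<le> s i" for i
    using c by (auto simp: configs_iff intro: le_trans[OF diff_le_self])
  thus "c(j := c j - 1) \<in> configs - {c\<in>configs. c j = s j}"
    using c by (auto simp: configs_iff) (metis Suc_pred Suc_n_not_le_n)
qed (use finite_configs in \<open>auto simp: fun_eq_iff\<close>)

text \<open>Unitarity turns the sum over output modes into a sum over input modes, where each
  derivative yields the number operator of its mode. Together these count the remaining photons, and
  this count is constant on the support of the state.\<close>

lemma weight_sum:
  assumes "length \<rho> \<le> n"
  shows "(\<Sum>r<m. weight (\<rho> @ [r])) = real (n - length \<rho>) * weight \<rho>"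
proof -
  have "(\<Sum>r<m. weight (\<rho> @ [r])) =
      (\<Sum>c\<in>configs. \<Sum>r<m. (cmod (\<Sum>j<m. U r j * amp \<rho> s (c(j := Suc (c j)))))\<^sup>2 / (\<Prod>j<m. fact (c j)))"
    unfolding weight_def amp_snoc by (rule sum.swap)
  also have "\<dots> = (\<Sum>c\<in>configs. \<Sum>j<m. (cmod (amp \<rho> s (c(j := Suc (c j)))))\<^sup>2 / (\<Prod>j<m. fact (c j)))"
    by (simp only: norm_unitary flip: sum_divide_distrib)
  also have "\<dots> = (\<Sum>j<m. \<Sum>c\<in>configs. (cmod (amp \<rho> s (c(j := Suc (c j)))))\<^sup>2 / (\<Prod>j<m. fact (c j)))"
    by (rule sum.swap)
  also have "\<dots> = (\<Sum>j<m. \<Sum>c\<in>configs. of_nat (c j) * ((cmod (amp \<rho> s c))\<^sup>2 / (\<Prod>j<m. fact (c j))))"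
    by (intro sum.cong refl sum_shift_config) auto
  also have "\<dots> = (\<Sum>c\<in>configs. of_nat (\<Sum>j<m. c j) * ((cmod (amp \<rho> s c))\<^sup>2 / (\<Prod>j<m. fact (c j))))"
    by (subst sum.swap) (simp add: sum_distrib_right sum_divide_distrib)
  also have "\<dots> = (\<Sum>c\<in>configs. real (n - length \<rho>) * ((cmod (amp \<rho> s c))\<^sup>2 / (\<Prod>j<m. fact (c j))))"
  proof (intro sum.cong refl)
    fix c
    show "of_nat (\<Sum>j<m. c j) * ((cmod (amp \<rho> s c))\<^sup>2 / (\<Prod>j<m. fact (c j))) =
      real (n - length \<rho>) * ((cmod (amp \<rho> s c))\<^sup>2 / (\<Prod>j<m. fact (c j)))"
    proof (cases "amp \<rho> s c = 0")
      case False
      hence "(\<Sum>j<m. c j) = n - length \<rho>" using amp_nonzero[OF False] sum_s by linarith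
      thus ?thesis by simp
    qed simp
  qed
  finally show ?thesis by (simp add: weight_def sum_distrib_left)
qed

lemma weight_Nil: "weight [] = 1 / (\<Prod>j<m. fact (s j))"
proof -
  have "weight [] = (\<Sum>c\<in>configs. if s = c then 1 / (\<Prod>j<m. fact (s j)) else 0)"
    unfolding weight_def by (intro sum.cong) (auto simp: amp_Nil)
  thus ?thesis using finite_configs by (simp add: configs_iff)
qed

lemma weight_full:
  assumes "length \<rho> = n"
  shows "weight \<rho> = (cmod (amp \<rho> s (\<lambda>_. 0)))\<^sup>2"
proof -
  have "weight \<rho> = (\<Sum>c\<in>configs. if c = (\<lambda>_. 0) then (cmod (amp \<rho> s (\<lambda>_. 0)))\<^sup>2 else 0)"
    unfolding weight_def
  proof (intro sum.cong refl)
    fix c assume c: "c \<in> configs"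
    have "c = (\<lambda>_. 0)" if "amp \<rho> s c \<noteq> 0"
    proof
      fix j
      have "(\<Sum>j<m. c j) = 0" using amp_nonzero[OF that] sum_s assms by simp
      moreover have "c j \<le> s j" using c by (auto simp: configs_iff)
      ultimately show "c j = 0" using s_outside[of j] by (cases "j < m") auto
    qed
    thus "(cmod (amp \<rho> s c))\<^sup>2 / (\<Prod>j<m. fact (c j)) = (if c = (\<lambda>_. 0) then (cmod (amp \<rho> s (\<lambda>_. 0)))\<^sup>2 else 0)"
      by auto
  qed
  thus ?thesis using finite_configs by (simp add: configs_iff)
qed

section \<open>Detection orders and outcomes\<close>

lemma count_list_occ:
  assumes "length \<rho> = n" "set \<rho> \<subseteq> {..<m}"
  shows "occ_vec m n (count_list \<rho>)"
proof -
  have "(\<Sum>i<m. count_list \<rho> i) = (\<Sum>i\<in>set \<rho>. count_list \<rho> i)"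
    using assms(2) by (intro sum.mono_neutral_right) (auto simp: count_list_0_iff)
  thus ?thesis using assms by (auto simp: occ_vec_def sum_count_set count_list_0_iff)
qed

lemma count_mode_of:
  assumes "occ_vec m n T"
  shows "count (mset (map (mode_of T) [0..<n])) j = T j"
proof -
  have "count (mset (map (mode_of T) [0..<n])) j = occupation (mode_of T) {..<n} j"
    by (simp only: mset_map mset_upt count_image_mset_eq_card_vimage finite_atLeastLessThan)
       (auto simp: occupation_def intro!: arg_cong[of _ _ card])
  thus ?thesis by (simp add: occupation_mode_of assms)
qed

text \<open>Any detection order \<rho> of the outcome may be used, since \<open>amp\<close> ignores
  the order. Of the two factors s! in the squared permanent one cancels against the denominator of
  \<open>bs_prob\<close>.\<close>

lemma bs_prob_weight:
  assumes "length \<rho> = n" "set \<rho> \<subseteq> {..<m}" "\<And>i. i < m \<Longrightarrow> count_list \<rho> i = T i" "occ_vec m n T"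
  shows "bs_prob m U s T = (\<Prod>j<m. fact (s j)) * weight \<rho> / (\<Prod>j<m. fact (T j))"
proof -
  have "mset \<rho> = mset (map (mode_of T) [0..<n])"
  proof (rule multiset_eqI)
    fix j
    have "count (mset (map (mode_of T) [0..<n])) j = T j"
      by (rule count_mode_of[OF assms(4)])
    also have "\<dots> = count (mset \<rho>) j"
    proof (cases "j < m")
      case True thus ?thesis using assms(3) by (simp add: count_mset)
    next
      case False
      hence "j \<notin> set \<rho>" using assms(2) by auto
      thus ?thesis using False assms(4) by (simp add: occ_vec_def count_mset)
    qed
    finally show "count (mset \<rho>) j = count (mset (map (mode_of T) [0..<n])) j" by simp
  qed
  from amp_mset[OF this]
  have "permanent n (sub_mat U s T) = (\<Prod>j<m. fact (s j)) * amp \<rho> s (\<lambda>_. 0)"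
    by (simp add: permanent_amp[OF assms(4)])
  moreover have "cmod (\<Prod>j<m. fact (s j)) = (\<Prod>j<m. fact (s j))"
    using norm_of_nat[where ?'a = complex, of "\<Prod>j<m. fact (s j)"] by (simp del: norm_of_nat)
  ultimately have "(cmod (permanent n (sub_mat U s T)))\<^sup>2 = (\<Prod>j<m. fact (s j))\<^sup>2 * weight \<rho>"
    by (simp only: weight_full[OF assms(1)] norm_mult power_mult_distrib)
  thus ?thesis unfolding bs_prob_def sum_s
    by (simp add: power2_eq_square)
qed

end

section \<open>Sequential sampling of the output modes\<close>

text \<open>By monotonicity the indices below the threshold form an initial segment, whose length is
  decided by the two values next to its end. For \<open>r = 0\<close> and for \<open>r = M\<close>
  one of the two is missing.\<close>

lemma card_threshold_eq_iff:
  fixes a :: "nat \<Rightarrow> real"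
  assumes "mono a" "r \<le> M"
  shows "card {i. i < M \<and> a i < u} = r \<longleftrightarrow> (r = 0 \<or> a (r - 1) < u) \<and> (r = M \<or> u \<le> a r)"
proof -
  let ?S = "{i. i < M \<and> a i < u}"
  have fin: "finite ?S" by auto
  show ?thesis
  proof
    assume card: "card ?S = r"
    have down: "{..i} \<subseteq> ?S" if "i \<in> ?S" for i
      using that monoD[OF assms(1)] by (auto intro: le_less_trans)
    have "a (r - 1) < u" if "r \<noteq> 0"
    proof (rule ccontr)
      assume *: "\<not> a (r - 1) < u"
      have "i < r - 1" if i: "i \<in> ?S" for i
      proof (rule ccontr)
        assume "\<not> i < r - 1"
        hence "a (r - 1) \<le> a i" by (intro monoD[OF assms(1)]) auto
        thus False using i * by auto
      qed
      hence "?S \<subseteq> {..<r - 1}" by auto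
      hence "card ?S \<le> r - 1" using card_mono[of "{..<r - 1}" ?S] by simp
      thus False using card that by simp
    qed
    moreover have "u \<le> a r" if "r \<noteq> M"
    proof (rule ccontr)
      assume "\<not> u \<le> a r"
      hence "{..r} \<subseteq> ?S" using that assms(2) by (intro down) auto
      hence "card {..r} \<le> card ?S" by (intro card_mono fin)
      thus False using card by simp
    qed
    ultimately show "(r = 0 \<or> a (r - 1) < u) \<and> (r = M \<or> u \<le> a r)" by blast
  next
    assume *: "(r = 0 \<or> a (r - 1) < u) \<and> (r = M \<or> u \<le> a r)"
    have "i \<in> ?S \<longleftrightarrow> i < r" for i
    proof (cases "i < r")
      case True
      hence "a i \<le> a (r - 1)" by (intro monoD[OF assms(1)]) auto
      thus ?thesis using True * assms(2) by auto
    next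
      case False
      hence "a r \<le> a i" by (intro monoD[OF assms(1)]) auto
      thus ?thesis using False * by auto
    qed
    hence "?S = {..<r}" by blast
    thus "card ?S = r" by simp
  qed
qed

text \<open>Inverse transform sampling: the event is an interval between consecutive values of
  \<open>a\<close>.\<close>

lemma
  fixes a :: "nat \<Rightarrow> real"
  assumes "mono a" "r \<le> M"
  shows sets_threshold: "{u. card {i. i < M \<and> a i < u} = r} \<in> sets borel"
    and measure_threshold: "0 \<le> a 0 \<Longrightarrow> a M = 1 \<Longrightarrow>
      measure (uniform_measure lborel {0..1}) {u. card {i. i < M \<and> a i < u} = r} =
        a r - (if r = 0 then 0 else a (r - 1))"
proof -
  have eq: "{u. card {i. i < M \<and> a i < u} = r} = {u. (r = 0 \<or> a (r - 1) < u) \<and> (r = M \<or> u \<le> a r)}"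
    by (simp only: card_threshold_eq_iff[OF assms])
  show meas: "{u. card {i. i < M \<and> a i < u} = r} \<in> sets borel"
    unfolding eq by measurable
  assume a: "0 \<le> a 0" "a M = 1"
  have nonneg: "0 \<le> a i" for i using monoD[OF assms(1), of 0 i] a by simp
  have le1: "a i \<le> 1" if "i \<le> M" for i using monoD[OF assms(1) that] a by simp
  have "measure (uniform_measure lborel {0..1}) {u. card {i. i < M \<and> a i < u} = r} =
      measure lborel ({0..1} \<inter> {u. card {i. i < M \<and> a i < u} = r})"
    using meas by (subst measure_uniform_measure) auto
  \<comment> \<open>For \<open>r = M\<close> the event has no upper end of its own; the unit
    interval supplies it, as \<open>a M = 1\<close>.\<close>
  also have "{0..1} \<inter> {u. card {i. i < M \<and> a i < u} = r} = (if r = 0 then {0..a r} else {a (r - 1)<..a r})"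
    unfolding eq using nonneg[of "r - 1"] le1[OF assms(2)] assms(2) a(2) by auto
  also have "measure lborel \<dots> = a r - (if r = 0 then 0 else a (r - 1))"
    using nonneg[of 0] monoD[OF assms(1), of "r - 1" r] by auto
  finally show "measure (uniform_measure lborel {0..1}) {u. card {i. i < M \<and> a i < u} = r} =
        a r - (if r = 0 then 0 else a (r - 1))" .
qed

lemma prob_space_unit: "prob_space (uniform_measure lborel {0..1::real})"
  by (rule prob_space_uniform_measure) auto

lemma measure_rand_space:
  assumes "\<And>k. k < n \<Longrightarrow> A k \<in> sets borel"
  shows "measure rand_space {\<omega> \<in> space rand_space. \<forall>k<n. \<omega> k \<in> A k} =
      (\<Prod>k<n. measure (uniform_measure lborel {0..1}) (A k))"
    and "{\<omega> \<in> space rand_space. \<forall>k<n. \<omega> k \<in> A k} \<in> sets rand_space"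
proof -
  interpret product_prob_space "\<lambda>_. uniform_measure lborel {0..1::real}" UNIV
    by (intro product_prob_spaceI prob_space_unit)
  have eq: "{\<omega> \<in> space rand_space. \<forall>k<n. \<omega> k \<in> A k} = {\<omega> \<in> space rand_space. \<forall>k\<in>{..<n}. \<omega> k \<in> A k}"
    by auto
  have "emeasure rand_space {\<omega> \<in> space rand_space. \<forall>k\<in>{..<n}. \<omega> k \<in> A k} =
      (\<Prod>k<n. emeasure (uniform_measure lborel {0..1}) (A k))"
    unfolding rand_space_def by (rule emeasure_PiM_Collect) (use assms in auto)
  thus "measure rand_space {\<omega> \<in> space rand_space. \<forall>k<n. \<omega> k \<in> A k} =
      (\<Prod>k<n. measure (uniform_measure lborel {0..1}) (A k))"
    unfolding eq by (simp only: measure_def[of rand_space] M.emeasure_eq_measure prod_ennreal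
      measure_nonneg enn2real_ennreal prod_nonneg)
  show "{\<omega> \<in> space rand_space. \<forall>k<n. \<omega> k \<in> A k} \<in> sets rand_space"
    unfolding eq unfolding rand_space_def
    by (intro sets.sets_Collect_finite_All sets_Collect_single') (use assms in auto)
qed

context boson_sampling begin

definition cum :: "nat list \<Rightarrow> nat \<Rightarrow> real" where
  "cum \<rho> r = (\<Sum>i\<le>r. weight (\<rho> @ [i]))"

text \<open>The number of partial sums below the threshold is the smallest mode whose partial sum reaches
  it, capped at m - 1; the cap makes it a mode even for samples outside the unit interval.\<close>
definition pick :: "nat list \<Rightarrow> real \<Rightarrow> nat" where
  "pick \<rho> u = card {r. r < m - 1 \<and> cum \<rho> r < u * (real (n - length \<rho>) * weight \<rho>)}"

fun picks :: "(nat \<Rightarrow> real) \<Rightarrow> nat \<Rightarrow> nat list" where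
  "picks \<omega> 0 = []"
| "picks \<omega> (Suc k) = picks \<omega> k @ [pick (picks \<omega> k) (\<omega> k)]"

lemma pick_less: "pick \<rho> u < m"
proof -
  have "pick \<rho> u \<le> card {..<m - 1}"
    unfolding pick_def by (intro card_mono) auto
  thus ?thesis using m_pos by simp
qed

lemma length_picks [simp]: "length (picks \<omega> k) = k"
  by (induction k) auto

lemma set_picks: "set (picks \<omega> k) \<subseteq> {..<m}"
  by (induction k) (auto simp: pick_less)

lemma picks_eq_iff:
  "length \<rho> = k \<Longrightarrow> picks \<omega> k = \<rho> \<longleftrightarrow> (\<forall>i<k. pick (take i \<rho>) (\<omega> i) = \<rho> ! i)"
proof (induction k arbitrary: \<rho>)
  case (Suc k)
  then obtain \<rho>' r where \<rho>: "\<rho> = \<rho>' @ [r]" "length \<rho>' = k"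
    by (metis length_Suc_conv_rev)
  show ?case
    using Suc.IH[OF \<rho>(2)] by (auto simp: \<rho> nth_append less_Suc_eq)
qed simp

text \<open>Stated as a product instead of a conditional probability, so that it also covers a state
  of weight 0.\<close>

lemma
  assumes len: "length \<rho> < n" and r: "r < m"
  shows sets_pick: "{u. pick \<rho> u = r} \<in> sets borel"
    and measure_pick: "weight (\<rho> @ [r]) =
      measure (uniform_measure lborel {0..1}) {u. pick \<rho> u = r} * (real (n - length \<rho>) * weight \<rho>)"
proof -
  define Z where "Z = real (n - length \<rho>) * weight \<rho>"
  have Z: "Z \<ge> 0" using weight_nonneg by (simp add: Z_def)
  have sum: "(\<Sum>r<m. weight (\<rho> @ [r])) = Z" using weight_sum[of \<rho>] len by (simp add: Z_def)
  have "{u. pick \<rho> u = r} \<in> sets borel \<and>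
      weight (\<rho> @ [r]) = measure (uniform_measure lborel {0..1}) {u. pick \<rho> u = r} * Z"
  \<comment> \<open>At total weight 0 the threshold is 0 for every \<open>u\<close>; then
    \<open>pick\<close> is constant and both sides of the equation vanish.\<close>
  proof (cases "Z = 0")
    case True
    have "weight (\<rho> @ [r]) = 0"
      using sum sum_nonneg_eq_0_iff[of "{..<m}" "\<lambda>r. weight (\<rho> @ [r])"] True weight_nonneg r by simp
    moreover have "{u. pick \<rho> u = r} = {} \<or> {u. pick \<rho> u = r} = UNIV"
      using True by (auto simp: pick_def Z_def)
    ultimately show ?thesis using True by auto
  next
    case False
    define a where "a i = cum \<rho> i / Z" for i
    have mono: "mono a"
      unfolding a_def cum_def using Z weight_nonneg
      by (intro monoI divide_right_mono sum_mono2) auto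
    have a0: "0 \<le> a 0" using Z weight_nonneg by (simp add: a_def cum_def)
    have "{..m - 1} = {..<m}" using m_pos by auto
    hence a1: "a (m - 1) = 1" using sum False by (simp add: a_def cum_def)
    have set_eq: "{u. pick \<rho> u = r} = {u. card {i. i < m - 1 \<and> a i < u} = r}"
      using False Z by (simp add: pick_def a_def divide_less_eq flip: Z_def)
    have "r \<le> m - 1" using r by simp
    note thr = sets_threshold[OF mono this] measure_threshold[OF mono this a0 a1]
    have "a r - (if r = 0 then 0 else a (r - 1)) = weight (\<rho> @ [r]) / Z"
      by (cases r) (auto simp: a_def cum_def simp flip: diff_divide_distrib)
    thus ?thesis using thr False by (simp add: set_eq)
  qed
  thus "{u. pick \<rho> u = r} \<in> sets borel" "weight (\<rho> @ [r]) =
      measure (uniform_measure lborel {0..1}) {u. pick \<rho> u = r} * (real (n - length \<rho>) * weight \<rho>)"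
    by (simp_all add: Z_def)
qed

text \<open>The conditional probabilities multiply along \<rho>. The factors n - i from
  \<open>weight_sum\<close> gather to n!, and the initial weight contributes 1 / s!.\<close>

lemma
  assumes \<rho>: "length \<rho> = n" "set \<rho> \<subseteq> {..<m}"
  shows measure_picks: "measure rand_space {\<omega> \<in> space rand_space. picks \<omega> n = \<rho>} =
      (\<Prod>j<m. fact (s j)) * weight \<rho> / fact n"
    and sets_picks: "{\<omega> \<in> space rand_space. picks \<omega> n = \<rho>} \<in> sets rand_space"
proof -
  let ?A = "\<lambda>k. {u. pick (take k \<rho>) u = \<rho> ! k}"
  have nth: "\<rho> ! k < m" if "k < n" for k using \<rho> that nth_mem by blast
  have eq: "{\<omega> \<in> space rand_space. picks \<omega> n = \<rho>} = {\<omega> \<in> space rand_space. \<forall>k<n. \<omega> k \<in> ?A k}"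
    using picks_eq_iff[OF \<rho>(1)] by auto
  have A: "?A k \<in> sets borel" if "k < n" for k
    using that nth \<rho>(1) by (intro sets_pick) auto
  show "{\<omega> \<in> space rand_space. picks \<omega> n = \<rho>} \<in> sets rand_space"
    unfolding eq by (rule measure_rand_space(2)[OF A])
  let ?p = "\<lambda>k. measure (uniform_measure lborel {0..1}) (?A k)"
  have "weight (take k \<rho>) = (\<Prod>i<k. ?p i) * (\<Prod>i<k. real (n - i)) * weight []" if "k \<le> n" for k
    using that
  proof (induction k)
    case (Suc k)
    have "take (Suc k) \<rho> = take k \<rho> @ [\<rho> ! k]"
      using Suc.prems \<rho>(1) by (intro take_Suc_conv_app_nth) auto
    thus ?case
      using measure_pick[of "take k \<rho>" "\<rho> ! k"] Suc nth[of k] \<rho>(1) by (simp add: min_def)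
  qed simp
  from this[of n] have "weight \<rho> = (\<Prod>i<n. ?p i) * fact n / (\<Prod>j<m. fact (s j))"
    using \<rho>(1) by (simp add: weight_Nil fact_prod_rev atLeast0LessThan)
  hence "(\<Prod>i<n. ?p i) = (\<Prod>j<m. fact (s j)) * weight \<rho> / fact n"
    by (simp add: field_simps)
  thus "measure rand_space {\<omega> \<in> space rand_space. picks \<omega> n = \<rho>} =
      (\<Prod>j<m. fact (s j)) * weight \<rho> / fact n"
    unfolding eq using measure_rand_space(1)[of n ?A, OF A] by simp
qed

text \<open>The n! / T! orderings of the outcome are disjoint events of equal probability, each
  being the outcome probability times T! / n!.\<close>

lemma measure_count_picks:
  assumes T: "occ_vec m n T"
  shows "measure rand_space {\<omega> \<in> space rand_space. \<forall>i<m. count_list (picks \<omega> n) i = T i} = bs_prob m U s T"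
proof -
  interpret prob_space rand_space
    unfolding rand_space_def by (intro prob_space_PiM prob_space_unit)
  define M where "M = mset (map (mode_of T) [0..<n])"
  let ?R = "permutations_of_multiset M"
  have count_M: "count M j = T j" for j unfolding M_def by (rule count_mode_of[OF T])
  have R: "length \<rho> = n" "set \<rho> \<subseteq> {..<m}" "\<And>i. count_list \<rho> i = T i" if "\<rho> \<in> ?R" for \<rho>
  proof -
    have \<rho>: "mset \<rho> = M" using that by (auto dest: permutations_of_multisetD)
    show "length \<rho> = n" using arg_cong[OF \<rho>, of size] by (simp add: M_def)
    show "set \<rho> \<subseteq> {..<m}" using arg_cong[OF \<rho>, of set_mset] mode_of_less[OF T] by (auto simp: M_def)
    show "count_list \<rho> i = T i" for i using \<rho> count_M[of i] by (simp flip: count_mset)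
  qed
  have "(\<forall>i<m. count_list (picks \<omega> n) i = T i) \<longleftrightarrow> picks \<omega> n \<in> ?R" for \<omega>
  proof
    assume *: "\<forall>i<m. count_list (picks \<omega> n) i = T i"
    have "mset (picks \<omega> n) = M"
    proof (rule multiset_eqI)
      fix j
      show "count (mset (picks \<omega> n)) j = count M j"
        using * T set_picks[of \<omega> n]
        by (cases "j < m") (auto simp: count_M count_mset occ_vec_def count_list_0_iff)
    qed
    thus "picks \<omega> n \<in> ?R" by (rule permutations_of_multisetI)
  qed (use R in blast)
  hence "{\<omega> \<in> space rand_space. \<forall>i<m. count_list (picks \<omega> n) i = T i} =
      (\<Union>\<rho>\<in>?R. {\<omega> \<in> space rand_space. picks \<omega> n = \<rho>})"
    by auto
  hence "measure rand_space {\<omega> \<in> space rand_space. \<forall>i<m. count_list (picks \<omega> n) i = T i} =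
      (\<Sum>\<rho>\<in>?R. measure rand_space {\<omega> \<in> space rand_space. picks \<omega> n = \<rho>})"
    by (simp only:) (rule finite_measure_finite_Union,
      auto simp: disjoint_family_on_def intro!: sets_picks R)
  also have "\<dots> = (\<Sum>\<rho>\<in>?R. bs_prob m U s T * (\<Prod>j<m. fact (T j)) / fact n)"
  proof (intro sum.cong refl)
    fix \<rho> assume \<rho>: "\<rho> \<in> ?R"
    have "(\<Prod>j<m. fact (T j)) \<noteq> (0 :: real)" by simp
    thus "measure rand_space {\<omega> \<in> space rand_space. picks \<omega> n = \<rho>} =
        bs_prob m U s T * (\<Prod>j<m. fact (T j)) / fact n"
      using R[OF \<rho>] by (simp add: measure_picks bs_prob_weight[of \<rho>] T)
  qed
  also have "\<dots> = bs_prob m U s T * (real (card ?R) * (\<Prod>j<m. fact (T j))) / fact n"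
    by simp
  also have "real (card ?R) * (\<Prod>j<m. fact (T j)) = fact n"
  proof -
    have "set_mset M \<subseteq> {..<m}" using mode_of_less[OF T] by (auto simp: M_def)
    hence "(\<Prod>x\<in>set_mset M. fact (count M x)) = (\<Prod>j<m. fact (T j) :: nat)"
      by (intro prod.mono_neutral_cong_left) (auto simp: count_M simp flip: count_eq_zero_iff)
    hence "card ?R * (\<Prod>j<m. fact (T j)) = fact n"
      using card_permutations_of_multiset_aux[of M] by (simp add: M_def)
    hence "real (card ?R * (\<Prod>j<m. fact (T j))) = real (fact n)" by (simp only:)
    thus ?thesis by simp
  qed
  finally show ?thesis by simp
qed

end

section \<open>Mixed-radix enumeration of configurations\<close>

context boson_sampling begin

text \<open>Place values of the mixed-radix system with radix \<open>s j + 1\<close> at position j;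
  \<open>stride m\<close> is N.\<close>

definition stride :: "nat \<Rightarrow> nat" where
  "stride k = (\<Prod>l<k. s l + 1)"

definition digits :: "nat \<Rightarrow> nat \<Rightarrow> nat" where
  "digits x j = (x div stride j) mod (s j + 1)"

definition encode :: "nat \<Rightarrow> (nat \<Rightarrow> nat) \<Rightarrow> nat" where
  "encode k c = (\<Sum>l<k. c l * stride l)"

lemma stride_Suc: "stride (Suc k) = stride k * (s k + 1)"
  by (simp add: stride_def)

lemma stride_pos: "stride k > 0"
  by (auto simp: stride_def intro!: prod_pos)

lemma encode_less: "(\<And>l. c l \<le> s l) \<Longrightarrow> encode k c < stride k"
proof (induction k)
  case (Suc k)
  have "encode (Suc k) c < stride k + c k * stride k"
    using Suc by (simp add: encode_def)
  also have "\<dots> \<le> stride k + s k * stride k" using Suc.prems by simp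
  finally show ?case by (simp add: stride_Suc algebra_simps)
qed (simp add: encode_def stride_def)

text \<open>Makes the digits above position j invisible at j: their contribution is a multiple of
  \<open>stride j * (s j + 1)\<close>.\<close>

lemma stride_dvd: "j < k \<Longrightarrow> stride j * (s j + 1) dvd stride k"
proof (induction k)
  case (Suc k)
  thus ?case by (cases "j = k") (auto simp: stride_Suc intro: dvd_mult2)
qed simp

lemma digit_encode:
  assumes c: "\<And>l. c l \<le> s l"
  shows "j < k \<Longrightarrow> digits (encode k c) j = c j"
proof (induction k)
  case (Suc k)
  have enc: "encode (Suc k) c = encode k c + c k * stride k" by (simp add: encode_def)
  show ?case
  proof (cases "j = k")
    case True
    have "encode (Suc k) c div stride k = c k"
      using encode_less[of c k, OF c] stride_pos[of k] by (simp add: enc)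
    thus ?thesis using True c[of k] by (simp add: digits_def)
  next
    case False
    hence "j < k" using Suc by simp
    then obtain x where x: "stride k = stride j * (s j + 1) * x"
      using stride_dvd[OF \<open>j < k\<close>] unfolding dvd_def by blast
    have "encode (Suc k) c = encode k c + stride j * ((s j + 1) * (c k * x))"
      by (simp only: enc x) (simp only: mult_ac)
    hence "encode (Suc k) c div stride j = encode k c div stride j + (s j + 1) * (c k * x)"
      using stride_pos[of j] by (simp only: div_mult_self2)
    hence "digits (encode (Suc k) c) j = digits (encode k c) j"
      by (simp only: digits_def mod_mult_self2)
    thus ?thesis using Suc.IH[OF \<open>j < k\<close>] by simp
  qed
qed simp

lemma digits_le: "digits x j \<le> s j"
  using pos_mod_bound[of "s j + 1" "x div stride j"]
  by (simp add: digits_def)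

lemma digits_configs: "digits x \<in> configs"
  by (simp add: configs_iff digits_le)

lemma digits_encode: "c \<in> configs \<Longrightarrow> digits (encode m c) = c"
proof
  fix j assume c: "c \<in> configs"
  show "digits (encode m c) j = c j"
  proof (cases "j < m")
    case True
    thus ?thesis using c by (intro digit_encode) (simp_all add: configs_iff)
  next
    case False
    thus ?thesis using c s_outside[of j] digits_le[of _ j] by (simp add: configs_iff) (metis le_zero_eq)
  qed
qed

lemma encode_digits_mod: "encode k (digits x) = x mod stride k"
proof (induction k)
  case (Suc k)
  thus ?case by (simp only: stride_Suc mod_mult2_eq) (simp add: encode_def digits_def)
qed (simp add: encode_def stride_def)

lemma encode_digits: "x < stride m \<Longrightarrow> encode m (digits x) = x"
  by (simp add: encode_digits_mod)

lemma sum_digits: "(\<Sum>x<stride m. f (digits x)) = (\<Sum>c\<in>configs. f c)"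
  by (rule sum.reindex_bij_witness[where i = "encode m" and j = digits])
     (auto simp: encode_digits digits_encode digits_configs digits_le configs_iff intro!: encode_less)

text \<open>A digit below its maximum can be raised without a carry. This is how the program
  addresses the neighbour of a configuration with one more photon in mode j.\<close>

lemma digits_add:
  assumes "x < stride m" "j < m" "digits x j < s j"
  shows "x + stride j < stride m" "digits (x + stride j) = (digits x)(j := Suc (digits x j))"
proof -
  let ?c = "(digits x)(j := Suc (digits x j))"
  have c: "?c \<in> configs" using assms(3) by (auto simp: configs_iff digits_le)
  have "encode m ?c = encode m (digits x) + stride j"
    using assms(2) unfolding encode_def by (subst (1 2) sum.remove[of _ j]) auto
  hence eq: "encode m ?c = x + stride j" by (simp add: encode_digits assms(1))
  show "x + stride j < stride m" unfolding eq [symmetric] using c by (intro encode_less) (auto simp: configs_iff)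
  show "digits (x + stride j) = ?c" unfolding eq [symmetric] by (rule digits_encode[OF c])
qed

lemma digits_last: "digits (stride m - 1) = s"
proof -
  have "encode k s + 1 = stride k" for k
    by (induction k) (simp_all add: encode_def stride_def algebra_simps)
  hence "stride m - 1 = encode m s" by (metis add_diff_cancel_right')
  thus ?thesis by (simp add: digits_encode configs_iff)
qed

section \<open>Restriction to the occupied modes\<close>

definition occupied :: "nat list" where
  "occupied = filter (\<lambda>j. s j \<noteq> 0) [0..<m]"

text \<open>The modulus of the remainder still to be decoded when only the occupied modes with list
  index below i are left.\<close>

definition top_stride :: "nat \<Rightarrow> nat" where
  "top_stride i = (if i < length occupied then stride (occupied ! i) else stride m)"

lemma set_occupied: "set occupied = {j. j < m \<and> s j \<noteq> 0}"
  by (auto simp: occupied_def)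

lemma distinct_occupied: "distinct occupied"
  by (simp add: occupied_def)

lemma occupied_nth: "i < length occupied \<Longrightarrow> occupied ! i < m \<and> s (occupied ! i) \<noteq> 0"
  using nth_mem[of i occupied] by (auto simp: set_occupied)

lemma stride_eq:
  assumes "j \<le> k" "\<And>l. j \<le> l \<Longrightarrow> l < k \<Longrightarrow> s l = 0"
  shows "stride k = stride j"
  unfolding stride_def using assms by (intro prod.mono_neutral_right) auto

text \<open>The modes between two neighbouring occupied ones are empty and have radix 1, so the
  place value does not change across them.\<close>

lemma top_stride_Suc:
  assumes i: "i < length occupied"
  shows "top_stride (Suc i) = stride (occupied ! i) * (s (occupied ! i) + 1)"
proof -
  let ?j = "occupied ! i" and ?k = "if Suc i < length occupied then occupied ! Suc i else m"
  have sorted: "sorted_wrt (<) occupied" by (simp add: occupied_def sorted_wrt_filter)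
  have "stride ?k = stride (Suc ?j)"
  proof (rule stride_eq)
    show "Suc ?j \<le> ?k"
      using occupied_nth[OF i] sorted_wrt_nth_less[OF sorted, of i "Suc i"] by auto
    fix l assume l: "Suc ?j \<le> l" "l < ?k"
    show "s l = 0"
    proof (rule ccontr)
      assume "s l \<noteq> 0"
      moreover have "l < m" using l(2) occupied_nth[of "Suc i"] by (auto split: if_splits)
      ultimately obtain p where p: "p < length occupied" "occupied ! p = l"
        using set_occupied by (metis (mono_tags, lifting) in_set_conv_nth mem_Collect_eq)
      consider "p \<le> i" | "p = Suc i" | "Suc i < p" by linarith
      thus False
      proof cases
        case 1
        hence "l \<le> ?j" using sorted_wrt_nth_less[OF sorted, of p i] p i by (cases "p = i") auto
        thus False using l by simp
      next
        case 3
        hence "?k < l" using sorted_wrt_nth_less[OF sorted, of "Suc i" p] p by auto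
        thus False using l by simp
      qed (use p l in auto)
    qed
  qed
  thus ?thesis by (auto simp: top_stride_def stride_Suc)
qed

lemma sum_occupied: "(\<And>j. j < m \<Longrightarrow> s j = 0 \<Longrightarrow> f j = 0) \<Longrightarrow>
    (\<Sum>i<length occupied. f (occupied ! i)) = (\<Sum>j<m. f j)"
  for f :: "nat \<Rightarrow> 'a :: comm_monoid_add"
proof -
  assume f: "\<And>j. j < m \<Longrightarrow> s j = 0 \<Longrightarrow> f j = 0"
  have "(\<Sum>i<length occupied. f (occupied ! i)) = (\<Sum>j\<in>set occupied. f j)"
    by (rule sum.reindex_bij_betw[OF bij_betw_nth[OF distinct_occupied refl refl]])
  also have "\<dots> = (\<Sum>j<m. f j)"
    using f by (intro sum.mono_neutral_left) (auto simp: set_occupied)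
  finally show ?thesis .
qed

lemma prod_occupied: "(\<And>j. j < m \<Longrightarrow> s j = 0 \<Longrightarrow> f j = 1) \<Longrightarrow>
    (\<Prod>i<length occupied. f (occupied ! i)) = (\<Prod>j<m. f j)"
  for f :: "nat \<Rightarrow> 'a :: comm_monoid_mult"
proof -
  assume f: "\<And>j. j < m \<Longrightarrow> s j = 0 \<Longrightarrow> f j = 1"
  have "(\<Prod>i<length occupied. f (occupied ! i)) = (\<Prod>j\<in>set occupied. f j)"
    by (rule prod.reindex_bij_betw[OF bij_betw_nth[OF distinct_occupied refl refl]])
  also have "\<dots> = (\<Prod>j<m. f j)"
    using f by (intro prod.mono_neutral_left) (auto simp: set_occupied)
  finally show ?thesis .
qed

end

section \<open>Computing one amplitude\<close>

text \<open>Registers 0 to 12 are constant from the end of the set-up until the output is written;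
  13 to 22 belong to the loops over photons, modes and indices; 23 to 31 are scratch, and they are
  all that \<open>entry\<close> changes. The frame conditions use these ranges.\<close>

abbreviation (input) "rM \<equiv> 0 :: nat"
abbreviation (input) "rOff \<equiv> 1 :: nat"
abbreviation (input) "rOne \<equiv> 2 :: nat"
abbreviation (input) "rZero \<equiv> 3 :: nat"
abbreviation (input) "rLow \<equiv> 4 :: nat"
abbreviation (input) "rRecs \<equiv> 5 :: nat"
abbreviation (input) "rEnd \<equiv> 6 :: nat"
abbreviation (input) "rTally \<equiv> 7 :: nat"
abbreviation (input) "rState \<equiv> 8 :: nat"
abbreviation (input) "rDim \<equiv> 9 :: nat"
abbreviation (input) "rN \<equiv> 10 :: nat"
abbreviation (input) "rLast \<equiv> 11 :: nat"
abbreviation (input) "rThree \<equiv> 12 :: nat"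
abbreviation (input) "rK \<equiv> 13 :: nat"
abbreviation (input) "rWeight \<equiv> 14 :: nat"
abbreviation (input) "rTFact \<equiv> 15 :: nat"
abbreviation (input) "rSFact \<equiv> 16 :: nat"
abbreviation (input) "rI \<equiv> 17 :: nat"
abbreviation (input) "rPick \<equiv> 18 :: nat"
abbreviation (input) "rCum \<equiv> 19 :: nat"
abbreviation (input) "rThr \<equiv> 20 :: nat"
abbreviation (input) "rIdx \<equiv> 21 :: nat"
abbreviation (input) "rRow \<equiv> 22 :: nat"
abbreviation (input) "rRem \<equiv> 23 :: nat"
abbreviation (input) "rFact \<equiv> 24 :: nat"
abbreviation (input) "rAmp \<equiv> 25 :: nat"
abbreviation (input) "rRec \<equiv> 26 :: nat"
abbreviation (input) "rStride \<equiv> 27 :: nat"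
abbreviation (input) "rOcc \<equiv> 28 :: nat"
abbreviation (input) "rA \<equiv> 29 :: nat"
abbreviation (input) "rDigit \<equiv> 30 :: nat"
abbreviation (input) "rB \<equiv> 31 :: nat"

text \<open>The machine has no integer division: digits are found by repeated subtraction. The register
  rRem holds the remainder plus one, so that the exit test for remainder < stride is a comparison
  of the form \<le>.\<close>
definition digit_loop :: com where
  "digit_loop =
     Until rRem rStride
       (Block [Sub rRem rStride rRem, Add rDigit rOne rDigit, Mul rFact rDigit rFact])"

text \<open>The comparison with \<open>rLow\<close>, which holds 32, realises \<open>loc\<close>: an
  address among the lowest 32 cells is redirected to its saved copy.\<close>

definition gather :: com where
  "gather =
     Block [Add rRow rA rA] ;;
     Cond rLow rA (Block []) (Block [Add rA rOff rA]) ;;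
     Block [Load rA rA, Add rState rIdx rB, Add rB rStride rB, Load rB rB,
       Mul rA rB rA, Add rAmp rA rAmp]"

text \<open>\<open>rRec\<close> moves downwards through the records, so digits are found from the
  largest place value to the smallest. At a maximal digit there is no neighbour to read, and
  \<open>gather\<close> is skipped.\<close>

definition record_body :: com where
  "record_body =
     Block [Sub rRec rThree rRec, Load rStride rRec, Add rRec rOne rB, Load rOcc rB,
       Add rB rOne rB, Load rA rB, Const rDigit 0] ;;
     digit_loop ;;
     Cond rOcc rDigit (Block []) gather"

definition entry :: com where
  "entry =
     Block [Add rIdx rOne rRem, Const rFact 1, Const rAmp 0, Add rEnd rZero rRec] ;;
     Until rRec rRecs record_body"

definition norm_entry :: com where
  "norm_entry =
     entry ;; Block [Conj rAmp rB, Mul rAmp rB rB, Div rB rFact rB, Add rCum rB rCum]"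

text \<open>The digit counter runs through 1, 2, and so on; multiplying each value into
  \<open>rFact\<close> yields the factorial of the digit without another loop.\<close>

lemma digit_loop:
  assumes "r rRem = of_nat (x + 1)" "r rStride = of_nat d" "0 < d" "r rDigit = 0" "r rOne = 1"
    "x div d \<le> b"
  shows "tri \<omega> digit_loop r q (5 * b + 1) (\<lambda>r' q'. q' = q \<and>
    r' = r(rRem := of_nat (x mod d + 1), rDigit := of_nat (x div d), rFact := r rFact * fact (x div d)))"
  unfolding digit_loop_def
proof (rule tri_until[where l = 0 and K = "x div d" and b = 3 and Inv = "\<lambda>k r' q'. q' = q \<and>
    r' = r(rRem := of_nat (x - k * d + 1), rDigit := of_nat k, rFact := r rFact * fact k)"])
  fix k r' q'
  assume k: "k < x div d" and inv: "q' = q \<and>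
    r' = r(rRem := of_nat (x - k * d + 1), rDigit := of_nat k, rFact := r rFact * fact k)"
  have "Suc k * d \<le> x div d * d" using k by (intro mult_right_mono) auto
  hence le: "Suc k * d \<le> x" by (rule le_trans) simp
  have eq: "of_nat (x - k * d + 1) - of_nat d = (of_nat (x - Suc k * d + 1) :: complex)"
    using le by (subst of_nat_diff [symmetric]) (auto simp: algebra_simps)
  show "\<not> Re (r' rRem) \<le> Re (r' rStride) \<and> tri \<omega>
     (Block [Sub rRem rStride rRem, Add rDigit rOne rDigit, Mul rFact rDigit rFact]) r' q' 3 (\<lambda>r' q'. q' = q \<and>
    r' = r(rRem := of_nat (x - Suc k * d + 1), rDigit := of_nat (Suc k), rFact := r rFact * fact (Suc k)))"
  proof
    have "d < x - k * d + 1" using le by (simp add: algebra_simps)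
    hence "real d < real (x - k * d + 1)" by (simp only: of_nat_less_iff)
    moreover have "r' rRem = of_nat (x - k * d + 1)" "r' rStride = of_nat d"
      using inv assms by (simp_all only: fun_upd_def) simp_all
    ultimately show "\<not> Re (r' rRem) \<le> Re (r' rStride)" by (simp only: complex_Re_of_nat not_le)
    show "tri \<omega> (Block [Sub rRem rStride rRem, Add rDigit rOne rDigit, Mul rFact rDigit rFact]) r' q' 3 (\<lambda>r' q'. q' = q \<and>
      r' = r(rRem := of_nat (x - Suc k * d + 1), rDigit := of_nat (Suc k), rFact := r rFact * fact (Suc k)))"
      using inv assms eq
      by (intro tri_block) (auto simp: fun_eq_iff algebra_simps simp del: of_nat_add)
  qed
next
  fix r' q'
  assume inv: "q' = q \<and>
    r' = r(rRem := of_nat (x - x div d * d + 1), rDigit := of_nat (x div d), rFact := r rFact * fact (x div d))"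
  have "x mod d + 1 \<le> d" using mod_less_divisor[OF \<open>0 < d\<close>, of x] by simp
  hence "real (x mod d + 1) \<le> real d" by (simp only: of_nat_le_iff)
  thus "Re (r' rRem) \<le> Re (r' rStride) \<and> q' = q \<and>
    r' = r(rRem := of_nat (x mod d + 1), rDigit := of_nat (x div d), rFact := r rFact * fact (x div d))"
    using inv assms by (simp add: minus_div_mult_eq_mod)
qed (use assms in \<open>auto simp: fun_eq_iff\<close>)

lemma gather:
  assumes "r rA = of_nat c" "r rRow = of_nat w" "r rLow = 32" "r rOff = of_nat off"
    "r rState = of_nat G" "r rIdx = of_nat x" "r rStride = of_nat d" "30 \<le> off" "2 \<le> c" "32 \<le> G"
  shows "tri \<omega> gather r q 10 (\<lambda>r' q'. q' = q \<and> (\<forall>a. a \<notin> {rA, rB, rAmp} \<longrightarrow> r' a = r a) \<and>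
    r' rAmp = r rAmp + r (if c + w < 32 then off + (c + w) else c + w) * r (G + x + d))"
  unfolding gather_def
proof (rule tri_seq[where ba = 1 and bb = 9])
  show "tri \<omega> (Block [Add rRow rA rA]) r q 1 (\<lambda>r' q'. q' = q \<and> r' = r(rA := of_nat (c + w)))"
    using assms by (intro tri_block) (auto simp: algebra_simps)
next
  fix r1 q1 assume r1: "q1 = q \<and> r1 = r(rA := of_nat (c + w))"
  let ?a = "if c + w < 32 then off + (c + w) else c + w"
  \<comment> \<open>Keeps the cell to be loaded clear of the registers, which have changed
    meanwhile.\<close>
  have a: "?a \<ge> 32" using assms by auto
  show "tri \<omega> (Cond rLow rA (Block []) (Block [Add rA rOff rA]) ;;
     Block [Load rA rA, Add rState rIdx rB, Add rB rStride rB, Load rB rB,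
       Mul rA rB rA, Add rAmp rA rAmp]) r1 q1 9 (\<lambda>r' q'. q' = q \<and> (\<forall>a. a \<notin> {rA, rB, rAmp} \<longrightarrow> r' a = r a) \<and>
    r' rAmp = r rAmp + r ?a * r (G + x + d))"
  proof (rule tri_seq[where ba = 3 and bb = 6])
    have le: "32 \<le> real c + real w \<longleftrightarrow> 32 \<le> c + w"
      by linarith
    show "tri \<omega> (Cond rLow rA (Block []) (Block [Add rA rOff rA])) r1 q1 3
        (\<lambda>r' q'. q' = q \<and> r' = r(rA := of_nat ?a))"
      using r1 assms le
      by (intro tri_cond[where ba = 1] tri_block) (auto simp: algebra_simps)
  next
    fix r2 q2 assume r2: "q2 = q \<and> r2 = r(rA := of_nat ?a)"
    show "tri \<omega> (Block [Load rA rA, Add rState rIdx rB, Add rB rStride rB, Load rB rB,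
       Mul rA rB rA, Add rAmp rA rAmp]) r2 q2 6 (\<lambda>r' q'. q' = q \<and> (\<forall>a. a \<notin> {rA, rB, rAmp} \<longrightarrow> r' a = r a) \<and>
      r' rAmp = r rAmp + r ?a * r (G + x + d))"
      using a assms r2 by (intro tri_block) (auto simp del: of_nat_add)
  qed simp
qed simp

context boson_sampling begin

text \<open>The input occupies the cells from 0 on, so the program first moves the cells 2 to 31, which it
  needs as registers, to the cells off + 2 to off + 31; loc is where input cell a is then found.
  Three cells are kept per occupied mode j from recs on: its stride, s j, and the address 2 + j of the
  first entry of column j of U. The counts of detected photons start at tally (followed by one cell for
  the final probability) and the state at state.\<close>
definition off :: nat where "off = 16 * (m * m + m) - 2"
definition recs :: nat where "recs = off + 64"
definition tally :: nat where "tally = recs + 3 * m"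
definition state :: nat where "state = tally + m + 1"

definition loc :: "nat \<Rightarrow> nat" where
  "loc a = (if a < 32 then off + a else a)"

lemma layout: "off \<ge> 30" "recs \<ge> 94" "recs = off + 64" "tally = recs + 3 * m" "state = tally + m + 1"
    "m * m + m + 2 \<le> off + 2"
proof -
  define k where "k = m * m"
  have "k \<ge> 1" using m_pos by (simp add: k_def)
  moreover from this have "off + 2 = 16 * k + 16 * m" by (simp add: off_def k_def)
  ultimately have "off \<ge> 30 \<and> m * m + m + 2 \<le> off + 2"
    using m_pos unfolding k_def [symmetric] by linarith
  thus "off \<ge> 30" "m * m + m + 2 \<le> off + 2" by auto
  thus "recs \<ge> 94" "recs = off + 64" "tally = recs + 3 * m" "state = tally + m + 1"
    by (simp_all add: recs_def tally_def state_def)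
qed

lemma loc_bounds: "2 \<le> a \<Longrightarrow> a < 2 + m * m + m \<Longrightarrow> 32 \<le> loc a \<and> loc a < recs"
  using layout by (auto simp: loc_def)

lemma matrix_index: "i < m \<Longrightarrow> j < m \<Longrightarrow> i * m + j < m * m"
proof -
  assume "i < m" "j < m"
  hence "i * m + j < (i + 1) * m" by simp
  also have "\<dots> \<le> m * m" using \<open>i < m\<close> by (intro mult_right_mono) auto
  finally show ?thesis .
qed

definition static :: "(nat \<Rightarrow> complex) \<Rightarrow> bool" where
  "static r \<longleftrightarrow> r rM = of_nat m \<and> r rOff = of_nat off \<and> r rOne = 1 \<and> r rZero = 0 \<and> r rLow = 32 \<and>
     r rRecs = of_nat recs \<and> r rEnd = of_nat (recs + 3 * length occupied) \<and>
     r rTally = of_nat tally \<and> r rState = of_nat state \<and> r rDim = of_nat (stride m) \<and>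
     r rN = of_nat n \<and> r rLast = of_nat (m - 1) \<and> r rThree = 3 \<and>
     (\<forall>i<m. \<forall>j<m. r (loc (2 + j + i * m)) = U i j) \<and>
     (\<forall>i<length occupied. r (recs + 3 * i) = of_nat (stride (occupied ! i)) \<and>
        r (recs + 3 * i + 1) = of_nat (s (occupied ! i)) \<and>
        r (recs + 3 * i + 2) = of_nat (2 + occupied ! i))"

lemma length_occupied: "length occupied \<le> m"
  unfolding occupied_def by (rule order_trans[OF length_filter_le]) simp

text \<open>Frame rule of the sampling phase: only the registers 13 to 31 and the cells from
  \<open>tally\<close> on are mutable.\<close>

lemma static_cong:
  assumes st: "static r" and eq: "\<And>a. a \<notin> {13..31} \<Longrightarrow> a < tally \<Longrightarrow> r' a = r a"
  shows "static r'"
proof -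
  have low: "r' a = r a" if "a < 13" for a
    using that layout by (intro eq) auto
  have mat: "r' (loc (2 + j + i * m)) = r (loc (2 + j + i * m))" if "i < m" "j < m" for i j
    using that layout loc_bounds[of "2 + j + i * m"] matrix_index[of i j] by (intro eq) auto
  have rec: "r' (recs + 3 * i + k) = r (recs + 3 * i + k)" if "i < length occupied" "k < 3" for i k
    using that layout length_occupied by (intro eq) auto
  show ?thesis
    using st rec[of _ 0] rec[of _ 1] rec[of _ 2] mat unfolding static_def
    by (simp add: low)
qed

text \<open>\<psi> is the state before the update. Only the indices above x have to hold it, so the
  lemma serves both for evaluating a candidate and for overwriting the state.\<close>

lemma record_body:
  assumes st: "static r" and i: "i < length occupied"
    and rec: "r rRec = of_nat (recs + 3 * Suc i)"
    and rem: "r rRem = of_nat (x mod top_stride (Suc i) + 1)"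
    and x: "r rIdx = of_nat x" "x < stride m" and w: "r rRow = of_nat (w * m)" "w < m"
    and \<psi>: "\<And>y. x < y \<Longrightarrow> y < stride m \<Longrightarrow> r (state + y) = \<psi> (digits y)"
  defines "j \<equiv> occupied ! i"
  shows "tri \<omega> record_body r q (5 * stride m + 20) (\<lambda>r' q'. q' = q \<and> (\<forall>a. a \<notin> {23..31} \<longrightarrow> r' a = r a) \<and>
    r' rRec = of_nat (recs + 3 * i) \<and> r' rRem = of_nat (x mod top_stride i + 1) \<and>
    r' rFact = r rFact * fact (digits x j) \<and>
    r' rAmp = r rAmp + (if digits x j < s j then U w j * \<psi> ((digits x)(j := Suc (digits x j))) else 0))"
proof -
  define d where "d = stride j"
  define x' where "x' = x mod (d * (s j + 1))"
  have top: "top_stride (Suc i) = d * (s j + 1)" "top_stride i = d"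
    using i top_stride_Suc[OF i] by (simp_all add: d_def j_def top_stride_def)
  have j: "j < m" "s j \<noteq> 0" using occupied_nth[OF i] by (simp_all add: j_def)
  have d: "0 < d" by (simp add: d_def stride_pos)
  have x'_mod: "x' mod d = x mod d" unfolding x'_def by (rule mod_mod_cancel) simp
  have x'_div: "x' div d = digits x j" unfolding x'_def mod_mult2_eq digits_def d_def [symmetric] using d by simp
  \<comment> \<open>Bounding the number of subtractions by \<open>stride m\<close> rather than by
    \<open>s j\<close> is generous; the second factor N of the time bound absorbs it.\<close>
  have digit_le: "digits x j \<le> stride m"
  proof -
    have "digits x j \<le> x'" unfolding x'_div [symmetric] by (rule div_le_dividend)
    also have "x' \<le> x" by (simp add: x'_def)
    finally show ?thesis using x(2) by simp
  qed
  have eq: "r rRec - 3 = of_nat (recs + 3 * i)" by (simp add: rec)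
  have recs: "r (recs + 3 * i) = of_nat d" "r (recs + 3 * i + 1) = of_nat (s j)"
      "r (recs + 3 * i + 2) = of_nat (2 + j)" "r rThree = 3" "r rOne = 1" "r rLow = 32"
      "r rOff = of_nat off" "r rState = of_nat state"
    using st i by (simp_all add: static_def d_def j_def)
  note lay = layout(1,2,5,4)
  define r1 where "r1 = r(rRec := of_nat (recs + 3 * i), rStride := of_nat d, rB := of_nat (recs + 3 * i + 2),
      rOcc := of_nat (s j), rA := of_nat (2 + j), rDigit := 0)"
  define r2 where "r2 = r1(rRem := of_nat (x mod d + 1), rDigit := of_nat (digits x j),
      rFact := r rFact * fact (digits x j))"
  show ?thesis unfolding record_body_def
  proof (rule tri_seq[where ba = 7 and bb = "5 * stride m + 13"])
    show "tri \<omega> (Block [Sub rRec rThree rRec, Load rStride rRec, Add rRec rOne rB, Load rOcc rB,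
         Add rB rOne rB, Load rA rB, Const rDigit 0]) r q 7 (\<lambda>r' q'. q' = q \<and> r' = r1)"
      unfolding r1_def using recs lay by (intro tri_block) (auto simp: eq simp del: of_nat_add of_nat_mult)
  next
    fix r' q' assume 1: "q' = q \<and> r' = r1"
    show "tri \<omega> (digit_loop ;; Cond rOcc rDigit (Block []) gather) r' q' (5 * stride m + 13)
      (\<lambda>r' q'. q' = q \<and> (\<forall>a. a \<notin> {23..31} \<longrightarrow> r' a = r a) \<and>
        r' rRec = of_nat (recs + 3 * i) \<and> r' rRem = of_nat (x mod top_stride i + 1) \<and>
        r' rFact = r rFact * fact (digits x j) \<and>
        r' rAmp = r rAmp + (if digits x j < s j then U w j * \<psi> ((digits x)(j := Suc (digits x j))) else 0))"
    proof (rule tri_seq[where ba = "5 * stride m + 1" and bb = 12])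
      show "tri \<omega> digit_loop r' q' (5 * stride m + 1) (\<lambda>r' q'. q' = q \<and> r' = r2)"
        using 1 digit_loop[of r1 x' d "stride m" \<omega> q] digit_le d recs rem
        by (simp add: r2_def x'_mod x'_div) (simp add: r1_def top x'_def)
    next
      fix r' q' assume 2: "q' = q \<and> r' = r2"
      have r2: "\<And>a. a \<notin> {23..31} \<Longrightarrow> r2 a = r a" "r2 rRec = of_nat (recs + 3 * i)"
          "r2 rRem = of_nat (x mod top_stride i + 1)" "r2 rFact = r rFact * fact (digits x j)"
          "r2 rAmp = r rAmp" "r2 rOcc = of_nat (s j)" "r2 rDigit = of_nat (digits x j)"
          "r2 rA = of_nat (2 + j)" "r2 rStride = of_nat d"
        by (auto simp: r2_def r1_def top)
      show "tri \<omega> (Cond rOcc rDigit (Block []) gather) r' q' 12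
        (\<lambda>r' q'. q' = q \<and> (\<forall>a. a \<notin> {23..31} \<longrightarrow> r' a = r a) \<and>
          r' rRec = of_nat (recs + 3 * i) \<and> r' rRem = of_nat (x mod top_stride i + 1) \<and>
          r' rFact = r rFact * fact (digits x j) \<and>
          r' rAmp = r rAmp + (if digits x j < s j then U w j * \<psi> ((digits x)(j := Suc (digits x j))) else 0))"
      proof (rule tri_cond[where ba = 10])
        assume "Re (r' rOcc) \<le> Re (r' rDigit)"
        hence "\<not> digits x j < s j" using 2 r2 by simp
        thus "tri \<omega> (Block []) r' q' 10
          (\<lambda>r' q'. q' = q \<and> (\<forall>a. a \<notin> {23..31} \<longrightarrow> r' a = r a) \<and>
            r' rRec = of_nat (recs + 3 * i) \<and> r' rRem = of_nat (x mod top_stride i + 1) \<and>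
            r' rFact = r rFact * fact (digits x j) \<and>
            r' rAmp = r rAmp + (if digits x j < s j then U w j * \<psi> ((digits x)(j := Suc (digits x j))) else 0))"
          using 2 r2 by (intro tri_block) auto
      next
        assume "\<not> Re (r' rOcc) \<le> Re (r' rDigit)"
        hence less: "digits x j < s j" using 2 r2 by simp
        have mat: "2 + j + w * m < 2 + m * m + m" using matrix_index[OF w(2) j(1)] by simp
        have r2_mat: "r2 (loc (2 + j + w * m)) = U w j"
          using loc_bounds[OF _ mat] st w(2) j(1) by (subst r2(1)) (auto simp: static_def)
        have r2_state: "r2 (state + x + d) = \<psi> ((digits x)(j := Suc (digits x j)))"
          using digits_add[OF x(2) j(1) less] \<psi>[of "x + d"] d lay
          by (subst r2(1)) (auto simp: d_def add.assoc)
        have "tri \<omega> gather r2 q 10 (\<lambda>r' q'. q' = q \<and> (\<forall>a. a \<notin> {rA, rB, rAmp} \<longrightarrow> r' a = r2 a) \<and>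
            r' rAmp = r2 rAmp + r2 (if 2 + j + w * m < 32 then off + (2 + j + w * m) else 2 + j + w * m) *
              r2 (state + x + d))"
          by (rule gather) (use r2 recs lay x w in \<open>auto simp del: of_nat_add of_nat_mult\<close>)
        thus "tri \<omega> gather r' q' 10
          (\<lambda>r' q'. q' = q \<and> (\<forall>a. a \<notin> {23..31} \<longrightarrow> r' a = r a) \<and>
            r' rRec = of_nat (recs + 3 * i) \<and> r' rRem = of_nat (x mod top_stride i + 1) \<and>
            r' rFact = r rFact * fact (digits x j) \<and>
            r' rAmp = r rAmp + (if digits x j < s j then U w j * \<psi> ((digits x)(j := Suc (digits x j))) else 0))"
          unfolding loc_def [symmetric] r2_mat r2_state
          using 2 less r2 by (auto elim!: tri_conseq)
      qed simp
    qed simp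
  qed simp
qed

text \<open>\<open>\<psi>_outside\<close> makes all skipped modes contribute 0: the empty ones,
  which have no record, and those at their maximal digit.\<close>

lemma entry:
  assumes st: "static r" and x: "r rIdx = of_nat x" "x < stride m" and w: "r rRow = of_nat (w * m)" "w < m"
    and \<psi>: "\<And>y. x < y \<Longrightarrow> y < stride m \<Longrightarrow> r (state + y) = \<psi> (digits y)"
    and \<psi>_outside: "\<And>j. s j < digits x j + 1 \<Longrightarrow> \<psi> ((digits x)(j := Suc (digits x j))) = 0"
  shows "tri \<omega> entry r q (length occupied * (5 * stride m + 22) + 5)
    (\<lambda>r' q'. q' = q \<and> (\<forall>a. a \<notin> {23..31} \<longrightarrow> r' a = r a) \<and>
      r' rFact = (\<Prod>j<m. fact (digits x j)) \<and>
      r' rAmp = (\<Sum>j<m. U w j * \<psi> ((digits x)(j := Suc (digits x j)))))"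
proof -
  let ?\<alpha> = "length occupied"
  define contrib where "contrib j = U w j * \<psi> ((digits x)(j := Suc (digits x j)))" for j
  define Inv where "Inv k r' q' \<longleftrightarrow> q' = q \<and> (\<forall>a. a \<notin> {23..31} \<longrightarrow> r' a = r a) \<and>
      r' rRec = of_nat (recs + 3 * (?\<alpha> - k)) \<and> r' rRem = of_nat (x mod top_stride (?\<alpha> - k) + 1) \<and>
      r' rFact = (\<Prod>i\<in>{?\<alpha> - k..<?\<alpha>}. fact (digits x (occupied ! i))) \<and>
      r' rAmp = (\<Sum>i\<in>{?\<alpha> - k..<?\<alpha>}. contrib (occupied ! i))" for k r' q'
  have lay: "recs \<ge> 94" "tally \<ge> recs" using layout by simp_all
  have fixed: "r rOne = 1" "r rZero = 0" "r rRecs = of_nat recs" "r rEnd = of_nat (recs + 3 * ?\<alpha>)"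
    using st by (simp_all add: static_def)
  have static_temp: "static r'" if "\<And>a. a \<notin> {23..31} \<Longrightarrow> r' a = r a" for r'
    by (rule static_cong[OF st]) (use that in auto)
  show ?thesis unfolding entry_def
  proof (rule tri_seq[where ba = 4 and bb = "?\<alpha> * (5 * stride m + 22) + 1"])
    show "tri \<omega> (Block [Add rIdx rOne rRem, Const rFact 1, Const rAmp 0, Add rEnd rZero rRec]) r q 4 (Inv 0)"
      using x fixed unfolding Inv_def by (intro tri_block) (auto simp: top_stride_def)
  next
    fix r1 q1 assume "Inv 0 r1 q1"
    thus "tri \<omega> (Until rRec rRecs record_body) r1 q1 (?\<alpha> * (5 * stride m + 22) + 1)
      (\<lambda>r' q'. q' = q \<and> (\<forall>a. a \<notin> {23..31} \<longrightarrow> r' a = r a) \<and>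
        r' rFact = (\<Prod>j<m. fact (digits x j)) \<and>
        r' rAmp = (\<Sum>j<m. U w j * \<psi> ((digits x)(j := Suc (digits x j)))))"
    proof (rule tri_until[where K = ?\<alpha> and b = "5 * stride m + 20"])
      fix k r' q' assume k: "k < ?\<alpha>" and inv: "Inv k r' q'"
      define i where "i = ?\<alpha> - Suc k"
      have i: "i < ?\<alpha>" "?\<alpha> - k = Suc i" using k by (auto simp: i_def)
      have set: "{i..<?\<alpha>} = insert i {Suc i..<?\<alpha>}" using i by auto
      have frame: "\<And>a. a \<notin> {23..31} \<Longrightarrow> r' a = r a" and q': "q' = q"
          and regs: "r' rRec = of_nat (recs + 3 * Suc i)" "r' rRem = of_nat (x mod top_stride (Suc i) + 1)"
            "r' rFact = (\<Prod>i\<in>{Suc i..<?\<alpha>}. fact (digits x (occupied ! i)))"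
            "r' rAmp = (\<Sum>i\<in>{Suc i..<?\<alpha>}. contrib (occupied ! i))"
        using inv unfolding Inv_def i by blast+
      have \<psi>': "r' (state + y) = \<psi> (digits y)" if "x < y" "y < stride m" for y
        using \<psi>[OF that] layout by (subst frame) auto
      have step: "tri \<omega> record_body r' q' (5 * stride m + 20) (Inv (Suc k))"
        by (rule tri_conseq[OF record_body[OF static_temp[OF frame] i(1) regs(1,2) _ x(2) _ w(2) \<psi>']])
          (use x w frame q' regs \<psi>_outside in
            \<open>auto simp: Inv_def set contrib_def mult.commute add.commute simp flip: i_def simp del: of_nat_add of_nat_mult\<close>)
      have "recs < recs + 3 * Suc i" by simp
      hence "real recs < real (recs + 3 * Suc i)" by (simp only: of_nat_less_iff)
      thus "\<not> Re (r' rRec) \<le> Re (r' rRecs) \<and> tri \<omega> record_body r' q' (5 * stride m + 20) (Inv (Suc k))"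
        using step regs(1) frame[of rRecs] fixed(3) by (simp del: of_nat_add of_nat_mult)
    next
      fix r' q' assume inv: "Inv ?\<alpha> r' q'"
      have "(\<Sum>i<?\<alpha>. contrib (occupied ! i)) = (\<Sum>j<m. contrib j)"
        by (rule sum_occupied) (use \<psi>_outside in \<open>auto simp: contrib_def\<close>)
      moreover have "(\<Prod>i<?\<alpha>. fact (digits x (occupied ! i))) = (\<Prod>j<m. fact (digits x j) :: complex)"
        using digits_le[of x] by (intro prod_occupied) (metis fact_0 le_zero_eq)
      ultimately show "Re (r' rRec) \<le> Re (r' rRecs) \<and> q' = q \<and> (\<forall>a. a \<notin> {23..31} \<longrightarrow> r' a = r a) \<and>
        r' rFact = (\<Prod>j<m. fact (digits x j)) \<and>
        r' rAmp = (\<Sum>j<m. U w j * \<psi> ((digits x)(j := Suc (digits x j))))"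
        using inv fixed by (auto simp: Inv_def contrib_def atLeast0LessThan)
    qed simp_all
  qed simp
qed

end

section \<open>Sampling one photon\<close>

text \<open>Evaluates a candidate detection without storing its amplitudes;
  \<open>commit_loop\<close> recomputes them for the chosen mode alone, so a single copy of the
  state suffices.\<close>

definition row_loop :: com where
  "row_loop = Until rDim rIdx (norm_entry ;; Block [Add rIdx rOne rIdx])"

definition commit_loop :: com where
  "commit_loop =
     Until rDim rIdx (norm_entry ;; Block [Add rState rIdx rB, Store rB rAmp, Add rIdx rOne rIdx])"

text \<open>\<open>rCum\<close> is not reset between modes and thus holds the partial sums
  \<open>cum\<close>.\<close>

definition scan_body :: com where
  "scan_body =
     Block [Mul rI rM rRow, Const rIdx 0] ;;
     row_loop ;;
     Cond rThr rCum (Block []) (Block [Add rPick rOne rPick]) ;;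
     Block [Add rI rOne rI]"

text \<open>By \<open>weight_sum\<close> the factors \<open>rN - rK\<close> and
  \<open>rWeight\<close> scale the random number to the total weight of the candidates.\<close>

definition sample_photon :: com where
  "sample_photon =
     Block [Rand rThr, Sub rN rK rB, Mul rThr rB rThr, Mul rThr rWeight rThr,
       Const rI 0, Const rPick 0, Const rCum 0] ;;
     Until rLast rI scan_body ;;
     Block [Mul rPick rM rRow, Const rIdx 0, Const rCum 0] ;;
     commit_loop ;;
     Block [Add rCum rZero rWeight, Add rTally rPick rB, Load rDigit rB, Add rDigit rOne rDigit,
       Store rB rDigit, Mul rTFact rDigit rTFact, Add rK rOne rK]"

context boson_sampling begin

definition amp_state :: "nat list \<Rightarrow> (nat \<Rightarrow> complex) \<Rightarrow> bool" where
  "amp_state \<rho> r \<longleftrightarrow> (\<forall>y<stride m. r (state + y) = amp \<rho> s (digits y))"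

definition term_weight :: "nat list \<Rightarrow> nat \<Rightarrow> real" where
  "term_weight \<rho> x = (cmod (amp \<rho> s (digits x)))\<^sup>2 / (\<Prod>j<m. fact (digits x j))"

lemma sum_term_weight: "(\<Sum>x<stride m. term_weight \<rho> x) = weight \<rho>"
  unfolding term_weight_def weight_def by (rule sum_digits)

definition entry_time :: nat where
  "entry_time = length occupied * (5 * stride m + 22) + 9"

lemma amp_outside: "s j < c j \<Longrightarrow> amp \<rho> s c = 0"
  using amp_nonzero[of \<rho> s c] by (meson not_le)

text \<open>With the old amplitudes for \<psi>, the sum computed by \<open>entry\<close> is the
  right-hand side of \<open>amp_snoc\<close>.\<close>

lemma norm_entry:
  assumes st: "static r" and x: "r rIdx = of_nat x" "x < stride m" and w: "r rRow = of_nat (w * m)" "w < m"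
    and \<rho>: "\<And>y. x < y \<Longrightarrow> y < stride m \<Longrightarrow> r (state + y) = amp \<rho> s (digits y)"
  shows "tri \<omega> norm_entry r q entry_time
    (\<lambda>r' q'. q' = q \<and> (\<forall>a. a \<notin> insert rCum {23..31} \<longrightarrow> r' a = r a) \<and>
      r' rAmp = amp (\<rho> @ [w]) s (digits x) \<and>
      r' rCum = r rCum + complex_of_real (term_weight (\<rho> @ [w]) x))"
  unfolding norm_entry_def
proof (rule tri_seq[where bb = 4])
  show "tri \<omega> entry r q (length occupied * (5 * stride m + 22) + 5)
    (\<lambda>r' q'. q' = q \<and> (\<forall>a. a \<notin> {23..31} \<longrightarrow> r' a = r a) \<and>
      r' rFact = (\<Prod>j<m. fact (digits x j)) \<and>
      r' rAmp = (\<Sum>j<m. U w j * amp \<rho> s ((digits x)(j := Suc (digits x j)))))"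
    by (rule entry[OF st x w \<rho>]) (auto intro: amp_outside)
next
  fix r1 q1
  assume 1: "q1 = q \<and> (\<forall>a. a \<notin> {23..31} \<longrightarrow> r1 a = r a) \<and>
      r1 rFact = (\<Prod>j<m. fact (digits x j)) \<and>
      r1 rAmp = (\<Sum>j<m. U w j * amp \<rho> s ((digits x)(j := Suc (digits x j))))"
  have "r1 rAmp = amp (\<rho> @ [w]) s (digits x)" using 1 by (simp add: amp_snoc)
  moreover from this have "r1 rAmp * cnj (r1 rAmp) / r1 rFact = complex_of_real (term_weight (\<rho> @ [w]) x)"
    using 1 by (simp only: term_weight_def of_real_divide complex_norm_square of_real_prod of_real_fact)
  ultimately show "tri \<omega> (Block [Conj rAmp rB, Mul rAmp rB rB, Div rB rFact rB, Add rCum rB rCum]) r1 q1 4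
    (\<lambda>r' q'. q' = q \<and> (\<forall>a. a \<notin> insert rCum {23..31} \<longrightarrow> r' a = r a) \<and>
      r' rAmp = amp (\<rho> @ [w]) s (digits x) \<and>
      r' rCum = r rCum + complex_of_real (term_weight (\<rho> @ [w]) x))"
    using 1 by (intro tri_block) auto
qed (simp add: entry_time_def)

lemma row_loop:
  assumes st: "static r" and x: "r rIdx = 0" and w: "r rRow = of_nat (w * m)" "w < m"
    and \<rho>: "amp_state \<rho> r"
  shows "tri \<omega> row_loop r q (stride m * (entry_time + 3) + 1)
    (\<lambda>r' q'. q' = q \<and> (\<forall>a. a \<notin> {rCum, rIdx} \<union> {23..31} \<longrightarrow> r' a = r a) \<and>
      r' rCum = r rCum + complex_of_real (weight (\<rho> @ [w])))"
  unfolding row_loop_def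
proof (rule tri_until[where l = 0 and K = "stride m" and b = "entry_time + 1" and Inv = "\<lambda>k r' q'. q' = q \<and>
    (\<forall>a. a \<notin> {rCum, rIdx} \<union> {23..31} \<longrightarrow> r' a = r a) \<and> r' rIdx = of_nat k \<and>
    r' rCum = r rCum + complex_of_real (\<Sum>x<k. term_weight (\<rho> @ [w]) x)"])
  fix k r' q'
  assume k: "k < stride m" and inv: "q' = q \<and>
    (\<forall>a. a \<notin> {rCum, rIdx} \<union> {23..31} \<longrightarrow> r' a = r a) \<and> r' rIdx = of_nat k \<and>
    r' rCum = r rCum + complex_of_real (\<Sum>x<k. term_weight (\<rho> @ [w]) x)"
  have frame: "\<And>a. a \<notin> {rCum, rIdx} \<union> {23..31} \<Longrightarrow> r' a = r a" using inv by blast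
  have st': "static r'" by (rule static_cong[OF st]) (use frame in auto)
  have \<rho>': "r' (state + y) = amp \<rho> s (digits y)" if "y < stride m" for y
    using \<rho> that layout by (subst frame) (auto simp: amp_state_def)
  show "\<not> Re (r' rDim) \<le> Re (r' rIdx) \<and>
    tri \<omega> (norm_entry ;; Block [Add rIdx rOne rIdx]) r' q' (entry_time + 1) (\<lambda>r' q'. q' = q \<and>
    (\<forall>a. a \<notin> {rCum, rIdx} \<union> {23..31} \<longrightarrow> r' a = r a) \<and> r' rIdx = of_nat (Suc k) \<and>
    r' rCum = r rCum + complex_of_real (\<Sum>x<Suc k. term_weight (\<rho> @ [w]) x))"
  proof
    show "\<not> Re (r' rDim) \<le> Re (r' rIdx)" using st' inv k by (simp add: static_def)
    show "tri \<omega> (norm_entry ;; Block [Add rIdx rOne rIdx]) r' q' (entry_time + 1) (\<lambda>r' q'. q' = q \<and>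
      (\<forall>a. a \<notin> {rCum, rIdx} \<union> {23..31} \<longrightarrow> r' a = r a) \<and> r' rIdx = of_nat (Suc k) \<and>
      r' rCum = r rCum + complex_of_real (\<Sum>x<Suc k. term_weight (\<rho> @ [w]) x))"
    proof (rule tri_seq[OF norm_entry[where x = k and \<rho> = \<rho> and w = w]])
      fix r2 q2 assume 2: "q2 = q' \<and> (\<forall>a. a \<notin> insert rCum {23..31} \<longrightarrow> r2 a = r' a) \<and>
        r2 rAmp = amp (\<rho> @ [w]) s (digits k) \<and>
        r2 rCum = r' rCum + complex_of_real (term_weight (\<rho> @ [w]) k)"
      have "r2 rOne = 1" "r2 rIdx = of_nat k" using 2 inv st' by (auto simp: static_def)
      thus "tri \<omega> (Block [Add rIdx rOne rIdx]) r2 q2 1 (\<lambda>r' q'. q' = q \<and>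
        (\<forall>a. a \<notin> {rCum, rIdx} \<union> {23..31} \<longrightarrow> r' a = r a) \<and> r' rIdx = of_nat (Suc k) \<and>
        r' rCum = r rCum + complex_of_real (\<Sum>x<Suc k. term_weight (\<rho> @ [w]) x))"
        using 2 inv by (intro tri_block) auto
    qed (use st' inv k w \<rho>' frame in auto)
  qed
next
  fix r' q'
  assume inv: "q' = q \<and>
    (\<forall>a. a \<notin> {rCum, rIdx} \<union> {23..31} \<longrightarrow> r' a = r a) \<and> r' rIdx = of_nat (stride m) \<and>
    r' rCum = r rCum + complex_of_real (\<Sum>x<stride m. term_weight (\<rho> @ [w]) x)"
  moreover have "r' rDim = of_nat (stride m)" using inv st by (auto simp: static_def)
  ultimately show "Re (r' rDim) \<le> Re (r' rIdx) \<and> q' = q \<and>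
    (\<forall>a. a \<notin> {rCum, rIdx} \<union> {23..31} \<longrightarrow> r' a = r a) \<and>
    r' rCum = r rCum + complex_of_real (weight (\<rho> @ [w]))"
    by (simp add: sum_term_weight del: of_real_sum)
qed (use x in \<open>auto simp: algebra_simps\<close>)

text \<open>The update is in place: the new entry at index x only reads old entries at larger indices.\<close>
lemma commit_loop:
  assumes st: "static r" and x: "r rIdx = 0" and w: "r rRow = of_nat (w * m)" "w < m"
    and \<rho>: "amp_state \<rho> r"
  shows "tri \<omega> commit_loop r q (stride m * (entry_time + 5) + 1)
    (\<lambda>r' q'. q' = q \<and> (\<forall>a. a \<notin> {rCum, rIdx} \<union> {23..31} \<union> {state..} \<longrightarrow> r' a = r a) \<and>
      r' rCum = r rCum + complex_of_real (weight (\<rho> @ [w])) \<and> amp_state (\<rho> @ [w]) r')"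
  unfolding commit_loop_def
proof (rule tri_until[where l = 0 and K = "stride m" and b = "entry_time + 3" and Inv = "\<lambda>k r' q'. q' = q \<and>
    (\<forall>a. a \<notin> {rCum, rIdx} \<union> {23..31} \<union> {state..<state + k} \<longrightarrow> r' a = r a) \<and> r' rIdx = of_nat k \<and>
    r' rCum = r rCum + complex_of_real (\<Sum>x<k. term_weight (\<rho> @ [w]) x) \<and>
    (\<forall>y<k. r' (state + y) = amp (\<rho> @ [w]) s (digits y))"])
  fix k r' q'
  assume k: "k < stride m" and inv: "q' = q \<and>
    (\<forall>a. a \<notin> {rCum, rIdx} \<union> {23..31} \<union> {state..<state + k} \<longrightarrow> r' a = r a) \<and> r' rIdx = of_nat k \<and>
    r' rCum = r rCum + complex_of_real (\<Sum>x<k. term_weight (\<rho> @ [w]) x) \<and>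
    (\<forall>y<k. r' (state + y) = amp (\<rho> @ [w]) s (digits y))"
  have frame: "\<And>a. a \<notin> {rCum, rIdx} \<union> {23..31} \<union> {state..<state + k} \<Longrightarrow> r' a = r a" using inv by blast
  have st': "static r'" by (rule static_cong[OF st]) (use frame layout in auto)
  have \<rho>': "r' (state + y) = amp \<rho> s (digits y)" if "k < y" "y < stride m" for y
    using \<rho> that layout by (subst frame) (auto simp: amp_state_def)
  show "\<not> Re (r' rDim) \<le> Re (r' rIdx) \<and>
    tri \<omega> (norm_entry ;; Block [Add rState rIdx rB, Store rB rAmp, Add rIdx rOne rIdx]) r' q' (entry_time + 3)
     (\<lambda>r' q'. q' = q \<and>
    (\<forall>a. a \<notin> {rCum, rIdx} \<union> {23..31} \<union> {state..<state + Suc k} \<longrightarrow> r' a = r a) \<and> r' rIdx = of_nat (Suc k) \<and>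
    r' rCum = r rCum + complex_of_real (\<Sum>x<Suc k. term_weight (\<rho> @ [w]) x) \<and>
    (\<forall>y<Suc k. r' (state + y) = amp (\<rho> @ [w]) s (digits y)))"
  proof
    show "\<not> Re (r' rDim) \<le> Re (r' rIdx)" using st' inv k by (simp add: static_def)
    show "tri \<omega> (norm_entry ;; Block [Add rState rIdx rB, Store rB rAmp, Add rIdx rOne rIdx]) r' q' (entry_time + 3)
       (\<lambda>r' q'. q' = q \<and>
      (\<forall>a. a \<notin> {rCum, rIdx} \<union> {23..31} \<union> {state..<state + Suc k} \<longrightarrow> r' a = r a) \<and> r' rIdx = of_nat (Suc k) \<and>
      r' rCum = r rCum + complex_of_real (\<Sum>x<Suc k. term_weight (\<rho> @ [w]) x) \<and>
      (\<forall>y<Suc k. r' (state + y) = amp (\<rho> @ [w]) s (digits y)))"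
    proof (rule tri_seq[OF norm_entry[where x = k and \<rho> = \<rho> and w = w]])
      fix r2 q2 assume 2: "q2 = q' \<and> (\<forall>a. a \<notin> insert rCum {23..31} \<longrightarrow> r2 a = r' a) \<and>
        r2 rAmp = amp (\<rho> @ [w]) s (digits k) \<and>
        r2 rCum = r' rCum + complex_of_real (term_weight (\<rho> @ [w]) k)"
      have "r2 rOne = 1" "r2 rIdx = of_nat k" "r2 rState = of_nat state"
        using 2 inv st' by (auto simp: static_def)
      moreover have "state \<ge> 94" using layout by simp
      moreover have "\<forall>y<k. r2 (state + y) = amp (\<rho> @ [w]) s (digits y)"
        using 2 inv \<open>state \<ge> 94\<close> by auto
      ultimately show "tri \<omega> (Block [Add rState rIdx rB, Store rB rAmp, Add rIdx rOne rIdx]) r2 q2 3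
       (\<lambda>r' q'. q' = q \<and>
        (\<forall>a. a \<notin> {rCum, rIdx} \<union> {23..31} \<union> {state..<state + Suc k} \<longrightarrow> r' a = r a) \<and> r' rIdx = of_nat (Suc k) \<and>
        r' rCum = r rCum + complex_of_real (\<Sum>x<Suc k. term_weight (\<rho> @ [w]) x) \<and>
        (\<forall>y<Suc k. r' (state + y) = amp (\<rho> @ [w]) s (digits y)))"
        using 2 inv by (intro tri_block) (auto simp: less_Suc_eq)
    qed (use st' inv k w \<rho>' frame layout in auto)
  qed
next
  fix r' q'
  assume inv: "q' = q \<and>
    (\<forall>a. a \<notin> {rCum, rIdx} \<union> {23..31} \<union> {state..<state + stride m} \<longrightarrow> r' a = r a) \<and> r' rIdx = of_nat (stride m) \<and>
    r' rCum = r rCum + complex_of_real (\<Sum>x<stride m. term_weight (\<rho> @ [w]) x) \<and>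
    (\<forall>y<stride m. r' (state + y) = amp (\<rho> @ [w]) s (digits y))"
  moreover have "r' rDim = of_nat (stride m)" using inv st layout by (auto simp: static_def)
  ultimately show "Re (r' rDim) \<le> Re (r' rIdx) \<and> q' = q \<and>
    (\<forall>a. a \<notin> {rCum, rIdx} \<union> {23..31} \<union> {state..} \<longrightarrow> r' a = r a) \<and>
    r' rCum = r rCum + complex_of_real (weight (\<rho> @ [w])) \<and> amp_state (\<rho> @ [w]) r'"
    by (auto simp add: sum_term_weight amp_state_def simp del: of_real_sum)
qed (use x in \<open>auto simp: algebra_simps\<close>)


definition scan_time :: nat where
  "scan_time = stride m * (entry_time + 3) + 7"

lemma card_less_Suc_Collect: "card {i. i < Suc k \<and> P i} = card {i. i < k \<and> P i} + (if P k then 1 else 0)"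
proof -
  have "{i. i < Suc k \<and> P i} = (if P k then insert k {i. i < k \<and> P i} else {i. i < k \<and> P i})"
    by (auto simp: less_Suc_eq)
  thus ?thesis by simp
qed

text \<open>Only m - 1 modes are evaluated: the last one takes every threshold above all their
  partial sums, in agreement with the cap in \<open>pick\<close>.\<close>

lemma scan_loop:
  assumes st: "static r" and \<rho>: "amp_state \<rho> r"
    and r: "r rI = 0" "r rPick = 0" "r rCum = 0" "r rThr = complex_of_real t"
  shows "tri \<omega> (Until rLast rI scan_body) r q ((m - 1) * (scan_time + 2) + 1)
    (\<lambda>r' q'. q' = q \<and> (\<forall>a. a \<notin> {rI, rPick, rCum} \<union> {21..31} \<longrightarrow> r' a = r a) \<and>
      r' rPick = of_nat (card {i. i < m - 1 \<and> cum \<rho> i < t}))"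
proof (rule tri_until[where l = 0 and K = "m - 1" and b = scan_time and Inv = "\<lambda>k r' q'. q' = q \<and>
    (\<forall>a. a \<notin> {rI, rPick, rCum} \<union> {21..31} \<longrightarrow> r' a = r a) \<and> r' rI = of_nat k \<and>
    r' rPick = of_nat (card {i. i < k \<and> cum \<rho> i < t}) \<and>
    r' rCum = complex_of_real (\<Sum>i<k. weight (\<rho> @ [i]))"])
  fix k r' q'
  assume k: "k < m - 1" and inv: "q' = q \<and>
    (\<forall>a. a \<notin> {rI, rPick, rCum} \<union> {21..31} \<longrightarrow> r' a = r a) \<and> r' rI = of_nat k \<and>
    r' rPick = of_nat (card {i. i < k \<and> cum \<rho> i < t}) \<and>
    r' rCum = complex_of_real (\<Sum>i<k. weight (\<rho> @ [i]))"
  have frame: "\<And>a. a \<notin> {rI, rPick, rCum} \<union> {21..31} \<Longrightarrow> r' a = r a" using inv by blast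
  have st': "static r'" by (rule static_cong[OF st]) (use frame in auto)
  have \<rho>': "amp_state \<rho> r'"
    using \<rho> layout by (auto simp: amp_state_def frame)
  have regs: "r' rLast = of_nat (m - 1)" "r' rM = of_nat m" "r' rOne = 1" "r' rThr = complex_of_real t"
    using st' r frame by (auto simp: static_def)
  define Q where "Q = (\<lambda>r' q'. q' = q \<and>
    (\<forall>a. a \<notin> {rI, rPick, rCum} \<union> {21..31} \<longrightarrow> r' a = r a) \<and> r' rI = of_nat (Suc k) \<and>
    r' rPick = complex_of_nat (card {i. i < Suc k \<and> cum \<rho> i < t}) \<and>
    r' rCum = complex_of_real (\<Sum>i<Suc k. weight (\<rho> @ [i])))"
  define r2 where "r2 = r'(rRow := of_nat (k * m), rIdx := 0)"
  have "tri \<omega> scan_body r' q' scan_time Q"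
    unfolding scan_body_def
  proof (rule tri_seq[where ba = 2 and bb = "stride m * (entry_time + 3) + 5"])
    show "tri \<omega> (Block [Mul rI rM rRow, Const rIdx 0]) r' q' 2 (\<lambda>r1 q1. q1 = q' \<and> r1 = r2)"
      using inv regs by (intro tri_block) (auto simp: r2_def)
  next
    fix r1 q1 assume "q1 = q' \<and> r1 = r2"
    hence 1: "q1 = q'" "r1 = r2" by simp_all
    have st2: "static r2" by (rule static_cong[OF st']) (auto simp: r2_def)
    have "amp_state \<rho> r2" using \<rho>' layout by (auto simp: amp_state_def r2_def)
    hence row: "tri \<omega> row_loop r2 q' (stride m * (entry_time + 3) + 1)
      (\<lambda>r3 q3. q3 = q' \<and> (\<forall>a. a \<notin> {rCum, rIdx} \<union> {23..31} \<longrightarrow> r3 a = r2 a) \<and>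
        r3 rCum = r2 rCum + complex_of_real (weight (\<rho> @ [k])))"
      using k by (intro row_loop st2) (auto simp: r2_def)
    show "tri \<omega> (row_loop ;; Cond rThr rCum (Block []) (Block [Add rPick rOne rPick]) ;;
        Block [Add rI rOne rI]) r1 q1 (stride m * (entry_time + 3) + 5) Q"
      unfolding 1
    proof (rule tri_seq[OF row, where bb = 4])
      fix r3 q3
      assume "q3 = q' \<and> (\<forall>a. a \<notin> {rCum, rIdx} \<union> {23..31} \<longrightarrow> r3 a = r2 a) \<and>
        r3 rCum = r2 rCum + complex_of_real (weight (\<rho> @ [k]))"
      hence q3: "q3 = q'" and frame3: "\<And>a. a \<notin> {rI, rPick, rCum} \<union> {21..31} \<Longrightarrow> r3 a = r a"
          and regs3: "r3 rI = of_nat k" "r3 rOne = 1" "r3 rThr = complex_of_real t"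
            "r3 rPick = of_nat (card {i. i < k \<and> cum \<rho> i < t})" "r3 rCum = complex_of_real (cum \<rho> k)"
        using inv regs by (auto simp: r2_def cum_def simp flip: lessThan_Suc_atMost)
      show "tri \<omega> (Cond rThr rCum (Block []) (Block [Add rPick rOne rPick]) ;; Block [Add rI rOne rI]) r3 q3 4 Q"
      proof (rule tri_seq[where ba = 3 and bb = 1])
        show "tri \<omega> (Cond rThr rCum (Block []) (Block [Add rPick rOne rPick])) r3 q3 3
          (\<lambda>r4 q4. q4 = q3 \<and> r4 = r3(rPick := of_nat (card {i. i < Suc k \<and> cum \<rho> i < t})))"
          using regs3 by (intro tri_cond[where ba = 1] tri_block) (auto simp: card_less_Suc_Collect fun_eq_iff)
      next
        fix r4 q4
        assume "q4 = q3 \<and> r4 = r3(rPick := of_nat (card {i. i < Suc k \<and> cum \<rho> i < t}))"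
        thus "tri \<omega> (Block [Add rI rOne rI]) r4 q4 1 Q"
          using q3 frame3 regs3 inv unfolding Q_def
          by (intro tri_block) (auto simp: cum_def lessThan_Suc_atMost)
      qed simp
    qed simp
  qed (simp add: scan_time_def)
  moreover have "\<not> Re (r' rLast) \<le> Re (r' rI)" using regs inv k by simp
  ultimately show "\<not> Re (r' rLast) \<le> Re (r' rI) \<and> tri \<omega> scan_body r' q' scan_time (\<lambda>r' q'. q' = q \<and>
    (\<forall>a. a \<notin> {rI, rPick, rCum} \<union> {21..31} \<longrightarrow> r' a = r a) \<and> r' rI = of_nat (Suc k) \<and>
    r' rPick = complex_of_nat (card {i. i < Suc k \<and> cum \<rho> i < t}) \<and>
    r' rCum = complex_of_real (\<Sum>i<Suc k. weight (\<rho> @ [i])))"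
    by (simp add: Q_def)
next
  fix r' q'
  assume inv: "q' = q \<and>
    (\<forall>a. a \<notin> {rI, rPick, rCum} \<union> {21..31} \<longrightarrow> r' a = r a) \<and> r' rI = of_nat (m - 1) \<and>
    r' rPick = complex_of_nat (card {i. i < m - 1 \<and> cum \<rho> i < t}) \<and>
    r' rCum = complex_of_real (\<Sum>i<m - 1. weight (\<rho> @ [i]))"
  moreover have "r' rLast = of_nat (m - 1)" using inv st by (auto simp: static_def)
  ultimately show "Re (r' rLast) \<le> Re (r' rI) \<and> q' = q \<and>
    (\<forall>a. a \<notin> {rI, rPick, rCum} \<union> {21..31} \<longrightarrow> r' a = r a) \<and>
    r' rPick = complex_of_nat (card {i. i < m - 1 \<and> cum \<rho> i < t})"
    by simp
qed (use r in auto)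

text \<open>The clause \<open>q = k\<close> says that each photon has consumed one random number, so
  the draw with index k decides photon k just as in \<open>picks\<close>.\<close>

definition main_inv :: "(nat \<Rightarrow> real) \<Rightarrow> nat \<Rightarrow> (nat \<Rightarrow> complex) \<Rightarrow> nat \<Rightarrow> bool" where
  "main_inv \<omega> k r q \<longleftrightarrow> q = k \<and> static r \<and> r rK = of_nat k \<and>
     r rWeight = complex_of_real (weight (picks \<omega> k)) \<and> amp_state (picks \<omega> k) r \<and>
     r rSFact = (\<Prod>j<m. fact (s j)) \<and> r rTFact = (\<Prod>j<m. fact (count_list (picks \<omega> k) j)) \<and>
     (\<forall>i<m. r (tally + i) = of_nat (count_list (picks \<omega> k) i))"

definition photon_time :: nat where
  "photon_time = 10 + ((m - 1) * (scan_time + 2) + 1) + (stride m * (entry_time + 5) + 1) + 7"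

lemma sample_photon:
  assumes inv: "main_inv \<omega> k r q" and k: "k < n"
  shows "tri \<omega> sample_photon r q photon_time (main_inv \<omega> (Suc k))"
proof -
  define \<rho> where "\<rho> = picks \<omega> k"
  define t where "t = \<omega> k * (real (n - k) * weight \<rho>)"
  define p where "p = pick \<rho> (\<omega> k)"
  have p: "p < m" "p = card {i. i < m - 1 \<and> cum \<rho> i < t}"
    by (simp_all add: p_def pick_less) (simp add: pick_def \<rho>_def t_def)
  have next_\<rho>: "picks \<omega> (Suc k) = \<rho> @ [p]" by (simp add: \<rho>_def p_def)
  have inv': "q = k" "static r" "r rK = of_nat k" "r rWeight = complex_of_real (weight \<rho>)" "amp_state \<rho> r"
      "r rSFact = (\<Prod>j<m. fact (s j))" "r rTFact = (\<Prod>j<m. fact (count_list \<rho> j))"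
      "\<And>i. i < m \<Longrightarrow> r (tally + i) = of_nat (count_list \<rho> i)"
    using inv by (simp_all add: main_inv_def \<rho>_def)
  have regs: "r rN = of_nat n" "r rM = of_nat m" "r rTally = of_nat tally" "r rZero = 0" "r rOne = 1"
    using inv'(2) by (simp_all add: static_def)
  have tally: "tally \<ge> 94" "state = tally + m + 1" using layout by simp_all
  define r1 where "r1 = r(rB := of_nat (n - k), rThr := complex_of_real t, rI := 0, rPick := 0, rCum := 0)"
  have st1: "static r1" by (rule static_cong[OF inv'(2)]) (auto simp: r1_def)
  have amp1: "amp_state \<rho> r1" using inv'(5) tally by (auto simp: amp_state_def r1_def)
  show ?thesis unfolding sample_photon_def
  proof (rule tri_seq[where ba = 7 and bb = "3 + ((m - 1) * (scan_time + 2) + 1) + (stride m * (entry_time + 5) + 1) + 7"])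
    have "complex_of_nat n - of_nat k = of_nat (n - k)" using k by (simp add: of_nat_diff)
    thus "tri \<omega> (Block [Rand rThr, Sub rN rK rB, Mul rThr rB rThr, Mul rThr rWeight rThr,
       Const rI 0, Const rPick 0, Const rCum 0]) r q 7 (\<lambda>r' q'. q' = Suc k \<and> r' = r1)"
      using regs inv' by (intro tri_block) (auto simp: r1_def t_def fun_eq_iff)
  next
    fix r' q' assume "q' = Suc k \<and> r' = r1"
    hence 1: "q' = Suc k" "r' = r1" by simp_all
    have scan: "tri \<omega> (Until rLast rI scan_body) r1 (Suc k) ((m - 1) * (scan_time + 2) + 1)
      (\<lambda>r' q'. q' = Suc k \<and> (\<forall>a. a \<notin> {rI, rPick, rCum} \<union> {21..31} \<longrightarrow> r' a = r1 a) \<and> r' rPick = of_nat p)"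
      unfolding p(2) by (rule scan_loop[OF st1 amp1]) (simp_all add: r1_def)
    show "tri \<omega> (Until rLast rI scan_body ;;
        Block [Mul rPick rM rRow, Const rIdx 0, Const rCum 0] ;;
        commit_loop ;;
        Block [Add rCum rZero rWeight, Add rTally rPick rB, Load rDigit rB, Add rDigit rOne rDigit,
          Store rB rDigit, Mul rTFact rDigit rTFact, Add rK rOne rK]) r' q'
        (3 + ((m - 1) * (scan_time + 2) + 1) + (stride m * (entry_time + 5) + 1) + 7) (main_inv \<omega> (Suc k))"
      unfolding 1
    proof (rule tri_seq[OF scan, where bb = "3 + (stride m * (entry_time + 5) + 1) + 7"])
      fix r2 q2
      assume 2: "q2 = Suc k \<and> (\<forall>a. a \<notin> {rI, rPick, rCum} \<union> {21..31} \<longrightarrow> r2 a = r1 a) \<and> r2 rPick = of_nat p"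
      define r3 where "r3 = r2(rRow := of_nat (p * m), rIdx := 0, rCum := 0)"
      have frame3: "r3 a = r a" if "a \<notin> {rI..31}" for a
        using 2 that by (auto simp: r3_def r1_def)
      have st3: "static r3" by (rule static_cong[OF inv'(2)]) (use frame3 in auto)
      have amp3: "amp_state \<rho> r3" using inv'(5) tally by (auto simp: amp_state_def frame3)
      have r3: "r3 rPick = of_nat p" "r3 rCum = 0" "r3 rIdx = 0" "r3 rRow = of_nat (p * m)"
        using 2 by (simp_all add: r3_def)
      show "tri \<omega> (Block [Mul rPick rM rRow, Const rIdx 0, Const rCum 0] ;;
        commit_loop ;;
        Block [Add rCum rZero rWeight, Add rTally rPick rB, Load rDigit rB, Add rDigit rOne rDigit,
          Store rB rDigit, Mul rTFact rDigit rTFact, Add rK rOne rK]) r2 q2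
        (3 + (stride m * (entry_time + 5) + 1) + 7) (main_inv \<omega> (Suc k))"
      proof (rule tri_seq[where ba = 3 and bb = "(stride m * (entry_time + 5) + 1) + 7"])
        show "tri \<omega> (Block [Mul rPick rM rRow, Const rIdx 0, Const rCum 0]) r2 q2 3
            (\<lambda>r' q'. q' = Suc k \<and> r' = r3)"
          using 2 regs by (intro tri_block) (auto simp: r3_def r1_def)
      next
        fix r' q' assume "q' = Suc k \<and> r' = r3"
        hence 3: "q' = Suc k" "r' = r3" by simp_all
        show "tri \<omega> (commit_loop ;;
          Block [Add rCum rZero rWeight, Add rTally rPick rB, Load rDigit rB, Add rDigit rOne rDigit,
            Store rB rDigit, Mul rTFact rDigit rTFact, Add rK rOne rK]) r' q'
          ((stride m * (entry_time + 5) + 1) + 7) (main_inv \<omega> (Suc k))"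
          unfolding 3
        proof (rule tri_seq[OF commit_loop[OF st3 r3(3,4) p(1) amp3], where bb = 7])
          fix r4 q4
          assume 4: "q4 = Suc k \<and> (\<forall>a. a \<notin> {rCum, rIdx} \<union> {23..31} \<union> {state..} \<longrightarrow> r4 a = r3 a) \<and>
            r4 rCum = r3 rCum + complex_of_real (weight (\<rho> @ [p])) \<and> amp_state (\<rho> @ [p]) r4"
          have frame4: "r4 a = r a" if "a \<notin> {rI..31}" "a < state" for a
            using 4 frame3 that by auto
          have regs4: "r4 rZero = 0" "r4 rOne = 1" "r4 rTally = of_nat tally" "r4 rK = of_nat k"
              "r4 rTFact = (\<Prod>j<m. fact (count_list \<rho> j))" "r4 rSFact = (\<Prod>j<m. fact (s j))"
            using regs inv' tally by (simp_all add: frame4)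
          have r4: "r4 rCum = complex_of_real (weight (\<rho> @ [p]))" "r4 rPick = of_nat p"
            using 4 r3 tally by simp_all
          have tally4: "r4 (tally + i) = of_nat (count_list \<rho> i)" if "i < m" for i
            using that tally inv'(8) by (subst frame4) auto
          \<comment> \<open>Multiplying the new count into \<open>rTFact\<close> updates the product
            of factorials. The cell \<open>tally + p\<close> lies below \<open>state\<close>, so the
            amplitudes are untouched.\<close>
          define r5 where "r5 = r4(rWeight := complex_of_real (weight (\<rho> @ [p])), rB := of_nat (tally + p),
            rDigit := of_nat (Suc (count_list \<rho> p)), tally + p := of_nat (Suc (count_list \<rho> p)),
            rTFact := of_nat (Suc (count_list \<rho> p)) * (\<Prod>j<m. fact (count_list \<rho> j)), rK := of_nat (Suc k))"
          have "static r5"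
            by (rule static_cong[OF inv'(2)]) (use frame4 tally in \<open>auto simp: r5_def\<close>)
          moreover have "amp_state (\<rho> @ [p]) r5"
            using 4 tally p(1) by (auto simp: amp_state_def r5_def)
          moreover have "(\<Prod>j<m. fact (count_list (\<rho> @ [p]) j)) =
              of_nat (Suc (count_list \<rho> p)) * (\<Prod>j<m. fact (count_list \<rho> j) :: complex)"
            using p(1) by (subst (1 2) prod.remove[of _ p]) (auto simp: algebra_simps)
          ultimately have "main_inv \<omega> (Suc k) r5 (Suc k)"
            unfolding main_inv_def next_\<rho>
            using regs4 tally4 tally p(1) by (auto simp: r5_def)
          thus "tri \<omega> (Block [Add rCum rZero rWeight, Add rTally rPick rB, Load rDigit rB, Add rDigit rOne rDigit,
            Store rB rDigit, Mul rTFact rDigit rTFact, Add rK rOne rK]) r4 q4 7 (main_inv \<omega> (Suc k))"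
            using 4 regs4 r4 tally tally4[OF p(1)]
            by (intro tri_block) (auto simp: r5_def add.commute elim!: back_subst[of "\<lambda>r. main_inv \<omega> (Suc k) r (Suc k)"])
        qed simp
      qed simp
    qed simp
  qed (simp add: photon_time_def)
qed

end

section \<open>The complete program\<close>

fun seqs :: "com list \<Rightarrow> com" where
  "seqs [] = Block []"
| "seqs (c # cs) = c ;; seqs cs"

text \<open>For loops unrolled in the code, where the index is a register number and hence part of
  the instructions.\<close>

lemma tri_seqs:
  assumes step: "\<And>k r q. l \<le> k \<Longrightarrow> k < h \<Longrightarrow> Inv k r q \<Longrightarrow> tri \<omega> (f k) r q b (Inv (Suc k))"
  shows "l \<le> h \<Longrightarrow> Inv l r q \<Longrightarrow> tri \<omega> (seqs (map f [l..<h])) r q ((h - l) * b) (Inv h)"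
  using step
proof (induction "h - l" arbitrary: l r q)
  case 0
  thus ?case by (auto intro: tri_block)
next
  case (Suc d)
  hence l: "l < h" by simp
  show ?case
    unfolding upt_conv_Cons[OF l] list.map seqs.simps
  proof (rule tri_seq[where ba = b and bb = "(h - Suc l) * b"])
    show "tri \<omega> (f l) r q b (Inv (Suc l))" using Suc.prems l by blast
    show "tri \<omega> (seqs (map f [Suc l..<h])) r' q' ((h - Suc l) * b) (Inv h)" if "Inv (Suc l) r' q'" for r' q'
      using Suc.hyps(2) Suc.prems l that by (intro Suc.hyps(1)) auto
    show "b + (h - Suc l) * b \<le> (h - l) * b"
      using l by (simp add: Suc_diff_Suc [symmetric])
  qed
qed

text \<open>At the start no cell is known to be free except 1, which holds n and can be recomputed. The
  address 16 (m^2 + m) is beyond the input, since m is at least 1, and at least 32.\<close>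
definition save_low :: com where
  "save_low =
     Block [Mul rM rM rOff, Add rOff rM rOff, Add rOff rOff rOff, Add rOff rOff rOff,
       Add rOff rOff rOff, Add rOff rOff rOff, Store rOff rOne] ;;
     seqs (map (\<lambda>k. Block [Const rOne 1, Add rOff rOne rOff, Store rOff k]) [3..<32])"

text \<open>\<open>save_low\<close> leaves \<open>rOff\<close> at the last cell written,
  \<open>off + 31\<close>, hence the subtraction. \<open>rIdx\<close> starts at
  \<open>m * m + 2\<close>, the input cell of the first occupation number.\<close>

definition init_regs :: com where
  "init_regs =
     Block [Const rOne 1, Const rZero 0, Const rLow 32, Const rThree 3, Const rB 31, Sub rOff rB rOff,
       Const rB 64, Add rOff rB rRecs, Add rM rM rB, Add rB rM rB, Add rRecs rB rTally,
       Add rTally rM rState, Add rState rOne rState, Const rDim 1, Const rN 0, Sub rM rOne rLast,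
       Mul rM rM rIdx, Add rIdx rOne rIdx, Add rIdx rOne rIdx, Const rI 0, Const rRow 2,
       Add rRecs rZero rEnd]"

text \<open>An empty mode gets no record and leaves \<open>rDim\<close> alone, its radix being 1.
  During this phase \<open>rRow\<close> holds 2 + i, the address of the first entry of column
  i.\<close>

definition build_body :: com where
  "build_body =
     Block [Add rIdx rZero rB] ;;
     Cond rLow rB (Block []) (Block [Add rB rOff rB]) ;;
     Block [Load rOcc rB] ;;
     Cond rOcc rZero (Block [])
       (Block [Store rEnd rDim, Add rEnd rOne rEnd, Store rEnd rOcc, Add rEnd rOne rEnd,
          Store rEnd rRow, Add rEnd rOne rEnd, Add rN rOcc rN, Add rOcc rOne rOcc, Mul rDim rOcc rDim]) ;;
     Block [Add rIdx rOne rIdx, Add rRow rOne rRow, Add rI rOne rI]"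

text \<open>The only nonzero initial derivative is 1, at s, which is the last index.
  \<open>entry\<close> is run there for its by-product \<open>rFact\<close>, the product of the
  factorials of s; the amplitude it computes is discarded.\<close>

definition init_state_vector :: com where
  "init_state_vector =
     Block [Add rState rDim rB, Sub rB rOne rB, Store rB rOne, Sub rDim rOne rIdx, Const rRow 0,
       Const rK 0, Const rTFact 1] ;;
     entry ;;
     Block [Add rFact rZero rSFact, Div rOne rFact rWeight]"

text \<open>The probability goes to the cell between counts and amplitudes, so that counts and
  probability form one block of m + 1 cells. Its part for the cells from 32 on is moved while the
  registers are still available.\<close>

definition copy_high :: com where
  "copy_high =
     Block [Mul rSFact rWeight rB, Div rB rTFact rB, Add rTally rM rDigit, Store rDigit rB,
       Const rI 32, Add rM rOne rDigit] ;;
     Until rDigit rI (Block [Add rTally rI rB, Load rB rB, Store rI rB, Add rI rOne rI])"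

text \<open>The count of mode 0 is first stashed at address \<open>2 * (tally + 1)\<close>: the
  pointer finally returns to \<open>tally + 1\<close> to load cell 1, and doubling then leads it to
  the stash. Each cell k to be filled first serves as the constant 1 that advances the
  pointer.\<close>

definition copy_low :: com where
  "copy_low =
     Block [Add rTally rOne rB, Add rB rB rB, Load rDigit rTally, Store rB rDigit, Add rTally rOne 0] ;;
     seqs (map (\<lambda>k. Block [Const k 1, Add 0 k 0, Load k 0]) [2..<32]) ;;
     Block [Const 1 30, Sub 0 1 0, Load 1 0, Add 0 0 0, Load 0 0]"

definition sampler :: com where
  "sampler =
     save_low ;; init_regs ;; Until rM rI build_body ;; init_state_vector ;;
     Until rN rK sample_photon ;; copy_high ;; copy_low"

context boson_sampling begin

section \<open>Correctness of the set-up\<close>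

abbreviation "input \<equiv> input_mem m n U s"

definition saved :: "(nat \<Rightarrow> complex) \<Rightarrow> bool" where
  "saved r \<longleftrightarrow> (\<forall>a. 2 \<le> a \<and> a < 2 + m * m + m \<longrightarrow> r (loc a) = input a) \<and> (\<forall>a\<ge>recs. r a = 0)"

lemma save_low:
  "tri \<omega> save_low input q 94 (\<lambda>r' q'. q' = q \<and> saved r' \<and> r' rM = of_nat m \<and> r' rOff = of_nat (off + 31))"
  unfolding save_low_def
proof (rule tri_seq[where ba = 7 and bb = 87])
  \<comment> \<open>\<open>rOff\<close> points to the last cell written. Register 2 can hold the
    constant 1 because its content is saved first, by the initial block.\<close>
  define Inv where "Inv k r' q' \<longleftrightarrow> q' = q \<and> r' rOff = of_nat (off + k - 1) \<and>
    (\<forall>i. 2 \<le> i \<and> i < k \<longrightarrow> r' (off + i) = input i) \<and>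
    (\<forall>a. a \<notin> {rOff, rOne} \<union> {off + 2..<off + k} \<longrightarrow> r' a = input a)" for k r' q'
  have off: "off + 2 = 16 * (m * m + m)" "off \<ge> 30" using layout by (simp_all add: off_def)
  have "complex_of_nat off + 2 = of_nat (off + 2)" by simp
  also have "\<dots> = 16 * (of_nat m * of_nat m + of_nat m)" unfolding off(1) by simp
  finally have off': "complex_of_nat off + 2 = 16 * (of_nat m * of_nat m + of_nat m)" .
  show "tri \<omega> (Block [Mul rM rM rOff, Add rOff rM rOff, Add rOff rOff rOff, Add rOff rOff rOff,
       Add rOff rOff rOff, Add rOff rOff rOff, Store rOff rOne]) input q 7 (Inv 3)"
  proof (rule tri_block)
    have r0: "input 0 = of_nat m" by (simp add: input_mem_def)
    have two: "2 \<le> i \<Longrightarrow> i < 3 \<Longrightarrow> i = 2" for i :: nat by simp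
    have "addr (16 * (complex_of_nat m * of_nat m + of_nat m)) = off + 2"
      unfolding off' [symmetric] by simp
    thus "case fold (effect \<omega>) [Mul rM rM rOff, Add rOff rM rOff, Add rOff rOff rOff, Add rOff rOff rOff,
       Add rOff rOff rOff, Add rOff rOff rOff, Store rOff rOne] (input, q) of (r', q') \<Rightarrow> Inv 3 r' q'"
      using off off' by (auto simp: Inv_def r0 algebra_simps dest: two)
  qed simp_all
  fix r1 q1 assume "Inv 3 r1 q1"
  have "tri \<omega> (seqs (map (\<lambda>k. Block [Const rOne 1, Add rOff rOne rOff, Store rOff k]) [3..<32])) r1 q1
    ((32 - 3) * 3) (Inv 32)"
  proof (rule tri_seqs)
    fix k r q assume k: "3 \<le> k" "k < 32" and inv: "Inv k r q"
    have "r rOff + 1 = of_nat (off + k)" "r k = input k"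
      using inv k off by (auto simp: Inv_def of_nat_diff)
    thus "tri \<omega> (Block [Const rOne 1, Add rOff rOne rOff, Store rOff k]) r q 3 (Inv (Suc k))"
      using inv k off by (intro tri_block) (auto simp: Inv_def less_Suc_eq simp del: of_nat_add)
  qed (use \<open>Inv 3 r1 q1\<close> in auto)
  thus "tri \<omega> (seqs (map (\<lambda>k. Block [Const rOne 1, Add rOff rOne rOff, Store rOff k]) [3..<32])) r1 q1 87
    (\<lambda>r' q'. q' = q \<and> saved r' \<and> r' rM = of_nat m \<and> r' rOff = of_nat (off + 31))"
  proof (rule tri_conseq)
    fix r' q' assume inv: "Inv 32 r' q'"
    have "r' (loc a) = input a" if "2 \<le> a" "a < 2 + m * m + m" for a
      using inv that layout by (auto simp: Inv_def loc_def)
    moreover have "r' a = 0" if "a \<ge> recs" for a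
      using inv that layout by (auto simp: Inv_def input_mem_def)
    ultimately show "q' = q \<and> saved r' \<and> r' rM = of_nat m \<and> r' rOff = of_nat (off + 31)"
      using inv off by (auto simp: Inv_def saved_def input_mem_def)
  qed simp
qed simp

definition num_occupied :: "nat \<Rightarrow> nat" where
  "num_occupied i = length (filter (\<lambda>j. s j \<noteq> 0) [0..<i])"

text \<open>The counterpart of \<open>static\<close> for the modes below i. The clause that memory
  beyond the records is zero later supplies the zero counts and the zero amplitudes of the initial
  state.\<close>

definition build_inv :: "nat \<Rightarrow> nat \<Rightarrow> (nat \<Rightarrow> complex) \<Rightarrow> nat \<Rightarrow> bool" where
  "build_inv q i r q' \<longleftrightarrow> q' = q \<and> r rM = of_nat m \<and> r rOff = of_nat off \<and> r rOne = 1 \<and> r rZero = 0 \<and> r rLow = 32 \<and>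
     r rRecs = of_nat recs \<and> r rEnd = of_nat (recs + 3 * num_occupied i) \<and>
     r rTally = of_nat tally \<and> r rState = of_nat state \<and> r rDim = of_nat (stride i) \<and>
     r rN = of_nat (\<Sum>l<i. s l) \<and> r rLast = of_nat (m - 1) \<and> r rThree = 3 \<and>
     r rI = of_nat i \<and> r rIdx = of_nat (2 + m * m + i) \<and> r rRow = of_nat (2 + i) \<and>
     (\<forall>a. 2 \<le> a \<and> a < 2 + m * m + m \<longrightarrow> r (loc a) = input a) \<and> (\<forall>a\<ge>recs + 3 * num_occupied i. r a = 0) \<and>
     (\<forall>k<num_occupied i. r (recs + 3 * k) = of_nat (stride (occupied ! k)) \<and>
        r (recs + 3 * k + 1) = of_nat (s (occupied ! k)) \<and>
        r (recs + 3 * k + 2) = of_nat (2 + occupied ! k))"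

lemma init_regs:
  assumes "saved r" "r rM = of_nat m" "r rOff = of_nat (off + 31)"
  shows "tri \<omega> init_regs r q 22 (build_inv q 0)"
proof -
  define r' where "r' = r(rOne := 1, rZero := 0, rLow := 32, rThree := 3, rOff := of_nat off,
    rB := of_nat (3 * m), rRecs := of_nat recs, rTally := of_nat tally, rState := of_nat state, rDim := 1, rN := 0,
    rLast := of_nat (m - 1), rIdx := of_nat (2 + m * m), rI := 0, rRow := 2, rEnd := of_nat recs)"
  have high: "r' a = r a" if "a \<ge> 32" for a using that by (simp add: r'_def)
  have "r' (loc a) = input a" if "2 \<le> a" "a < 2 + m * m + m" for a
    using that loc_bounds[of a] assms(1) by (subst high) (auto simp: saved_def)
  moreover have "r' a = 0" if "recs \<le> a" for a
    using that layout assms(1) by (subst high) (auto simp: saved_def)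
  ultimately have inv: "build_inv q 0 r' q"
    using assms(2) unfolding build_inv_def by (simp add: r'_def num_occupied_def stride_def)
  have "complex_of_nat m - 1 = of_nat (m - 1)" using m_pos by (simp add: of_nat_diff)
  hence "fold (effect \<omega>) [Const rOne 1, Const rZero 0, Const rLow 32, Const rThree 3, Const rB 31, Sub rOff rB rOff,
       Const rB 64, Add rOff rB rRecs, Add rM rM rB, Add rB rM rB, Add rRecs rB rTally,
       Add rTally rM rState, Add rState rOne rState, Const rDim 1, Const rN 0, Sub rM rOne rLast,
       Mul rM rM rIdx, Add rIdx rOne rIdx, Add rIdx rOne rIdx, Const rI 0, Const rRow 2,
       Add rRecs rZero rEnd] (r, q) = (r', q)"
    using assms layout by (auto simp: r'_def fun_eq_iff)
  thus ?thesis unfolding init_regs_def using inv by (intro tri_block) (simp_all only:, simp_all)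
qed

lemma num_occupied_Suc: "num_occupied (Suc i) = num_occupied i + (if s i = 0 then 0 else 1)"
  by (simp add: num_occupied_def)

lemma occupied_num_occupied:
  assumes "i < m" "s i \<noteq> 0"
  shows "occupied ! num_occupied i = i"
proof -
  have "[0..<m] = [0..<i] @ i # [Suc i..<m]"
    unfolding upt_conv_Cons[OF assms(1), symmetric] using upt_add_eq_append[of 0 i "m - i"] assms(1) by simp
  thus ?thesis using assms(2) by (simp add: occupied_def num_occupied_def nth_append)
qed

lemma build_body:
  assumes inv: "build_inv q i r q'" and i: "i < m"
  shows "tri \<omega> build_body r q' 20 (build_inv q (Suc i))"
proof -
  let ?a = "2 + m * m + i" and ?e = "recs + 3 * num_occupied i"
  note inv' = inv[unfolded build_inv_def]
  have lay: "recs \<ge> 94" using layout by simp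
  have loc: "32 \<le> loc ?a" "loc ?a < recs" using loc_bounds[of ?a] i by auto
  have "input ?a = of_nat (s i)" using i by (simp add: input_mem_def)
  moreover have "r (loc ?a) = input ?a" using inv' i by simp
  ultimately have si: "r (loc ?a) = of_nat (s i)" by simp
  define r2 where "r2 = r(rB := of_nat (loc ?a))"
  define r3 where "r3 = r2(rOcc := of_nat (s i))"
  define r4 where "r4 = (if s i = 0 then r3 else
    r3(?e := of_nat (stride i), ?e + 1 := of_nat (s i), ?e + 2 := of_nat (2 + i), rEnd := of_nat (?e + 3),
      rN := of_nat (\<Sum>l<Suc i. s l), rOcc := of_nat (s i + 1), rDim := of_nat (stride (Suc i))))"
  show ?thesis unfolding build_body_def
  proof (rule tri_seq[where ba = 1 and bb = 19])
    show "tri \<omega> (Block [Add rIdx rZero rB]) r q' 1 (\<lambda>r1 q1. q1 = q \<and> r1 = r(rB := of_nat ?a))"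
      using inv' by (intro tri_block) auto
  next
    fix r1 q1 assume 1: "q1 = q \<and> r1 = r(rB := of_nat ?a)"
    show "tri \<omega> (Cond rLow rB (Block []) (Block [Add rB rOff rB]) ;; Block [Load rOcc rB] ;;
     Cond rOcc rZero (Block [])
       (Block [Store rEnd rDim, Add rEnd rOne rEnd, Store rEnd rOcc, Add rEnd rOne rEnd,
          Store rEnd rRow, Add rEnd rOne rEnd, Add rN rOcc rN, Add rOcc rOne rOcc, Mul rDim rOcc rDim]) ;;
     Block [Add rIdx rOne rIdx, Add rRow rOne rRow, Add rI rOne rI]) r1 q1 19 (build_inv q (Suc i))"
    proof (rule tri_seq[where ba = 3 and bb = 16])
      have "32 \<le> real 2 + real (m * m) + real i \<longleftrightarrow> 32 \<le> ?a" by linarith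
      thus "tri \<omega> (Cond rLow rB (Block []) (Block [Add rB rOff rB])) r1 q1 3 (\<lambda>r' q'. q' = q \<and> r' = r2)"
        using 1 inv' by (intro tri_cond[where ba = 1] tri_block) (auto simp: r2_def loc_def)
    next
      fix r' q' assume 2: "q' = q \<and> r' = r2"
      show "tri \<omega> (Block [Load rOcc rB] ;;
         Cond rOcc rZero (Block [])
           (Block [Store rEnd rDim, Add rEnd rOne rEnd, Store rEnd rOcc, Add rEnd rOne rEnd,
              Store rEnd rRow, Add rEnd rOne rEnd, Add rN rOcc rN, Add rOcc rOne rOcc, Mul rDim rOcc rDim]) ;;
         Block [Add rIdx rOne rIdx, Add rRow rOne rRow, Add rI rOne rI]) r' q' 16 (build_inv q (Suc i))"
      proof (rule tri_seq[where ba = 1 and bb = 15])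
        show "tri \<omega> (Block [Load rOcc rB]) r' q' 1 (\<lambda>r' q'. q' = q \<and> r' = r3)"
          using 2 si loc by (intro tri_block) (auto simp: r3_def r2_def)
      next
        fix r' q' assume 3: "q' = q \<and> r' = r3"
        show "tri \<omega> (Cond rOcc rZero (Block [])
           (Block [Store rEnd rDim, Add rEnd rOne rEnd, Store rEnd rOcc, Add rEnd rOne rEnd,
              Store rEnd rRow, Add rEnd rOne rEnd, Add rN rOcc rN, Add rOcc rOne rOcc, Mul rDim rOcc rDim]) ;;
         Block [Add rIdx rOne rIdx, Add rRow rOne rRow, Add rI rOne rI]) r' q' 15 (build_inv q (Suc i))"
        proof (rule tri_seq[where ba = 11 and bb = 3])
          have regs: "r3 rOcc = of_nat (s i)" "r3 rZero = 0" "r3 rOne = 1" "r3 rEnd = of_nat ?e"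
              "r3 rDim = of_nat (stride i)" "r3 rRow = of_nat (2 + i)" "r3 rN = of_nat (\<Sum>l<i. s l)"
            using inv' by (simp_all add: r3_def r2_def)
          show "tri \<omega> (Cond rOcc rZero (Block [])
             (Block [Store rEnd rDim, Add rEnd rOne rEnd, Store rEnd rOcc, Add rEnd rOne rEnd,
              Store rEnd rRow, Add rEnd rOne rEnd, Add rN rOcc rN, Add rOcc rOne rOcc, Mul rDim rOcc rDim]))
             r' q' 11 (\<lambda>r' q'. q' = q \<and> r' = r4)"
          proof (rule tri_cond[where ba = 9])
            assume "Re (r' rOcc) \<le> Re (r' rZero)"
            hence "s i = 0" using 3 regs by simp
            thus "tri \<omega> (Block []) r' q' 9 (\<lambda>r' q'. q' = q \<and> r' = r4)"
              using 3 by (intro tri_block) (auto simp: r4_def)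
          next
            assume "\<not> Re (r' rOcc) \<le> Re (r' rZero)"
            hence "s i \<noteq> 0" using 3 regs by simp
            thus "tri \<omega> (Block [Store rEnd rDim, Add rEnd rOne rEnd, Store rEnd rOcc, Add rEnd rOne rEnd,
              Store rEnd rRow, Add rEnd rOne rEnd, Add rN rOcc rN, Add rOcc rOne rOcc, Mul rDim rOcc rDim])
              r' q' 9 (\<lambda>r' q'. q' = q \<and> r' = r4)"
              using 3 regs lay by (intro tri_block) (auto simp: r4_def fun_eq_iff stride_Suc distrib_left)
          qed simp
        next
          fix r' q' assume 4: "q' = q \<and> r' = r4"
          define r5 where "r5 = r4(rIdx := of_nat (2 + m * m + Suc i), rRow := of_nat (2 + Suc i), rI := of_nat (Suc i))"
          have high: "r4 a = r a" if "a \<ge> 32" "s i = 0 \<or> a \<notin> {?e..<?e + 3}" for a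
            using that lay by (auto simp: r4_def r3_def r2_def)
          have r5_high: "r5 a = r a" if "a \<ge> 32" "s i = 0 \<or> a \<notin> {?e..<?e + 3}" for a
            using high[OF that] that(1) by (simp add: r5_def)
          have low: "r4 rM = of_nat m" "r4 rOff = of_nat off" "r4 rOne = 1" "r4 rZero = 0" "r4 rLow = 32"
            "r4 rRecs = of_nat recs" "r4 rEnd = of_nat (recs + 3 * num_occupied (Suc i))"
            "r4 rTally = of_nat tally" "r4 rState = of_nat state" "r4 rDim = of_nat (stride (Suc i))"
            "r4 rN = of_nat (\<Sum>l<Suc i. s l)" "r4 rLast = of_nat (m - 1)" "r4 rThree = 3"
            "r4 rI = of_nat i" "r4 rIdx = of_nat (2 + m * m + i)" "r4 rRow = of_nat (2 + i)"
            using inv' lay by (simp_all add: r4_def r3_def r2_def num_occupied_Suc stride_Suc)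
          have "r5 (loc a) = input a" if "2 \<le> a" "a < 2 + m * m + m" for a
            using that loc_bounds[of a] inv' by (subst r5_high) auto
          moreover have "r5 a = 0" if "a \<ge> recs + 3 * num_occupied (Suc i)" for a
            using that inv' lay by (subst r5_high) (auto simp: num_occupied_Suc split: if_splits)
          moreover have "r5 (recs + 3 * k) = of_nat (stride (occupied ! k)) \<and>
            r5 (recs + 3 * k + 1) = of_nat (s (occupied ! k)) \<and>
            r5 (recs + 3 * k + 2) = of_nat (2 + occupied ! k)" if k: "k < num_occupied (Suc i)" for k
          proof (cases "k < num_occupied i")
            case True
            thus ?thesis using inv' lay by (subst (1 2 3) r5_high) auto
          next
            case False
            hence "s i \<noteq> 0" "k = num_occupied i" using k by (auto simp: num_occupied_Suc split: if_splits)
            thus ?thesis using i lay by (auto simp: occupied_num_occupied r5_def r4_def)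
          qed
          ultimately have "build_inv q (Suc i) r5 q"
            unfolding build_inv_def using low by (simp add: r5_def)
          moreover have "r5 = r4(rIdx := r4 rIdx + 1, rRow := r4 rRow + 1, rI := r4 rI + 1)"
            by (simp add: r5_def low fun_eq_iff)
          ultimately show "tri \<omega> (Block [Add rIdx rOne rIdx, Add rRow rOne rRow, Add rI rOne rI]) r' q' 3
              (build_inv q (Suc i))"
            using 4 low(3) by (intro tri_block) simp_all
        qed simp
      qed simp
    qed simp
  qed simp
qed

lemma build_inv_static:
  assumes inv: "build_inv q m r q'"
  shows "static r \<and> (\<forall>a\<ge>tally. r a = 0)"
proof -
  note inv' = inv[unfolded build_inv_def]
  have num: "num_occupied m = length occupied" by (simp add: num_occupied_def occupied_def)
  have "r (loc (2 + j + i * m)) = U i j" if "i < m" "j < m" for i j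
  proof -
    have "(j + i * m) div m = i" "(j + i * m) mod m = j" using that by simp_all
    moreover have "j + i * m < m * m" using matrix_index[OF that] by simp
    ultimately have "input (2 + j + i * m) = U i j" by (simp add: input_mem_def)
    moreover have "r (loc (2 + j + i * m)) = input (2 + j + i * m)"
      using inv' \<open>j + i * m < m * m\<close> by simp
    ultimately show ?thesis by simp
  qed
  moreover have "r a = 0" if "a \<ge> tally" for a
    using inv' that layout length_occupied by (auto simp: num)
  ultimately show ?thesis
    using inv' sum_s by (simp add: static_def num)
qed

lemma init_state_vector:
  assumes st: "static r" and zero: "\<And>a. a \<ge> tally \<Longrightarrow> r a = 0"
  shows "tri \<omega> init_state_vector r 0 (entry_time + 9) (main_inv \<omega> 0)"
  unfolding init_state_vector_def
proof (rule tri_seq[where ba = 7 and bb = "entry_time + 2"])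
  define N where "N = stride m"
  have N: "N > 0" by (simp add: N_def stride_pos)
  have lay: "tally \<ge> 94" "state = tally + m + 1" using layout by simp_all
  define z where "z = N - 1"
  define y where "y = state + z"
  have y: "y \<ge> 94" using lay by (simp add: y_def)
  define r1 where "r1 = r(rB := of_nat y, y := 1, rIdx := of_nat z, rRow := 0,
    rK := 0, rTFact := 1)"
  have regs: "r rState = of_nat state" "r rDim = of_nat N" "r rOne = 1"
    using st by (simp_all add: static_def N_def)
  have eq: "complex_of_nat state + of_nat N - 1 = of_nat y" "complex_of_nat N - 1 = of_nat z"
    using N by (simp_all add: of_nat_diff y_def z_def)
  show "tri \<omega> (Block [Add rState rDim rB, Sub rB rOne rB, Store rB rOne, Sub rDim rOne rIdx, Const rRow 0,
       Const rK 0, Const rTFact 1]) r 0 7 (\<lambda>r' q'. q' = 0 \<and> r' = r1)"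
    using regs y by (intro tri_block) (auto simp: r1_def eq simp del: of_nat_add)
  fix r' and q' :: nat assume 1: "q' = 0 \<and> r' = r1"
  have st1: "static r1" by (rule static_cong[OF st]) (use lay in \<open>auto simp: r1_def y_def\<close>)
  \<comment> \<open>Only the last index decodes to s, since \<open>encode\<close> inverts
    \<open>digits\<close>.\<close>
  have amp1: "amp_state [] r1"
  proof -
    have last: "digits z = s" "encode m s = z"
      using digits_last encode_digits[of z] N by (simp_all add: N_def z_def)
    have "digits x = s \<longleftrightarrow> x = z" if "x < N" for x
      using encode_digits[of x] that last unfolding N_def by metis
    hence "amp [] s (digits x) = (if x = z then 1 else 0)" if "x < N" for x
      using that by (simp add: amp_Nil eq_commute[of s])
    thus ?thesis using lay zero by (auto simp: amp_state_def r1_def y_def simp flip: N_def)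
  qed
  have "tri \<omega> entry r1 0 (length occupied * (5 * stride m + 22) + 5)
    (\<lambda>r' q'. q' = 0 \<and> (\<forall>a. a \<notin> {23..31} \<longrightarrow> r' a = r1 a) \<and>
      r' rFact = (\<Prod>j<m. fact (digits (N - 1) j)) \<and>
      r' rAmp = (\<Sum>j<m. U 0 j * amp [] s ((digits (N - 1))(j := Suc (digits (N - 1) j)))))"
    by (rule entry[OF st1]) (use N m_pos lay y in \<open>auto simp: r1_def N_def z_def intro: amp_outside\<close>)
  thus "tri \<omega> (entry ;; Block [Add rFact rZero rSFact, Div rOne rFact rWeight]) r' q' (entry_time + 2) (main_inv \<omega> 0)"
  unfolding 1[THEN conjunct1] 1[THEN conjunct2]
  proof (rule tri_seq[where bb = 2])
    fix r2 and q2 :: nat assume "q2 = 0 \<and> (\<forall>a. a \<notin> {23..31} \<longrightarrow> r2 a = r1 a) \<and>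
      r2 rFact = (\<Prod>j<m. fact (digits (N - 1) j)) \<and>
      r2 rAmp = (\<Sum>j<m. U 0 j * amp [] s ((digits (N - 1))(j := Suc (digits (N - 1) j))))"
    hence 2: "q2 = 0" "\<And>a. a \<notin> {23..31} \<Longrightarrow> r2 a = r1 a" "r2 rFact = (\<Prod>j<m. fact (s j))"
      using digits_last by (simp_all add: N_def)
    have regs2: "r2 rZero = 0" "r2 rOne = 1" using st1 2(2) by (auto simp: static_def)
    define r3 where "r3 = r2(rSFact := r2 rFact, rWeight := 1 / r2 rFact)"
    have "static r3" by (rule static_cong[OF st1]) (use 2(2) in \<open>auto simp: r3_def\<close>)
    moreover have "amp_state [] r3" using amp1 2(2) lay by (auto simp: amp_state_def r3_def)
    moreover have "r3 (tally + i) = 0" if "i < m" for i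
      using that lay zero 2(2) by (auto simp: r3_def r1_def y_def)
    moreover have "r3 rK = 0" "r3 rTFact = 1" using 2(2) lay by (auto simp: r3_def r1_def y_def)
    ultimately have "main_inv \<omega> 0 r3 0"
      using 2(3) by (simp add: main_inv_def weight_Nil r3_def)
    thus "tri \<omega> (Block [Add rFact rZero rSFact, Div rOne rFact rWeight]) r2 q2 2 (main_inv \<omega> 0)"
      using 2(1) regs2 by (intro tri_block) (simp_all add: r3_def)
  qed (simp add: entry_time_def)
qed simp

section \<open>Output of the counts and the probability\<close>

definition buffer_ok :: "nat list \<Rightarrow> (nat \<Rightarrow> complex) \<Rightarrow> bool" where
  "buffer_ok \<rho> r \<longleftrightarrow> (\<forall>i<m. r (tally + i) = of_nat (count_list \<rho> i)) \<and>
     r (tally + m) = complex_of_real ((\<Prod>j<m. fact (s j)) * weight \<rho> / (\<Prod>j<m. fact (count_list \<rho> j)))"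

lemma copy_high:
  assumes inv: "main_inv \<omega> n r q"
  shows "tri \<omega> copy_high r q (6 * m + 7) (\<lambda>r' q'. buffer_ok (picks \<omega> n) r' \<and> r' rTally = of_nat tally \<and>
    r' rOne = 1 \<and> (\<forall>i. 32 \<le> i \<and> i \<le> m \<longrightarrow> r' i = r' (tally + i)))"
proof -
  define \<rho> where "\<rho> = picks \<omega> n"
  define p where "p = (\<Prod>j<m. fact (s j)) * weight \<rho> / (\<Prod>j<m. fact (count_list \<rho> j))"
  have lay: "tally \<ge> 94 + 3 * m" using layout by simp
  have regs: "r rSFact = (\<Prod>j<m. fact (s j))" "r rTFact = (\<Prod>j<m. fact (count_list \<rho> j))"
      "r rWeight = complex_of_real (weight \<rho>)" "r rTally = of_nat tally" "r rM = of_nat m" "r rOne = 1"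
      "\<And>i. i < m \<Longrightarrow> r (tally + i) = of_nat (count_list \<rho> i)"
    using inv by (simp_all add: main_inv_def \<rho>_def static_def)
  define r1 where "r1 = r(rB := complex_of_real p, rDigit := of_nat (m + 1), tally + m := complex_of_real p, rI := 32)"
  have buf1: "buffer_ok \<rho> r1"
    using regs lay by (auto simp: buffer_ok_def r1_def p_def)
  have regs1: "r1 rTally = of_nat tally" "r1 rOne = 1" "r1 rDigit = of_nat (m + 1)" "r1 rI = of_nat 32"
    using regs lay by (simp_all add: r1_def)
  define Inv where "Inv k r' q' \<longleftrightarrow> r' rI = of_nat k \<and> (\<forall>i. 32 \<le> i \<and> i < k \<longrightarrow> r' i = r1 (tally + i)) \<and>
    (\<forall>a. a \<notin> {rI, rB} \<union> {32..<k} \<longrightarrow> r' a = r1 a)" for k and r' :: "nat \<Rightarrow> complex" and q' :: nat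
  have loop: "tri \<omega> (Until rDigit rI (Block [Add rTally rI rB, Load rB rB, Store rI rB, Add rI rOne rI])) r1 q (6 * m + 1)
    (\<lambda>r' q'. buffer_ok \<rho> r' \<and> r' rTally = of_nat tally \<and> r' rOne = 1 \<and>
      (\<forall>i. 32 \<le> i \<and> i \<le> m \<longrightarrow> r' i = r' (tally + i)))"
  \<comment> \<open>If m is below 32, the maximum makes the number of rounds 0.\<close>
  proof (rule tri_until[where l = 32 and K = "max 32 (m + 1)" and b = 4 and Inv = Inv])
    show "Inv 32 r1 q" using regs1 by (auto simp: Inv_def)
  next
    fix k r' q' assume k: "32 \<le> k" "k < max 32 (m + 1)" and inv: "Inv k r' q'"
    hence km: "k \<le> m" by simp
    have regs': "r' rTally = of_nat tally" "r' rOne = 1" "r' rDigit = of_nat (m + 1)" "r' rI = of_nat k"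
        "r' (tally + k) = r1 (tally + k)"
      using inv regs1 lay km by (auto simp: Inv_def)
    show "\<not> Re (r' rDigit) \<le> Re (r' rI) \<and>
      tri \<omega> (Block [Add rTally rI rB, Load rB rB, Store rI rB, Add rI rOne rI]) r' q' 4 (Inv (Suc k))"
    proof
      show "\<not> Re (r' rDigit) \<le> Re (r' rI)" using regs' km by simp
      show "tri \<omega> (Block [Add rTally rI rB, Load rB rB, Store rI rB, Add rI rOne rI]) r' q' 4 (Inv (Suc k))"
        using regs' inv k lay km by (intro tri_block) (auto simp: Inv_def less_Suc_eq)
    qed
  next
    fix r' q' assume inv: "Inv (max 32 (m + 1)) r' q'"
    have frame: "r' a = r1 a" if "a \<notin> {rI, rB}" "a < 32 \<or> a > m" for a
      using inv that by (auto simp: Inv_def)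
    have "r' (tally + i) = r1 (tally + i)" for i
      using lay by (intro frame) auto
    moreover have "r' i = r1 (tally + i)" if "32 \<le> i" "i \<le> m" for i
      using inv that by (auto simp: Inv_def)
    ultimately show "Re (r' rDigit) \<le> Re (r' rI) \<and> buffer_ok \<rho> r' \<and> r' rTally = of_nat tally \<and> r' rOne = 1 \<and>
      (\<forall>i. 32 \<le> i \<and> i \<le> m \<longrightarrow> r' i = r' (tally + i))"
      using buf1 inv regs1 by (auto simp: frame buffer_ok_def Inv_def max_def)
  next
    show "(max 32 (m + 1) - 32) * (4 + 2) + 1 \<le> 6 * m + 1" by (simp add: max_def)
  qed simp
  show ?thesis unfolding copy_high_def \<rho>_def [symmetric]
  proof (rule tri_seq[where ba = 6])
    show "tri \<omega> (Block [Mul rSFact rWeight rB, Div rB rTFact rB, Add rTally rM rDigit, Store rDigit rB,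
       Const rI 32, Add rM rOne rDigit]) r q 6 (\<lambda>r' q'. q' = q \<and> r' = r1)"
      using regs lay by (intro tri_block) (auto simp: r1_def p_def fun_eq_iff)
  qed (use loop in auto)
qed

text \<open>Every fixed register may be an output cell, so the pointer of the last copy lives in an
  output cell itself: it is loaded through itself, and moved by doubling, which needs no operand.\<close>
lemma copy_low:
  assumes tally: "r rTally = of_nat tally" "r rOne = 1"
    and high: "\<And>i. 32 \<le> i \<Longrightarrow> i \<le> m \<Longrightarrow> r i = r (tally + i)"
  shows "tri \<omega> copy_low r q 100 (\<lambda>r' q'. \<forall>i\<le>m. r' i = r (tally + i))"
  unfolding copy_low_def
proof (rule tri_seq[where ba = 5 and bb = 95])
  have lay: "tally \<ge> 94 + 3 * m" using layout by simp
  define Inv where "Inv k r' q' \<longleftrightarrow> r' 0 = of_nat (tally + k - 1) \<and> r' (2 * (tally + 1)) = r tally \<and>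
    (\<forall>i. 2 \<le> i \<and> i < k \<longrightarrow> r' i = r (tally + i)) \<and>
    (\<forall>a. 32 \<le> a \<and> a < 2 * (tally + 1) \<longrightarrow> r' a = r a)" for k and r' :: "nat \<Rightarrow> complex" and q' :: nat
  show "tri \<omega> (Block [Add rTally rOne rB, Add rB rB rB, Load rDigit rTally, Store rB rDigit, Add rTally rOne 0]) r q 5 (Inv 2)"
    using tally lay by (intro tri_block) (auto simp: Inv_def)
  fix r1 q1 assume 1: "Inv 2 r1 q1"
  show "tri \<omega> (seqs (map (\<lambda>k. Block [Const k 1, Add 0 k 0, Load k 0]) [2..<32]) ;;
     Block [Const 1 30, Sub 0 1 0, Load 1 0, Add 0 0 0, Load 0 0]) r1 q1 95 (\<lambda>r' q'. \<forall>i\<le>m. r' i = r (tally + i))"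
  proof (rule tri_seq[where ba = "(32 - 2) * 3" and bb = 5])
    show "tri \<omega> (seqs (map (\<lambda>k. Block [Const k 1, Add 0 k 0, Load k 0]) [2..<32])) r1 q1 ((32 - 2) * 3) (Inv 32)"
    proof (rule tri_seqs)
      fix k r' q' assume k: "2 \<le> k" "k < 32" and inv: "Inv k r' q'"
      have ptr: "r' 0 + 1 = of_nat (tally + k)" using inv k lay by (simp add: Inv_def of_nat_diff)
      have "r' (tally + k) = r (tally + k)" using inv k lay by (auto simp: Inv_def)
      thus "tri \<omega> (Block [Const k 1, Add 0 k 0, Load k 0]) r' q' 3 (Inv (Suc k))"
        using inv k lay ptr by (intro tri_block) (auto simp: Inv_def less_Suc_eq simp del: of_nat_add)
    qed (use 1 in auto)
  next
    fix r2 q2 assume inv: "Inv 32 r2 q2"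
    have ptr: "r2 0 - 30 = of_nat (tally + 1)" using inv lay by (simp add: Inv_def of_nat_diff)
    have dbl: "complex_of_nat (tally + 1) + of_nat (tally + 1) = of_nat (2 * (tally + 1))" by simp
    have "r2 (tally + 1) = r (tally + 1)" "r2 (2 * (tally + 1)) = r tally"
      using inv lay by (auto simp: Inv_def)
    moreover have "r2 i = r (tally + i)" if "2 \<le> i" "i \<le> m" for i
      using inv that high[of i] lay by (cases "i < 32") (auto simp: Inv_def)
    moreover have "i = 0 \<or> i = 1 \<or> 2 \<le> i" for i :: nat by linarith
    ultimately show "tri \<omega> (Block [Const 1 30, Sub 0 1 0, Load 1 0, Add 0 0 0, Load 0 0]) r2 q2 5
        (\<lambda>r' q'. \<forall>i\<le>m. r' i = r (tally + i))"
      using lay by (intro tri_block) (auto simp: ptr dbl simp del: of_nat_add of_nat_mult)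
  qed simp
qed simp

section \<open>Assembly and running time\<close>

definition total_time :: nat where
  "total_time = 94 + 22 + (m * 22 + 1) + (entry_time + 9) + (n * (photon_time + 2) + 1) + (6 * m + 7) + 100"

lemma sampler:
  "tri \<omega> sampler input 0 total_time (\<lambda>r' q'.
    (\<forall>i<m. r' i = of_nat (count_list (picks \<omega> n) i)) \<and>
    r' m = complex_of_real (bs_prob m U s (count_list (picks \<omega> n))))"
  unfolding sampler_def
proof (rule tri_seq[OF save_low, where bb = "total_time - 94"], elim conjE)
  fix r and q :: nat assume 1: "saved r" "r rM = of_nat m" "r rOff = of_nat (off + 31)" "q = 0"
  show "tri \<omega> (init_regs ;; Until rM rI build_body ;; init_state_vector ;;
     Until rN rK sample_photon ;; copy_high ;; copy_low) r q (total_time - 94) (\<lambda>r' q'.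
    (\<forall>i<m. r' i = of_nat (count_list (picks \<omega> n) i)) \<and>
    r' m = complex_of_real (bs_prob m U s (count_list (picks \<omega> n))))"
  proof (rule tri_seq[OF init_regs[OF 1(1-3)], where bb = "total_time - 116"])
    fix r' q' assume 2: "build_inv q 0 r' q'"
    show "tri \<omega> (Until rM rI build_body ;; init_state_vector ;;
       Until rN rK sample_photon ;; copy_high ;; copy_low) r' q' (total_time - 116) (\<lambda>r' q'.
      (\<forall>i<m. r' i = of_nat (count_list (picks \<omega> n) i)) \<and>
      r' m = complex_of_real (bs_prob m U s (count_list (picks \<omega> n))))"
    proof (rule tri_seq[where ba = "m * 22 + 1" and bb = "total_time - 117 - m * 22"])
      show "tri \<omega> (Until rM rI build_body) r' q' (m * 22 + 1)
          (\<lambda>r q. q = 0 \<and> static r \<and> (\<forall>a\<ge>tally. r a = 0))"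
      proof (rule tri_until[where l = 0 and K = m and b = 20 and Inv = "build_inv q"])
        fix k r q' assume "k < m" "build_inv q k r q'"
        thus "\<not> Re (r rM) \<le> Re (r rI) \<and> tri \<omega> build_body r q' 20 (build_inv q (Suc k))"
          using build_body by (simp add: build_inv_def)
      next
        fix r q' assume inv: "build_inv q m r q'"
        hence "Re (r rM) \<le> Re (r rI)" "q' = 0" using 1(4) by (simp_all add: build_inv_def)
        thus "Re (r rM) \<le> Re (r rI) \<and> q' = 0 \<and> static r \<and> (\<forall>a\<ge>tally. r a = 0)"
          using build_inv_static[OF inv] by blast
      qed (use 2 in auto)
    next
      fix r and q :: nat assume 3: "q = 0 \<and> static r \<and> (\<forall>a\<ge>tally. r a = 0)"
      show "tri \<omega> (init_state_vector ;; Until rN rK sample_photon ;; copy_high ;; copy_low) r q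
        (total_time - 117 - m * 22) (\<lambda>r' q'.
          (\<forall>i<m. r' i = of_nat (count_list (picks \<omega> n) i)) \<and>
          r' m = complex_of_real (bs_prob m U s (count_list (picks \<omega> n))))"
      proof (rule tri_seq[where ba = "entry_time + 9" and bb = "n * (photon_time + 2) + 6 * m + 108"])
        show "tri \<omega> init_state_vector r q (entry_time + 9) (main_inv \<omega> 0)"
          using 3 init_state_vector[of r \<omega>] by simp
        fix r q assume 4: "main_inv \<omega> 0 r q"
        show "tri \<omega> (Until rN rK sample_photon ;; copy_high ;; copy_low) r q
          (n * (photon_time + 2) + 6 * m + 108) (\<lambda>r' q'.
            (\<forall>i<m. r' i = of_nat (count_list (picks \<omega> n) i)) \<and>
            r' m = complex_of_real (bs_prob m U s (count_list (picks \<omega> n))))"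
        proof (rule tri_seq[where ba = "n * (photon_time + 2) + 1" and bb = "6 * m + 107"])
          show "tri \<omega> (Until rN rK sample_photon) r q (n * (photon_time + 2) + 1) (main_inv \<omega> n)"
          proof (rule tri_until[where l = 0 and K = n and b = photon_time and Inv = "main_inv \<omega>"])
            fix k r q assume "k < n" "main_inv \<omega> k r q"
            thus "\<not> Re (r rN) \<le> Re (r rK) \<and> tri \<omega> sample_photon r q photon_time (main_inv \<omega> (Suc k))"
              using sample_photon by (simp add: main_inv_def static_def)
          next
            fix r q assume "main_inv \<omega> n r q"
            thus "Re (r rN) \<le> Re (r rK) \<and> main_inv \<omega> n r q"
              by (simp add: main_inv_def static_def)
          qed (use 4 in auto)
          fix r q assume 5: "main_inv \<omega> n r q"
          show "tri \<omega> (copy_high ;; copy_low) r q (6 * m + 107) (\<lambda>r' q'.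
            (\<forall>i<m. r' i = of_nat (count_list (picks \<omega> n) i)) \<and>
            r' m = complex_of_real (bs_prob m U s (count_list (picks \<omega> n))))"
          proof (rule tri_seq[OF copy_high[OF 5], where bb = 100])
            fix r' and q' :: nat
            assume 6: "buffer_ok (picks \<omega> n) r' \<and> r' rTally = of_nat tally \<and> r' rOne = 1 \<and>
              (\<forall>i. 32 \<le> i \<and> i \<le> m \<longrightarrow> r' i = r' (tally + i))"
            have "bs_prob m U s (count_list (picks \<omega> n)) =
                (\<Prod>j<m. fact (s j)) * weight (picks \<omega> n) / (\<Prod>j<m. fact (count_list (picks \<omega> n) j))"
              by (rule bs_prob_weight) (simp_all add: set_picks count_list_occ)
            thus "tri \<omega> copy_low r' q' 100 (\<lambda>r' q'.
              (\<forall>i<m. r' i = of_nat (count_list (picks \<omega> n) i)) \<and>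
              r' m = complex_of_real (bs_prob m U s (count_list (picks \<omega> n))))"
              using 6 by (intro tri_conseq[OF copy_low[of r']]) (auto simp: buffer_ok_def)
          qed simp
        qed simp
      qed (simp add: total_time_def)
    qed (simp add: total_time_def)
  qed (simp add: total_time_def)
qed (simp add: total_time_def)

text \<open>The quantities m, n, N and \<alpha> are all at least 1, so lower-order terms can be
  absorbed into the leading product. The constants add up to 36 for an entry, 46 for a candidate,
  110 for a photon and 408 in total, which is below 500.\<close>

lemma total_time_bound: "total_time \<le> 500 * time_bound m s"
proof -
  define \<alpha> where "\<alpha> = length occupied"
  define N where "N = stride m"
  have N: "N \<ge> 1" using stride_pos[of m] by (simp add: N_def)
  have card: "card {i. i < m \<and> s i \<noteq> 0} = \<alpha>"
    using distinct_card[OF distinct_occupied] by (simp add: \<alpha>_def set_occupied)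
  \<comment> \<open>Here at least one photon is needed: without an occupied mode
    \<open>time_bound\<close> would be 0.\<close>
  have "\<alpha> \<noteq> 0"
  proof
    assume "\<alpha> = 0"
    hence "\<forall>i<m. s i = 0" using set_occupied by (auto simp: \<alpha>_def)
    thus False using sum_s n_pos by simp
  qed
  hence \<alpha>: "\<alpha> \<ge> 1" by simp
  have aN: "1 \<le> \<alpha> * N" "\<alpha> \<le> \<alpha> * N" using \<alpha> N by simp_all
  have "entry_time = 5 * (\<alpha> * N) + 22 * \<alpha> + 9"
    by (simp add: entry_time_def N_def \<alpha>_def algebra_simps)
  hence entry: "entry_time \<le> 36 * (\<alpha> * N)" using aN by linarith
  define X where "X = N * (\<alpha> * N)"
  have X: "1 \<le> X" "N \<le> X" "\<alpha> * N \<le> X" using aN N by (simp_all add: X_def)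
  have "N * entry_time \<le> N * (36 * (\<alpha> * N))" using entry by (rule mult_left_mono) simp
  hence N_entry: "N * entry_time \<le> 36 * X" by (simp add: X_def)
  have "scan_time = N * entry_time + 3 * N + 7"
    by (simp add: scan_time_def N_def algebra_simps)
  hence scan: "scan_time \<le> 46 * X" using N_entry X by linarith
  have mX: "X \<le> m * X" "m \<le> m * X" using m_pos X(1) by simp_all
  have "(m - 1) * (scan_time + 2) \<le> m * (48 * X)"
    using scan X by (intro mult_mono) auto
  moreover have "photon_time = (m - 1) * (scan_time + 2) + N * entry_time + 5 * N + 19"
    by (simp add: photon_time_def N_def algebra_simps)
  ultimately have "photon_time + 2 \<le> 110 * (m * X)" using N_entry X mX by linarith
  hence "n * (photon_time + 2) \<le> n * (110 * (m * X))" by (rule mult_left_mono) simp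
  moreover have "m * X \<le> n * (m * X)" using n_pos by simp
  moreover have "total_time = n * (photon_time + 2) + entry_time + 28 * m + 234"
    by (simp add: total_time_def)
  ultimately have "total_time \<le> 500 * (n * (m * X))" using mX X entry by linarith
  moreover have "time_bound m s = n * (m * X)"
  proof -
    have "(\<Prod>j<m. (s j + 1)\<^sup>2) = N * N"
      by (simp only: N_def stride_def power2_eq_square prod.distrib)
    thus ?thesis unfolding time_bound_def sum_s card by (simp add: X_def mult_ac)
  qed
  ultimately show ?thesis by simp
qed

text \<open>Each run is deterministic for its random sequence \<omega> and computes
  \<open>picks\<close>; probability enters only through \<open>measure_count_picks\<close>.\<close>

lemma sampler_correct:
  defines "P \<equiv> compile 0 sampler"
  shows "\<exists>t \<le> 500 * time_bound m s. halted P (run P \<omega> t (init_state m n U s))"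
    and "outputs m (final_mem P \<omega> (init_state m n U s)) T \<longleftrightarrow> (\<forall>i<m. count_list (picks \<omega> n) i = T i)"
    and "final_mem P \<omega> (init_state m n U s) m = complex_of_real (bs_prob m U s (count_list (picks \<omega> n)))"
proof -
  obtain t r' q' where run: "big \<omega> sampler (input, 0) t (r', q')" "t \<le> total_time"
      and r': "\<forall>i<m. r' i = of_nat (count_list (picks \<omega> n) i)"
        "r' m = complex_of_real (bs_prob m U s (count_list (picks \<omega> n)))"
    using sampler[of \<omega>] unfolding tri_def by blast
  note fin = final_mem_compile[OF run(1), folded init_state_def P_def]
  show "\<exists>t \<le> 500 * time_bound m s. halted P (run P \<omega> t (init_state m n U s))"
    using fin(1) run(2) total_time_bound by (meson order_trans)
  show "outputs m (final_mem P \<omega> (init_state m n U s)) T \<longleftrightarrow> (\<forall>i<m. count_list (picks \<omega> n) i = T i)"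
    using r'(1) by (auto simp: outputs_def fin(2))
  show "final_mem P \<omega> (init_state m n U s) m = complex_of_real (bs_prob m U s (count_list (picks \<omega> n)))"
    using r'(2) by (simp add: fin(2))
qed

end

theorem theorem2:
  shows "\<exists>(P :: instr list) (C :: nat).
    \<forall>m n U s. m \<ge> 1 \<and> n \<ge> 1 \<and> unitary_mat m U \<and> occ_vec m n s \<longrightarrow>
      (\<forall>\<omega>\<in>space rand_space.
         (\<exists>t \<le> C * time_bound m s. halted P (run P \<omega> t (init_state m n U s))) \<and>
         (\<exists>T. occ_vec m n T \<and> outputs m (final_mem P \<omega> (init_state m n U s)) T \<and>
              final_mem P \<omega> (init_state m n U s) m = complex_of_real (bs_prob m U s T))) \<and>
      (\<forall>T. occ_vec m n T \<longrightarrow>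
         measure rand_space
           {\<omega> \<in> space rand_space. outputs m (final_mem P \<omega> (init_state m n U s)) T}
         = bs_prob m U s T)"
proof (rule exI[of _ "compile 0 sampler"], rule exI[of _ 500], intro allI impI, elim conjE)
  fix m n :: nat and U s
  assume "m \<ge> 1" "n \<ge> 1" "unitary_mat m U" "occ_vec m n s"
  \<comment> \<open>\<open>sampler\<close> and the constant 500 do not depend on the parameters of
    the locale, so they could be fixed before entering it.\<close>
  then interpret boson_sampling m n U s by unfold_locales
  note correct = sampler_correct
  have occ_picks: "occ_vec m n (count_list (picks \<omega> n))" for \<omega>
    by (rule count_list_occ) (simp_all add: set_picks)
  show "(\<forall>\<omega>\<in>space rand_space.
         (\<exists>t \<le> 500 * time_bound m s. halted (compile 0 sampler) (run (compile 0 sampler) \<omega> t (init_state m n U s))) \<and>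
         (\<exists>T. occ_vec m n T \<and> outputs m (final_mem (compile 0 sampler) \<omega> (init_state m n U s)) T \<and>
              final_mem (compile 0 sampler) \<omega> (init_state m n U s) m = complex_of_real (bs_prob m U s T))) \<and>
      (\<forall>T. occ_vec m n T \<longrightarrow>
         measure rand_space
           {\<omega> \<in> space rand_space. outputs m (final_mem (compile 0 sampler) \<omega> (init_state m n U s)) T}
         = bs_prob m U s T)"
  proof (intro conjI ballI allI impI)
    fix \<omega>
    show "\<exists>T. occ_vec m n T \<and> outputs m (final_mem (compile 0 sampler) \<omega> (init_state m n U s)) T \<and>
              final_mem (compile 0 sampler) \<omega> (init_state m n U s) m = complex_of_real (bs_prob m U s T)"
      using occ_picks[of \<omega>] correct(2,3)[of \<omega>] by blast
  next
    fix T assume "occ_vec m n T"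
    thus "measure rand_space
        {\<omega> \<in> space rand_space. outputs m (final_mem (compile 0 sampler) \<omega> (init_state m n U s)) T}
      = bs_prob m U s T"
      unfolding correct(2) by (rule measure_count_picks)
  qed (rule correct(1))
qed

end
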